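(* Fix $\gamma>1$, $\underline{\rho}>0$, $L>0$, $T_*>0$, $\beta_*<0$ and real constants $\kappa_1,\kappa_2$ with $|\kappa_1|<1$, $|\kappa_2|<1$. There exist a (small) constant $\epsilon_1>0$ and a constant $C_E>0$ such that the following holds for every $0<\epsilon<\epsilon_1$, every $C^2$ function $\beta:D\to\mathbb{R}$ satisfying $$\beta_*\le\beta(t,x)\le0,\qquad |\partial_t\beta(t,x)|,\ |\partial_x\beta(t,x)|\le\epsilon,\qquad \beta(t+T_*,x)=\beta(t,x)\qquad\text{on } D,$$ and all $C^1$ functions $\phi_{1_b},\phi_{2_b}:\mathbb{R}_+\to\mathbb{R}$ satisfying $$\phi_{i_b}(t+T_* )=\phi_{i_b}(t)\ (t>0),\qquad \|\phi_{i_b}\|_{C^1(\mathbb{R}_+)}\le\epsilon,\qquad i=1,2.$$ There exists a $C^1$ function $\phi_0=(\phi_{1_0},\phi_{2_0})^\top:[0,L]\to\mathbb{R}^2$ with $\|\phi_0\|_{C^1([0,L])}\le C_E\epsilon$ such that the initial-boundary value problem $$\partial_t\phi_i+\lambda_i(\phi+\Phi)\,\partial_x\phi_i=\tfrac{\beta}{2}(\phi_1+\phi_2)\ \text{ on } D,\quad i=1,2,$$ $$\phi(0,x)=\phi_0(x),\qquad \phi_2(t,0)=\phi_{2_b}(t)+\kappa_2\phi_1(t,0),\qquad \phi_1(t,L)=\phi_{1_b}(t)+\kappa_1\phi_2(t,L)\quad(x\in[0,L],\ t\ge0)$$ admits a $C^1$ solution $\phi=\phi^{(T_* )}(t,x)$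 on $D$ that is time-periodic, i.e. $\phi^{(T_* )}(t+T_*,x)=\phi^{(T_* )}(t,x)$ for all $(t,x)\in D$, and satisfies $\|\phi^{(T_* )}\|_{C^1(D)}\le C_E\epsilon$.
   Context: $\mathbb{R}_+=[0,\infty)$ and $D=\{(t,x): t\in\mathbb{R}_+,\ x\in[0,L]\}$. For $(m,n)\in\mathbb{R}^2$, $$\lambda_1(m,n)=\tfrac{\gamma+1}{2}m+\tfrac{3-\gamma}{2}n,\qquad \lambda_2(m,n)=\tfrac{3-\gamma}{2}m+\tfrac{\gamma+1}{2}n .$$ $\Phi=(\underline m,\underline n)^\top$ with $-\underline m=\underline n=\frac{\sqrt\gamma}{\gamma-1}\underline\rho^{\frac{\gamma-1}{2}}$, so that $\lambda_1(\Phi)=-\sqrt\gamma\,\underline\rho^{\frac{\gamma-1}{2}}<0<\lambda_2(\Phi)=\sqrt\gamma\,\underline\rho^{\frac{\gamma-1}{2}}$. The unknown is $\phi=(\phi_1,\phi_2)^\top$; $\phi=(m,n)^\top-\Phi$ is the perturbation of the Riemann invariants $m=\frac12(u-\frac{2}{\gamma-1}c)$, $n=\frac12(u+\frac{2}{\gamma-1}c)$, $c=\sqrt{\gamma}\rho^{\frac{\gamma-1}{2}}$, of the isentropic Euler system $\partial_t\rho+\partial_x(\rho u)=0$, $\partial_t(\rho u)+\partial_x(\rho u^2+\rho^\gamma)=\beta\rho u$, around the state $(\rho,u)=(\underline\rho,0)$. The $C^1$ norm of a (vector) function is the maximum, over its components, of the sup norms of the component and of all its first-order partial derivatives. *)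

theory Defs
  imports "HOL-Analysis.Analysis"
begin

text \<open>Only the values of a function on its nominal domain matter below: all derivatives are taken
  within that domain, so they are one-sided at its boundary, and all suprema range over it.
  Sup norms take values in \<^typ>\<open>ereal\<close>, so that an unbounded function has norm \<open>\<infinity>\<close>
  rather than an unspecified real one.\<close>

definition sup_norm :: "'a set \<Rightarrow> ('a \<Rightarrow> 'b::euclidean_space) \<Rightarrow> ereal" where
  "sup_norm S f = (MAX b\<in>Basis. SUP p\<in>S. ereal \<bar>f p \<bullet> b\<bar>)"

definition C1_on :: "real set \<Rightarrow> (real \<Rightarrow> 'b::euclidean_space) \<Rightarrow> bool" where
  "C1_on I f \<longleftrightarrow>
     (\<forall>t\<in>I. f differentiable (at t within I)) \<and>
     continuous_on I (\<lambda>t. vector_derivative f (at t within I))"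

definition C1_norm :: "real set \<Rightarrow> (real \<Rightarrow> 'b::euclidean_space) \<Rightarrow> ereal" where
  "C1_norm I f = max (sup_norm I f) (sup_norm I (\<lambda>t. vector_derivative f (at t within I)))"

text \<open>Functions of the pair \<open>(t, x)\<close>, on a set \<open>S\<close> in the \<open>(t, x)\<close>-plane.\<close>

definition partial_t :: "(real \<times> real) set \<Rightarrow> (real \<times> real \<Rightarrow> 'b::euclidean_space) \<Rightarrow> real \<times> real \<Rightarrow> 'b" where
  "partial_t S f = (\<lambda>(t, x). vector_derivative (\<lambda>s. f (s, x)) (at t within {s. (s, x) \<in> S}))"

definition partial_x :: "(real \<times> real) set \<Rightarrow> (real \<times> real \<Rightarrow> 'b::euclidean_space) \<Rightarrow> real \<times> real \<Rightarrow> 'b" where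
  "partial_x S f = (\<lambda>(t, x). vector_derivative (\<lambda>y. f (t, y)) (at x within {y. (t, y) \<in> S}))"

definition C1_on2 :: "(real \<times> real) set \<Rightarrow> (real \<times> real \<Rightarrow> 'b::euclidean_space) \<Rightarrow> bool" where
  "C1_on2 S f \<longleftrightarrow>
     (\<forall>(t, x)\<in>S. (\<lambda>s. f (s, x)) differentiable (at t within {s. (s, x) \<in> S}) \<and>
                 (\<lambda>y. f (t, y)) differentiable (at x within {y. (t, y) \<in> S})) \<and>
     continuous_on S f \<and> continuous_on S (partial_t S f) \<and> continuous_on S (partial_x S f)"

definition C2_on2 :: "(real \<times> real) set \<Rightarrow> (real \<times> real \<Rightarrow> 'b::euclidean_space) \<Rightarrow> bool" where
  "C2_on2 S f \<longleftrightarrow> C1_on2 S f \<and> C1_on2 S (partial_t S f) \<and> C1_on2 S (partial_x S f)"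

definition C1_norm2 :: "(real \<times> real) set \<Rightarrow> (real \<times> real \<Rightarrow> 'b::euclidean_space) \<Rightarrow> ereal" where
  "C1_norm2 S f = max (sup_norm S f) (max (sup_norm S (partial_t S f)) (sup_norm S (partial_x S f)))"

definition dom_D :: "real \<Rightarrow> (real \<times> real) set" where
  "dom_D L = {0..} \<times> {0..L}"

text \<open>The characteristic speeds, evaluated at the Riemann invariants
  \<open>(m, n) = (w $ 1, w $ 2)\<close>.\<close>

definition char_speed :: "real \<Rightarrow> real^2 \<Rightarrow> real^2" where
  "char_speed \<gamma> w = vector
     [(\<gamma> + 1) / 2 * w $ 1 + (3 - \<gamma>) / 2 * w $ 2,
      (3 - \<gamma>) / 2 * w $ 1 + (\<gamma> + 1) / 2 * w $ 2]"

text \<open>The Riemann invariants of the constant state with density \<open>\<rho>\<close> and velocity \<open>0\<close>.\<close>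

definition background :: "real \<Rightarrow> real \<Rightarrow> real^2" where
  "background \<gamma> \<rho> = vector
     [- (sqrt \<gamma> / (\<gamma> - 1) * \<rho> powr ((\<gamma> - 1) / 2)),
      sqrt \<gamma> / (\<gamma> - 1) * \<rho> powr ((\<gamma> - 1) / 2)]"

definition IBVP_solution ::
  "real \<Rightarrow> real \<Rightarrow> real \<Rightarrow> real \<Rightarrow> real \<Rightarrow> (real \<times> real \<Rightarrow> real) \<Rightarrow>
   (real \<Rightarrow> real) \<Rightarrow> (real \<Rightarrow> real) \<Rightarrow> (real \<Rightarrow> real^2) \<Rightarrow> (real \<times> real \<Rightarrow> real^2) \<Rightarrow> bool" where
  "IBVP_solution \<gamma> \<rho> L \<kappa>1 \<kappa>2 \<beta> \<phi>1b \<phi>2b \<phi>0 \<phi> \<longleftrightarrow>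
     C1_on2 (dom_D L) \<phi> \<and>
     (\<forall>p\<in>dom_D L. \<forall>i.
        partial_t (dom_D L) \<phi> p $ i
          + char_speed \<gamma> (\<phi> p + background \<gamma> \<rho>) $ i * partial_x (dom_D L) \<phi> p $ i
        = \<beta> p / 2 * (\<phi> p $ 1 + \<phi> p $ 2)) \<and>
     (\<forall>x\<in>{0..L}. \<phi> (0, x) = \<phi>0 x) \<and>
     (\<forall>t\<ge>0. \<phi> (t, 0) $ 2 = \<phi>2b t + \<kappa>2 * \<phi> (t, 0) $ 1) \<and>
     (\<forall>t\<ge>0. \<phi> (t, L) $ 1 = \<phi>1b t + \<kappa>1 * \<phi> (t, L) $ 2)"

end

theory Submission
  imports Defs
begin

text \<open>Take \<open>x\<close> as the evolution variable and reflect the first component in \<open>x\<close>: both Riemann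
  invariants then enter at \<open>x = 0\<close> and solve \<open>\<partial>\<^sub>x u + a(u) \<partial>\<^sub>t u = - k u + G(u)\<close>, where
  \<open>k = - \<beta>(0,0)/(2\<mu>) \<ge> 0\<close>, with \<open>\<mu>\<close> the sound speed of the background state, may be
  taken constant because \<open>\<beta>\<close> varies only by \<open>O(\<epsilon>)\<close>. Integration along the characteristics, which are treated as unknowns alongside \<open>u\<close>, gives a fixed point equation on
  profiles that are periodic on the whole time axis. It is a contraction in the sup norm: the
  boundary coefficients satisfy \<open>\<bar>\<kappa>\<bar> < 1\<close>, the damping never amplifies the sup norm, and the
  dependence on the characteristics costs only \<open>O(\<epsilon>)\<close>. The time derivatives of the iterates obey a
  linearised equation that contracts for the same reason, so by fibre contraction they converge
  uniformly, and the fixed point is \<open>C\<^sup>1\<close> in time. Uniqueness of the characteristics then yields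
  the \<open>x\<close>-derivative and the differential equation.\<close>

section \<open>Contractions of function families\<close>

text \<open>The obstacle is a loss of derivative. The characteristics depend on the profile, so
  composing with them is Lipschitz only in the sup norm and only on profiles with a Lipschitz bound
  in time; a contraction in a C^1 norm would need a modulus of continuity for first derivatives.
  Hence the derivatives are followed separately, with mere continuity in the base point. The zero
  order term is of order one and cannot be treated as small. Its diagonal part goes into an
  exponential factor and the coupling to the other component has gain exactly k, so a transit of
  length x multiplies the sup norm by at most e^(-kx) \<kappa> + (1 - e^(-kx)) = 1 - e^(-kx) (1 -
  \<kappa>), which stays below 1 uniformly for 0 \<le> k \<le> -\<open>\<beta>min\<close>/(2\<mu>).
  This is where the sign of \<beta> and the bounds on the reflection coefficients enter. With x as
  evolution variable the boundary feedback becomes inflow data and periodicity is a property of the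
  function space; the initial datum is then simply the trace of the solution at t = 0.\<close>

definition near :: "real \<Rightarrow> ('i \<Rightarrow> 'a \<Rightarrow> real) \<Rightarrow> ('i \<Rightarrow> 'a \<Rightarrow> real) \<Rightarrow> bool" where
  "near d f g \<longleftrightarrow> (\<forall>i p. \<bar>f i p - g i p\<bar> \<le> d)"

lemma nearD: "near d f g \<Longrightarrow> \<bar>f i p - g i p\<bar> \<le> d"
  by (simp add: near_def)

lemma near_commute: "near d f g \<longleftrightarrow> near d g f"
  by (simp add: near_def abs_minus_commute)

lemma near_trans:
  assumes "near d f g" "near e g h"
  shows "near (d + e) f h"
  unfolding near_def
proof (intro allI)
  fix i p
  show "\<bar>f i p - h i p\<bar> \<le> d + e"
    using nearD[OF assms(1), of i p] nearD[OF assms(2), of i p] by linarith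
qed

lemma near_mono: "near d f g \<Longrightarrow> d \<le> e \<Longrightarrow> near e f g"
  unfolding near_def by (meson order_trans)

lemma near_tendsto:
  assumes "\<And>n. near (e n) (f n) g" "e \<longlonglongrightarrow> 0"
  shows "(\<lambda>n. f n i p) \<longlonglongrightarrow> g i p"
proof -
  have "(\<lambda>n. f n i p - g i p) \<longlonglongrightarrow> 0"
    by (rule Lim_null_comparison[OF _ assms(2)]) (use assms(1) in \<open>auto simp: near_def\<close>)
  then show ?thesis by (simp add: LIM_zero_iff)
qed

lemma near_imp_uniform_limit:
  assumes "\<And>n. near (e n) (f n) g" "e \<longlonglongrightarrow> 0"
  shows "uniform_limit UNIV (\<lambda>n. f n i) (g i) sequentially"
proof (rule uniform_limitI)
  fix r :: real assume "r > 0"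
  then have "\<forall>\<^sub>F n in sequentially. e n < r" using assms(2) by (simp add: order_tendstoD(2))
  then show "\<forall>\<^sub>F n in sequentially. \<forall>p\<in>UNIV. dist (f n i p) (g i p) < r"
    by eventually_elim (use assms(1) in \<open>auto simp: near_def dist_real_def intro: le_less_trans\<close>)
qed

text \<open>The limit is the telescoping series of the increments, dominated by a geometric series
  uniformly in the index and the point; its tail gives the explicit rate.\<close>

lemma geometric_limit:
  fixes z :: "nat \<Rightarrow> 'i \<Rightarrow> 'a \<Rightarrow> real"
  assumes "\<And>n. near (D * \<theta> ^ n) (z (Suc n)) (z n)" "0 \<le> \<theta>" "\<theta> < 1"
  obtains f where "\<And>n. near (D * \<theta> ^ n / (1 - \<theta>)) (z n) f"
proof -
  define f where "f i p = z 0 i p + (\<Sum>n. z (Suc n) i p - z n i p)" for i p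
  have sm: "summable (\<lambda>n. D * \<theta> ^ n)"
    using assms(2,3) by (intro summable_mult summable_geometric) simp
  have b: "norm (z (Suc n) i p - z n i p) \<le> D * \<theta> ^ n" for n i p
    using assms(1) by (auto simp: near_def)
  have s: "summable (\<lambda>n. z (Suc n) i p - z n i p)" for i p
    by (rule summable_comparison_test'[OF sm, of 0]) (use b in auto)
  have "near (D * \<theta> ^ n / (1 - \<theta>)) (z n) f" for n
    unfolding near_def
  proof (intro allI)
    fix i p
    have "f i p = z n i p + (\<Sum>j. z (Suc (j + n)) i p - z (j + n) i p)"
    proof -
      have "(\<Sum>j. z (Suc j) i p - z j i p)
          = (\<Sum>j. z (Suc (j + n)) i p - z (j + n) i p) + (\<Sum>j<n. z (Suc j) i p - z j i p)"
        using suminf_split_initial_segment[OF s, of i p n] by simp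
      also have "(\<Sum>j<n. z (Suc j) i p - z j i p) = z n i p - z 0 i p"
        by (rule sum_lessThan_telescope)
      finally show ?thesis by (simp add: f_def)
    qed
    moreover have "norm (\<Sum>j. z (Suc (j + n)) i p - z (j + n) i p) \<le> (\<Sum>j. D * \<theta> ^ (j + n))"
      by (rule norm_suminf_le) (use b sm summable_ignore_initial_segment in auto)
    moreover have "(\<Sum>j. D * \<theta> ^ (j + n)) = D * \<theta> ^ n / (1 - \<theta>)"
    proof -
      have "(\<lambda>j. \<theta> ^ j) sums (1 / (1 - \<theta>))" using assms(2,3) by (intro geometric_sums) simp
      then have "(\<lambda>j. (D * \<theta> ^ n) * \<theta> ^ j) sums ((D * \<theta> ^ n) * (1 / (1 - \<theta>)))"
        by (rule sums_mult)
      then show ?thesis by (simp add: power_add sums_iff mult_ac)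
    qed
    ultimately show "\<bar>z n i p - f i p\<bar> \<le> D * \<theta> ^ n / (1 - \<theta>)" by simp
  qed
  then show ?thesis by (rule that)
qed

text \<open>A weighted maximum distance, written as a relation because flows are unbounded and only
  their differences are controlled. Flow errors are counted in units of \<open>M\<close>: the flow
  reacts to the profile with a constant of order one, which a large \<open>M\<close> absorbs, while
  the profile reacts to the flow with a small constant that tolerates the factor
  \<open>M\<close>.\<close>

definition near2 :: "real \<Rightarrow> real \<Rightarrow> ('i \<Rightarrow> 'a \<Rightarrow> real) \<times> ('j \<Rightarrow> 'b \<Rightarrow> real)
    \<Rightarrow> ('i \<Rightarrow> 'a \<Rightarrow> real) \<times> ('j \<Rightarrow> 'b \<Rightarrow> real) \<Rightarrow> bool" where
  "near2 M d f g \<longleftrightarrow> near d (fst f) (fst g) \<and> near (M * d) (snd f) (snd g)"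

lemma near2_trans:
  "near2 M d f g \<Longrightarrow> near2 M e g h \<Longrightarrow> near2 M (d + e) f h"
  unfolding near2_def distrib_left by (blast intro: near_trans)

lemma near2_commute: "near2 M d f g \<longleftrightarrow> near2 M d g f"
  by (simp add: near2_def near_commute)

lemma near2_mono: "near2 M d f g \<Longrightarrow> d \<le> e \<Longrightarrow> M \<ge> 0 \<Longrightarrow> near2 M e f g"
  unfolding near2_def by (meson near_mono mult_left_mono)

lemma near2_eqI:
  assumes "\<And>n. near2 M (e n) f g" "e \<longlonglongrightarrow> 0"
  shows "f = g"
proof -
  have "(\<lambda>n. fst f i p) \<longlonglongrightarrow> fst g i p" for i p
    by (rule near_tendsto[OF _ assms(2)]) (use assms(1) in \<open>simp add: near2_def\<close>)
  moreover have "(\<lambda>n. snd f i p) \<longlonglongrightarrow> snd g i p" for i p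
    by (rule near_tendsto[of "\<lambda>n. M * e n"])
      (use assms(1) tendsto_mult_right_zero[OF assms(2)] in \<open>auto simp: near2_def\<close>)
  ultimately show ?thesis by (auto simp: LIMSEQ_const_iff prod_eq_iff fun_eq_iff)
qed

text \<open>Banach's argument for one given orbit. It is the orbit that is assumed to stay in
  \<open>V\<close>, not that \<open>F\<close> maps \<open>V\<close> into itself: for the nonlinear
  map \<open>V\<close> contains a Lipschitz bound that is known for the iterates only through their
  derivatives. The null sequence \<open>e\<close> is returned since the uniform convergence is used
  again.\<close>

lemma contraction_limit:
  fixes z :: "nat \<Rightarrow> ('i \<Rightarrow> 'a \<Rightarrow> real) \<times> ('j \<Rightarrow> 'b \<Rightarrow> real)"
  assumes step: "\<And>n. z (Suc n) = F (z n)" and V: "\<And>n. z n \<in> V"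
    and contr: "\<And>f g d. f \<in> V \<Longrightarrow> g \<in> V \<Longrightarrow> near2 M d f g \<Longrightarrow> near2 M (\<theta> * d) (F f) (F g)"
    and init: "near2 M D (z (Suc 0)) (z 0)"
    and closed: "\<And>s e. (\<And>n. near2 M (e n) (z n) s) \<Longrightarrow> e \<longlonglongrightarrow> 0 \<Longrightarrow> s \<in> V"
    and \<theta>: "0 \<le> \<theta>" "\<theta> < 1"
  obtains s e where "s \<in> V" "F s = s" "e \<longlonglongrightarrow> 0" "\<And>n. near2 M (e n) (z n) s"
proof -
  have g: "near2 M (D * \<theta> ^ n) (z (Suc n)) (z n)" for n
  proof (induction n)
    case 0 then show ?case using init by simp
  next
    case (Suc n)
    then have "near2 M (\<theta> * (D * \<theta> ^ n)) (F (z (Suc n))) (F (z n))" by (intro contr V)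
    then show ?case unfolding step by (simp add: mult_ac)
  qed
  obtain f1 where f1: "\<And>n. near (D * \<theta> ^ n / (1 - \<theta>)) (fst (z n)) f1"
    using geometric_limit[of D \<theta> "\<lambda>n. fst (z n)"] g \<theta> unfolding near2_def by blast
  obtain f2 where f2: "\<And>n. near (M * D * \<theta> ^ n / (1 - \<theta>)) (snd (z n)) f2"
    using geometric_limit[of "M * D" \<theta> "\<lambda>n. snd (z n)"] g \<theta> unfolding near2_def
    by (metis mult.assoc)
  define e where "e n = D * \<theta> ^ n / (1 - \<theta>)" for n
  have near: "near2 M (e n) (z n) (f1, f2)" for n
    using f1[of n] f2[of n] by (simp add: near2_def e_def mult.assoc)
  have e: "e \<longlonglongrightarrow> 0"
    unfolding e_def using \<theta> LIMSEQ_realpow_zero[of \<theta>]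
    by (auto intro!: tendsto_eq_intros)
  have V': "(f1, f2) \<in> V" using near e by (rule closed)
  have "F (f1, f2) = (f1, f2)"
  proof (rule near2_eqI)
    fix n
    have "near2 M (\<theta> * e n) (F (f1, f2)) (z (Suc n))"
      unfolding step near2_commute[of _ _ "F (f1, f2)"] by (intro contr V V' near)
    then show "near2 M (\<theta> * e n + e (Suc n)) (F (f1, f2)) (f1, f2)"
      using near by (rule near2_trans)
  next
    show "(\<lambda>n. \<theta> * e n + e (Suc n)) \<longlonglongrightarrow> 0"
      using e LIMSEQ_Suc[OF e] by (auto intro!: tendsto_eq_intros)
  qed
  then show ?thesis using that V' near e by blast
qed

text \<open>Distances obeying d' \<le> \<theta> d + r, with r as small as desired from some index
  on, tend to zero. This is the convergence half of the fibre contraction principle, where the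
  perturbation is the effect of a base point that has not yet converged.\<close>

lemma perturbed_contraction_limit:
  assumes rec: "\<And>r. r > 0 \<Longrightarrow> \<exists>N. \<forall>n\<ge>N. \<forall>d. near2 M d (z n) s \<longrightarrow> near2 M (\<theta> * d + r) (z (Suc n)) s"
    and bdd: "\<And>n. near2 M D (z n) s"
    and \<theta>: "0 \<le> \<theta>" "\<theta> < 1" and M: "M \<ge> 0" and r: "r > 0"
  shows "\<forall>\<^sub>F n in sequentially. near2 M r (z n) s"
proof -
  \<comment> \<open>With this choice r/2 is the fixed point of d \<mapsto> \<theta> d + \<rho>, so
    the other half of r is left for the geometrically decaying part.\<close>
  define \<rho> where "\<rho> = r / 2 * (1 - \<theta>)"
  have "\<rho> > 0" using r \<theta> by (simp add: \<rho>_def)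
  then obtain N where N: "\<And>n d. n \<ge> N \<Longrightarrow> near2 M d (z n) s \<Longrightarrow> near2 M (\<theta> * d + \<rho>) (z (Suc n)) s"
    using rec by blast
  have b: "near2 M (\<theta> ^ j * D + r / 2) (z (N + j)) s" for j
  proof (induction j)
    case 0 then show ?case using near2_mono[OF bdd _ M] r by simp
  next
    case (Suc j)
    have "near2 M (\<theta> * (\<theta> ^ j * D + r / 2) + \<rho>) (z (Suc (N + j))) s"
      using N Suc by simp
    moreover have "\<theta> * (\<theta> ^ j * D + r / 2) + \<rho> = \<theta> ^ Suc j * D + r / 2"
      by (simp add: \<rho>_def field_simps)
    ultimately show ?case by simp
  qed
  have "(\<lambda>j. \<theta> ^ j * D) \<longlonglongrightarrow> 0"
    using tendsto_mult_left_zero[OF LIMSEQ_realpow_zero[OF \<theta>]] by simp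
  then have "\<forall>\<^sub>F j in sequentially. \<theta> ^ j * D < r / 2"
    using r by (intro order_tendstoD) auto
  then have "\<forall>\<^sub>F j in sequentially. near2 M r (z (j + N)) s"
    by eventually_elim (use near2_mono[OF b _ M] in \<open>auto simp: add.commute\<close>)
  then show ?thesis by (rule eventually_sequentially_seg[THEN iffD1])
qed

section \<open>Transport along characteristics\<close>

text \<open>For \<open>x > 0\<close> this is \<open>e\<^sup>-\<^sup>k\<^sup>x \<eta> + \<integral> e\<^sup>-\<^sup>k\<^sup>(\<^sup>x\<^sup>-\<^sup>s\<^sup>) g(s/x) ds\<close> over \<open>0 \<le> s \<le> x\<close>. Here and in
  \<open>drift\<close> below the integrals are rescaled to \<open>[0, 1]\<close>, so that continuity and differentiation in the
  parameters need no moving limits.\<close>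

definition damp :: "real \<Rightarrow> real \<Rightarrow> real \<Rightarrow> (real \<Rightarrow> real) \<Rightarrow> real" where
  "damp k x \<eta> g = exp (- k * x) * \<eta> + x * integral {0..1} (\<lambda>q. exp (- k * x * (1 - q)) * g q)"

lemma damp_diff:
  assumes "continuous_on {0..1} g" "continuous_on {0..1} g'"
  shows "damp k x \<eta> g - damp k x \<eta>' g' = damp k x (\<eta> - \<eta>') (\<lambda>q. g q - g' q)"
proof -
  have "integral {0..1} (\<lambda>q. exp (- k * x * (1 - q)) * g q) - integral {0..1} (\<lambda>q. exp (- k * x * (1 - q)) * g' q)
    = integral {0..1} (\<lambda>q. exp (- k * x * (1 - q)) * g q - exp (- k * x * (1 - q)) * g' q)"
    by (rule Henstock_Kurzweil_Integration.integral_diff[symmetric])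
      (use assms in \<open>auto intro!: integrable_continuous_interval continuous_intros\<close>)
  then show ?thesis
    unfolding damp_def by (simp add: algebra_simps)
qed

text \<open>The part k b of the source is integrated exactly, since k e^(-k(x-s)) has integral 1 -
  e^(-kx). Together with the inflow part this gives (1 - e^(-kx) (1 - \<kappa>)) b, which is largest
  at x = L. The remainder c is counted once at the inflow and over a length of at most L in the
  source, hence the factor 1 + L.\<close>

lemma damp_bound:
  assumes g: "continuous_on {0..1} g" and x: "0 \<le> x" "x \<le> L" and k: "k \<ge> 0"
    and \<kappa>: "\<kappa> < 1" and \<theta>: "1 - exp (- k * L) * (1 - \<kappa>) \<le> \<theta>" and bc: "b \<ge> 0" "c \<ge> 0"
    and \<eta>: "\<bar>\<eta>\<bar> \<le> \<kappa> * b + c" and gb: "\<And>q. 0 \<le> q \<Longrightarrow> q \<le> 1 \<Longrightarrow> \<bar>g q\<bar> \<le> k * b + c"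
  shows "\<bar>damp k x \<eta> g\<bar> \<le> \<theta> * b + (1 + L) * c"
proof -
  let ?E = "\<lambda>q. exp (- k * x * (1 - q))"
  have FTC: "((\<lambda>q. x * k * ?E q) has_integral (1 - exp (- k * x))) {0..1}"
  proof -
    have "((\<lambda>q. x * k * ?E q) has_integral (?E 1 - ?E 0)) {0..1}"
      by (rule fundamental_theorem_of_calculus)
        (auto simp: has_real_derivative_iff_has_vector_derivative[symmetric] intro!: derivative_eq_intros)
    then show ?thesis by simp
  qed
  have "norm (integral {0..1} (\<lambda>q. x * (?E q * g q))) \<le> integral {0..1} (\<lambda>q. b * (x * k * ?E q) + x * c)"
  proof (rule integral_norm_bound_integral)
    fix q :: real assume q: "q \<in> {0..1}"
    have E: "?E q \<le> 1" using q x k by (simp add: mult_nonneg_nonneg)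
    have "norm (x * (?E q * g q)) = x * ?E q * \<bar>g q\<bar>" using x by (simp add: abs_mult)
    also have "\<dots> \<le> x * ?E q * (k * b + c)" using q x by (intro mult_left_mono gb) auto
    also have "\<dots> = b * (x * k * ?E q) + x * (?E q * c)" by (simp add: algebra_simps)
    also have "\<dots> \<le> b * (x * k * ?E q) + x * (1 * c)"
      using E x bc by (intro add_left_mono mult_left_mono mult_right_mono) auto
    finally show "norm (x * (?E q * g q)) \<le> b * (x * k * ?E q) + x * c" by simp
  qed (use g in \<open>auto intro!: integrable_continuous_interval continuous_intros\<close>)
  also have "integral {0..1} (\<lambda>q. b * (x * k * ?E q) + x * c) = b * (1 - exp (- k * x)) + x * c"
    by (rule integral_unique) 
      (use has_integral_add[OF has_integral_mult_right[OF FTC, of b] has_integral_const_real[of "x * c" 0 1]] in simp)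
  finally have 1: "\<bar>x * integral {0..1} (\<lambda>q. ?E q * g q)\<bar> \<le> b * (1 - exp (- k * x)) + x * c"
    by simp
  have "\<bar>exp (- k * x) * \<eta>\<bar> \<le> exp (- k * x) * (\<kappa> * b + c)" using \<eta> by (simp add: abs_mult)
  moreover have "exp (- k * x) * c \<le> 1 * c" using bc k x by (intro mult_right_mono) auto
  moreover have "exp (- k * L) * (1 - \<kappa>) * b \<le> exp (- k * x) * (1 - \<kappa>) * b"
    using x k \<kappa> bc by (intro mult_right_mono) (auto intro: mult_left_mono)
  moreover have "x * c \<le> L * c" using x bc by (intro mult_right_mono)
  moreover have "(1 - exp (- k * L) * (1 - \<kappa>)) * b \<le> \<theta> * b" using \<theta> bc by (intro mult_right_mono)
  ultimately show ?thesis
    using 1 abs_triangle_ineq[of "exp (- k * x) * \<eta>" "x * integral {0..1} (\<lambda>q. ?E q * g q)"]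
    unfolding damp_def by (simp add: algebra_simps)
qed

lemma damp_has_real_derivative:
  fixes \<eta> \<eta>' :: "real \<Rightarrow> real" and g g' :: "real \<Rightarrow> real \<Rightarrow> real"
  assumes "\<And>t. (\<eta> has_real_derivative \<eta>' t) (at t)"
    and g: "\<And>t q. ((\<lambda>t. g t q) has_real_derivative g' t q) (at t)"
    and "\<And>t. continuous_on UNIV (g t)" and g'c: "continuous_on UNIV (\<lambda>(t, q). g' t q)"
  shows "((\<lambda>t. damp k x (\<eta> t) (g t)) has_real_derivative damp k x (\<eta>' t) (g' t)) (at t)"
proof -
  have "((\<lambda>t. integral (cbox 0 1) (\<lambda>q. exp (- k * x * (1 - q)) * g t q)) has_field_derivative
      integral (cbox 0 1) (\<lambda>q. exp (- k * x * (1 - q)) * g' t q)) (at t within UNIV)"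
  proof (rule leibniz_rule_field_derivative)
    show "((\<lambda>t. exp (- k * x * (1 - q)) * g t q) has_field_derivative exp (- k * x * (1 - q)) * g' t q) (at t within UNIV)"
      for t q using g by (auto intro!: derivative_eq_intros)
    show "(\<lambda>q. exp (- k * x * (1 - q)) * g t q) integrable_on cbox 0 1" for t
      by (rule integrable_continuous) (use assms(3) in \<open>auto intro!: continuous_intros intro: continuous_on_subset\<close>)
    have "continuous_on (UNIV \<times> cbox 0 1) (\<lambda>(t, q). g' t q)" 
      using g'c continuous_on_subset by blast
    then show "continuous_on (UNIV \<times> cbox 0 1) (\<lambda>(t, q). exp (- k * x * (1 - q)) * g' t q)"
      unfolding case_prod_beta by (intro continuous_intros) 
  qed auto
  then show ?thesis
    unfolding damp_def using assms(1) by (auto intro!: derivative_eq_intros)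
qed

section \<open>Averaged integrals, uniform continuity in time, and clipping to the interval\<close>

lemma integral01_bound:
  fixes g :: "real \<Rightarrow> real"
  assumes "continuous_on {0..1} g" "\<And>q. 0 \<le> q \<Longrightarrow> q \<le> 1 \<Longrightarrow> \<bar>g q\<bar> \<le> c"
  shows "\<bar>integral {0..1} g\<bar> \<le> c"
  using integral_bound[of 0 1 g c] assms by simp

text \<open>Undoes the rescaling to [0, 1]: an average over a segment times its length is a
  difference of one antiderivative. This is what allows differentiation in the endpoints later
  on.\<close>

lemma mean_integral_antiderivative:
  fixes f :: "real \<Rightarrow> real"
  assumes f: "continuous_on UNIV f"
  obtains F where "\<And>r. (F has_real_derivative f r) (at r)"
    "\<And>x s. (s - x) * integral {0..1} (\<lambda>q. f (x + q * (s - x))) = F s - F x"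
proof -
  have "\<exists>F. \<forall>x :: real. -\<infinity> < ereal x \<longrightarrow> ereal x < \<infinity> \<longrightarrow> (F has_vector_derivative f x) (at x)"
    by (rule einterval_antiderivative) (use f in \<open>auto simp: continuous_on_eq_continuous_at\<close>)
  then obtain F where F: "\<And>r. (F has_real_derivative f r) (at r)"
    by (auto simp: has_real_derivative_iff_has_vector_derivative)
  have "(s - x) * integral {0..1} (\<lambda>q. f (x + q * (s - x))) = F s - F x" for x s
  proof -
    have "((\<lambda>q. (s - x) * f (x + q * (s - x))) has_integral F (x + 1 * (s - x)) - F (x + 0 * (s - x))) {0..1}"
    proof (rule fundamental_theorem_of_calculus)
      fix q :: real
      have "((\<lambda>q. F (x + q * (s - x))) has_real_derivative f (x + q * (s - x)) * (s - x)) (at q within {0..1})"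
        by (rule DERIV_chain2[OF F]) (auto intro!: derivative_eq_intros)
      then show "((\<lambda>q. F (x + q * (s - x))) has_vector_derivative (s - x) * f (x + q * (s - x))) (at q within {0..1})"
        by (simp add: has_real_derivative_iff_has_vector_derivative[symmetric] mult.commute)
    qed simp
    then show ?thesis by (simp add: integral_unique flip: integral_mult_right)
  qed
  then show ?thesis using that F by blast
qed

text \<open>A shift by whole periods moves t into [0, T); a time closer than T to it then lies in
  the compact window [-T, 2T], where continuity is uniform. The minimum with T in the choice of d
  guarantees this.\<close>

lemma periodic_uniformly_continuous:
  fixes f :: "real \<times> real \<Rightarrow> real"
  assumes f: "continuous_on UNIV f" and T: "T > 0" and per: "\<And>t x. f (t + T, x) = f (t, x)" and e: "e > 0"
  obtains d where "d > 0"
    "\<And>t t' x. 0 \<le> x \<Longrightarrow> x \<le> L \<Longrightarrow> \<bar>t - t'\<bar> < d \<Longrightarrow> \<bar>f (t, x) - f (t', x)\<bar> < e"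
proof -
  have "uniformly_continuous_on ({-T..2*T} \<times> {0..L}) f"
    by (intro compact_uniformly_continuous compact_Times compact_Icc continuous_on_subset[OF f]) auto
  then obtain d where d: "d > 0" and D: "\<And>p p'. p \<in> {-T..2*T} \<times> {0..L} \<Longrightarrow> p' \<in> {-T..2*T} \<times> {0..L} \<Longrightarrow>
      dist p' p < d \<Longrightarrow> dist (f p') (f p) < e"
    using e unfolding uniformly_continuous_on_def by metis
  have pern: "f (t + real n * T, x) = f (t, x)" for t x n
  proof (induction n)
    case (Suc n)
    have "f (t + real (Suc n) * T, x) = f ((t + real n * T) + T, x)" by (simp add: algebra_simps)
    then show ?case using Suc per by simp
  qed simp
  have peri: "f (t + of_int n * T, x) = f (t, x)" for t x n
  proof (cases "n \<ge> 0")
    case True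
    then show ?thesis using pern[of t "nat n" x] by simp
  next
    case False
    then show ?thesis using pern[of "t + of_int n * T" "nat (- n)" x] by simp
  qed
  show ?thesis
  proof (rule that[of "min d T"])
    show "min d T > 0" using d T by simp
    fix t t' x assume x: "0 \<le> x" "x \<le> L" and tt: "\<bar>t - t'\<bar> < min d T"
    define n where "n = - \<lfloor>t / T\<rfloor>"
    have "of_int \<lfloor>t / T\<rfloor> * T \<le> t" "t < (of_int \<lfloor>t / T\<rfloor> + 1) * T"
      using T by (simp_all add: pos_le_divide_eq[symmetric] pos_divide_less_eq[symmetric])
    then have n: "0 \<le> t + of_int n * T" "t + of_int n * T < T" by (auto simp: n_def algebra_simps)
    have "dist (f (t + of_int n * T, x)) (f (t' + of_int n * T, x)) < e"
      using n tt x T by (intro D) (auto simp: dist_prod_def dist_real_def)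
    then show "\<bar>f (t, x) - f (t', x)\<bar> < e" by (simp add: peri dist_real_def)
  qed
qed

text \<open>Profiles and flows are total functions with bounds for all real arguments. Replacing
  sections by their nearest points of [0, L] keeps the integral operators continuous and bounded
  everywhere without changing them on the strip.\<close>

definition clip :: "real \<Rightarrow> real \<Rightarrow> real" where
  "clip L x = max 0 (min L x)"

lemma clip_mem: "L > 0 \<Longrightarrow> clip L x \<ge> 0 \<and> clip L x \<le> L"
  by (auto simp: clip_def)

lemma clip_id: "0 \<le> x \<Longrightarrow> x \<le> L \<Longrightarrow> clip L x = x"
  by (auto simp: clip_def)

lemma continuous_on_clip [continuous_intros]:
  "continuous_on S f \<Longrightarrow> continuous_on S (\<lambda>x. clip L (f x))"
  unfolding clip_def by (intro continuous_intros)

lemma clip_between: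
  assumes "L > 0" "0 \<le> q" "q \<le> 1"
  shows "0 \<le> clip L x + q * (clip L s - clip L x)" "clip L x + q * (clip L s - clip L x) \<le> L"
proof -
  have eq: "clip L x + q * (clip L s - clip L x) = (1 - q) * clip L x + q * clip L s"
    by (simp add: algebra_simps)
  show "0 \<le> clip L x + q * (clip L s - clip L x)"
    unfolding eq using assms clip_mem by simp
  have "(1 - q) * clip L x + q * clip L s \<le> (1 - q) * L + q * L"
    using assms clip_mem by (intro add_mono mult_left_mono) auto
  then show "clip L x + q * (clip L s - clip L x) \<le> L" unfolding eq by (simp add: algebra_simps)
qed

section \<open>Profiles, coefficient fields and flows\<close>

type_synonym profile = "bool \<Rightarrow> real \<times> real \<Rightarrow> real"
type_synonym flow = "bool \<Rightarrow> real \<times> real \<times> real \<Rightarrow> real"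

text \<open>The index \<open>True\<close> belongs to the invariant that travels to the right,
  \<open>False\<close> to the other one after reflection. Time runs over the whole real line, so
  that following a characteristic backwards never leaves the domain.\<close>

definition bounded_profile :: "real \<Rightarrow> real \<Rightarrow> profile \<Rightarrow> bool" where
  "bounded_profile T R w \<longleftrightarrow> (\<forall>i. continuous_on UNIV (w i) \<and>
     (\<forall>t x. \<bar>w i (t, x)\<bar> \<le> R \<and> w i (t + T, x) = w i (t, x)))"

definition lip_profile :: "real \<Rightarrow> real \<Rightarrow> profile \<Rightarrow> bool" where
  "lip_profile T R u \<longleftrightarrow> bounded_profile T R u \<and>
     (\<forall>i t t' x. \<bar>u i (t, x) - u i (t', x)\<bar> \<le> R * \<bar>t - t'\<bar>)"

definition t_derivative :: "profile \<Rightarrow> profile \<Rightarrow> bool" where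
  "t_derivative u w \<longleftrightarrow> (\<forall>i t x. ((\<lambda>t. u i (t, x)) has_real_derivative w i (t, x)) (at t))"

text \<open>\<open>f' u w\<close> is the formal time derivative of the coefficient field \<open>f u\<close>, with \<open>w\<close> in place of
  the time derivative of \<open>u\<close>, which need not exist.\<close>

definition admissible :: "real \<Rightarrow> real \<Rightarrow> real \<Rightarrow> real \<Rightarrow> real \<Rightarrow> real \<Rightarrow> real \<Rightarrow>
    (profile \<Rightarrow> profile) \<Rightarrow> (profile \<Rightarrow> profile \<Rightarrow> profile) \<Rightarrow> bool" where
  "admissible T R c B B' l C2 f f' \<longleftrightarrow>
     (\<forall>u. lip_profile T R u \<longrightarrow> bounded_profile T B (f u) \<and>
        (\<forall>i t t' x. \<bar>f u i (t, x) - f u i (t', x)\<bar> \<le> l * \<bar>t - t'\<bar>)) \<and>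
     (\<forall>u v d. lip_profile T R u \<longrightarrow> lip_profile T R v \<longrightarrow> near d u v \<longrightarrow> near (c * d) (f u) (f v)) \<and>
     (\<forall>u w. lip_profile T R u \<longrightarrow> bounded_profile T R w \<longrightarrow> bounded_profile T B' (f' u w)) \<and>
     (\<forall>u w w' d. lip_profile T R u \<longrightarrow> bounded_profile T R w \<longrightarrow> bounded_profile T R w' \<longrightarrow>
        near d w w' \<longrightarrow> near (c * d) (f' u w) (f' u w')) \<and>
     (\<forall>u v w d. lip_profile T R u \<longrightarrow> lip_profile T R v \<longrightarrow> bounded_profile T R w \<longrightarrow>
        near d u v \<longrightarrow> near (C2 * d) (f' u w) (f' v w)) \<and>
     (\<forall>u w. lip_profile T R u \<longrightarrow> bounded_profile T R w \<longrightarrow> t_derivative u w \<longrightarrow> t_derivative (f u) (f' u w))"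

context
  fixes T R c B B' l C2 f f'
  assumes adm: "admissible T R c B B' l C2 f f'"
begin

lemma admissible_bounded: "lip_profile T R u \<Longrightarrow> bounded_profile T B (f u)"
  using adm unfolding admissible_def by blast

lemma admissible_lip: "lip_profile T R u \<Longrightarrow> \<bar>f u i (t, x) - f u i (t', x)\<bar> \<le> l * \<bar>t - t'\<bar>"
  using adm unfolding admissible_def by blast

lemma admissible_near:
  "lip_profile T R u \<Longrightarrow> lip_profile T R v \<Longrightarrow> near d u v \<Longrightarrow> near (c * d) (f u) (f v)"
  using adm unfolding admissible_def by blast

lemma admissible_derivative_bounded:
  "lip_profile T R u \<Longrightarrow> bounded_profile T R w \<Longrightarrow> bounded_profile T B' (f' u w)"
  using adm unfolding admissible_def by blast

lemma admissible_derivative_near: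
  "lip_profile T R u \<Longrightarrow> bounded_profile T R w \<Longrightarrow> bounded_profile T R w' \<Longrightarrow> near d w w'
    \<Longrightarrow> near (c * d) (f' u w) (f' u w')"
  using adm unfolding admissible_def by blast

lemma admissible_derivative_near_base:
  "lip_profile T R u \<Longrightarrow> lip_profile T R v \<Longrightarrow> bounded_profile T R w \<Longrightarrow> near d u v
    \<Longrightarrow> near (C2 * d) (f' u w) (f' v w)"
  using adm unfolding admissible_def by blast

lemma admissible_t_derivative:
  "lip_profile T R u \<Longrightarrow> bounded_profile T R w \<Longrightarrow> t_derivative u w \<Longrightarrow> t_derivative (f u) (f' u w)"
  using adm unfolding admissible_def by blast

lemma admissible_continuous: "lip_profile T R u \<Longrightarrow> continuous_on UNIV (f u i)"
  using admissible_bounded by (simp add: bounded_profile_def)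

lemma admissible_derivative_continuous:
  "lip_profile T R u \<Longrightarrow> bounded_profile T R w \<Longrightarrow> continuous_on UNIV (f' u w i)"
  using admissible_derivative_bounded by (simp add: bounded_profile_def)

end

lemma bounded_profile_near_limit:
  assumes "\<And>n :: nat. bounded_profile T R (w n)" "\<And>n. near (e n) (w n) s" "e \<longlonglongrightarrow> 0"
  shows "bounded_profile T R s"
  unfolding bounded_profile_def
proof (intro allI conjI)
  fix i t x
  have lim: "(\<lambda>n. w n i p) \<longlonglongrightarrow> s i p" for p using assms(2,3) by (rule near_tendsto)
  show "continuous_on UNIV (s i)"
    by (rule uniform_limit_theorem[OF _ near_imp_uniform_limit[OF assms(2,3)]])
      (use assms(1) in \<open>auto simp: bounded_profile_def\<close>)
  show "\<bar>s i (t, x)\<bar> \<le> R"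
    by (rule LIMSEQ_le_const2[OF tendsto_rabs[OF lim]]) (use assms(1) in \<open>auto simp: bounded_profile_def\<close>)
  show "s i (t + T, x) = s i (t, x)"
    by (rule LIMSEQ_unique[OF lim]) (use lim[of "(t, x)"] assms(1) in \<open>simp add: bounded_profile_def\<close>)
qed

lemma lip_profile_near_limit:
  assumes "\<And>n :: nat. lip_profile T R (w n)" "\<And>n. near (e n) (w n) s" "e \<longlonglongrightarrow> 0"
  shows "lip_profile T R s"
  unfolding lip_profile_def
proof (intro allI conjI)
  show "bounded_profile T R s"
    using assms(1) by (intro bounded_profile_near_limit[OF _ assms(2,3)]) (simp add: lip_profile_def)
  fix i t t' x
  have lim: "(\<lambda>n. w n i p) \<longlonglongrightarrow> s i p" for p using assms(2,3) by (rule near_tendsto)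
  show "\<bar>s i (t, x) - s i (t', x)\<bar> \<le> R * \<bar>t - t'\<bar>"
    by (rule LIMSEQ_le_const2[OF tendsto_rabs[OF tendsto_diff[OF lim lim]]])
      (use assms(1) in \<open>auto simp: lip_profile_def\<close>)
qed

text \<open>The mean value theorem. This is how the iterates remain in the Lipschitz class on which
  the coefficient fields are controlled: the bound comes from the iterated derivatives.\<close>

lemma t_derivative_lip_profile:
  assumes u: "bounded_profile T R u" and w: "bounded_profile T R w" and d: "t_derivative u w"
  shows "lip_profile T R u"
  unfolding lip_profile_def
proof (intro conjI allI u)
  fix i t t' x
  have "norm (u i (t, x) - u i (t', x)) \<le> R * norm (t - t')"
    by (rule field_differentiable_bound[of UNIV "\<lambda>t. u i (t, x)" "\<lambda>t. w i (t, x)"])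
      (use d w in \<open>auto simp: t_derivative_def bounded_profile_def\<close>)
  then show "\<bar>u i (t, x) - u i (t', x)\<bar> \<le> R * \<bar>t - t'\<bar>" by simp
qed

text \<open>A flow assigns to \<open>(s, t, x)\<close> the time at which the characteristic through \<open>(t, x)\<close> crosses
  the section \<open>s\<close>.\<close>

definition periodic_flow :: "real \<Rightarrow> flow \<Rightarrow> bool" where
  "periodic_flow T y \<longleftrightarrow> (\<forall>i. continuous_on UNIV (y i) \<and> (\<forall>s t x. y i (s, t + T, x) = y i (s, t, x) + T))"

text \<open>Candidates for the derivative of a flow in its starting time t. A flow is t plus a drift
  of small time derivative, so this derivative is close to 1, and it is periodic although the flow
  itself gains \<open>T\<close> in each period.\<close>

definition bounded_jacobian :: "real \<Rightarrow> real \<Rightarrow> flow \<Rightarrow> bool" where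
  "bounded_jacobian T m j \<longleftrightarrow> (\<forall>i. continuous_on UNIV (j i) \<and>
     (\<forall>s t x. \<bar>j i (s, t, x)\<bar> \<le> 1 + m \<and> j i (s, t + T, x) = j i (s, t, x)))"

lemma periodic_flow_near_limit:
  assumes "\<And>n :: nat. periodic_flow T (w n)" "\<And>n. near (e n) (w n) s" "e \<longlonglongrightarrow> 0"
  shows "periodic_flow T s"
  unfolding periodic_flow_def
proof (intro allI conjI)
  fix i r t x
  have lim: "(\<lambda>n. w n i p) \<longlonglongrightarrow> s i p" for p using assms(2,3) by (rule near_tendsto)
  show "continuous_on UNIV (s i)"
    by (rule uniform_limit_theorem[OF _ near_imp_uniform_limit[OF assms(2,3)]])
      (use assms(1) in \<open>auto simp: periodic_flow_def\<close>)
  show "s i (r, t + T, x) = s i (r, t, x) + T"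
    by (rule LIMSEQ_unique[OF lim]) (use tendsto_add[OF lim[of "(r, t, x)"] tendsto_const[of T]] assms(1) in \<open>simp add: periodic_flow_def\<close>)
qed

lemma bounded_jacobian_near_limit:
  assumes "\<And>n :: nat. bounded_jacobian T m (w n)" "\<And>n. near (e n) (w n) s" "e \<longlonglongrightarrow> 0"
  shows "bounded_jacobian T m s"
  unfolding bounded_jacobian_def
proof (intro allI conjI)
  fix i r t x
  have lim: "(\<lambda>n. w n i p) \<longlonglongrightarrow> s i p" for p using assms(2,3) by (rule near_tendsto)
  show "continuous_on UNIV (s i)"
    by (rule uniform_limit_theorem[OF _ near_imp_uniform_limit[OF assms(2,3)]])
      (use assms(1) in \<open>auto simp: bounded_jacobian_def\<close>)
  show "\<bar>s i (r, t, x)\<bar> \<le> 1 + m"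
    by (rule LIMSEQ_le_const2[OF tendsto_rabs[OF lim]]) (use assms(1) in \<open>auto simp: bounded_jacobian_def\<close>)
  show "s i (r, t + T, x) = s i (r, t, x)"
    by (rule LIMSEQ_unique[OF lim]) (use lim[of "(r, t, x)"] assms(1) in \<open>simp add: bounded_jacobian_def\<close>)
qed

text \<open>With \<open>j\<close> equal to 1 this is the field seen along characteristics. With
  \<open>j\<close> the time derivative of \<open>y\<close> and \<open>f\<close> a time derivative it
  is the right side of the chain rule, so one operator serves both the nonlinear and the linearised
  equation.\<close>

definition pull :: "profile \<Rightarrow> flow \<Rightarrow> flow \<Rightarrow> flow" where
  "pull f y j = (\<lambda>i (s, t, x). f i (y i (s, t, x), s) * j i (s, t, x))"

definition transport :: "real \<Rightarrow> real \<Rightarrow> flow \<Rightarrow> flow \<Rightarrow> profile" where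
  "transport L k P Q = (\<lambda>i (t, x). damp k (clip L x) (P i (0, t, x)) (\<lambda>q. Q i (q * clip L x, t, x)))"

text \<open>The integral of \<open>A\<close> over sections from x to s; adding t gives the Picard
  integral of the characteristic equation dy/ds = \<alpha>(y, s) with y = t at s = x.\<close>

definition drift :: "real \<Rightarrow> flow \<Rightarrow> flow" where
  "drift L A = (\<lambda>i (s, t, x). (clip L s - clip L x) *
     integral {0..1} (\<lambda>q. A i (clip L x + q * (clip L s - clip L x), t, x)))"

lemma continuous_on_flow_compose:
  assumes "continuous_on UNIV (A :: real \<times> real \<times> real \<Rightarrow> real)" "continuous_on S f" "continuous_on S g" "continuous_on S h"
  shows "continuous_on S (\<lambda>z. A (f z, g z, h z))"
  by (rule continuous_on_compose2[OF assms(1)]) (use assms in \<open>auto intro!: continuous_intros\<close>)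

lemma continuous_on_profile_compose:
  assumes "continuous_on UNIV (A :: real \<times> real \<Rightarrow> real)" "continuous_on S f" "continuous_on S g"
  shows "continuous_on S (\<lambda>z. A (f z, g z))"
  by (rule continuous_on_compose2[OF assms(1)]) (use assms in \<open>auto intro!: continuous_intros\<close>)

lemma continuous_on_integral01:
  fixes f :: "'a::topological_space \<Rightarrow> real \<Rightarrow> real"
  assumes "continuous_on UNIV (\<lambda>(z, q). f z q)"
  shows "continuous_on UNIV (\<lambda>z. integral {0..1} (f z))"
proof -
  have "continuous_on UNIV (\<lambda>z. integral (cbox 0 1) (f z))"
    by (rule integral_continuous_on_param) (rule continuous_on_subset[OF assms], simp)
  then show ?thesis by simp
qed

lemma pull_continuous:
  assumes "continuous_on UNIV (f i)" "continuous_on UNIV (y i)" "continuous_on UNIV (j i)"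
  shows "continuous_on UNIV (pull f y j i)"
  unfolding pull_def case_prod_beta using assms
  by (intro continuous_intros continuous_on_profile_compose[of "f i"]) auto

lemma transport_continuous:
  assumes "continuous_on UNIV (P i)" "continuous_on UNIV (Q i)"
  shows "continuous_on UNIV (transport L k P Q i)"
  unfolding transport_def damp_def case_prod_beta
  by (intro continuous_intros continuous_on_flow_compose[of "P i"] assms continuous_on_integral01)
    (unfold case_prod_beta, intro continuous_intros continuous_on_flow_compose[of "Q i"] assms)

lemma drift_continuous:
  assumes "continuous_on UNIV (A i)"
  shows "continuous_on UNIV (drift L A i)"
  unfolding drift_def case_prod_beta
  by (intro continuous_intros assms continuous_on_integral01)
    (unfold case_prod_beta, intro continuous_intros continuous_on_flow_compose[of "A i"] assms)

lemma transport_periodic: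
  assumes "\<And>s t x. P i (s, t + T, x) = P i (s, t, x)" "\<And>s t x. Q i (s, t + T, x) = Q i (s, t, x)"
  shows "transport L k P Q i (t + T, x) = transport L k P Q i (t, x)"
  by (simp add: transport_def assms)

lemma drift_periodic:
  assumes "\<And>s t x. A i (s, t + T, x) = A i (s, t, x)"
  shows "drift L A i (s, t + T, x) = drift L A i (s, t, x)"
  by (simp add: drift_def assms)

lemma drift_bound:
  assumes A: "continuous_on UNIV (A i)" and L: "L > 0"
    and b: "\<And>s. 0 \<le> s \<Longrightarrow> s \<le> L \<Longrightarrow> \<bar>A i (s, t, x)\<bar> \<le> c"
  shows "\<bar>drift L A i (s, t, x)\<bar> \<le> L * c"
proof -
  have "\<bar>integral {0..1} (\<lambda>q. A i (clip L x + q * (clip L s - clip L x), t, x))\<bar> \<le> c"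
    by (rule integral01_bound) (use clip_between[OF L] b A in
      \<open>auto intro!: continuous_intros continuous_on_flow_compose[of "A i"]\<close>)
  moreover have "\<bar>clip L s - clip L x\<bar> \<le> L"
    using clip_mem[OF L, of s] clip_mem[OF L, of x] by linarith
  ultimately show ?thesis using L
    unfolding drift_def by (simp add: abs_mult) (intro mult_mono, auto)
qed

lemma drift_diff:
  assumes "continuous_on UNIV (A i)" "continuous_on UNIV (A' i)"
  shows "drift L A i p - drift L A' i p = drift L (\<lambda>i p. A i p - A' i p) i p"
proof (cases p)
  case (fields s t x)
  have "integral {0..1} (\<lambda>q. A i (clip L x + q * (clip L s - clip L x), t, x) - A' i (clip L x + q * (clip L s - clip L x), t, x))
    = integral {0..1} (\<lambda>q. A i (clip L x + q * (clip L s - clip L x), t, x)) - integral {0..1} (\<lambda>q. A' i (clip L x + q * (clip L s - clip L x), t, x))"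
    by (intro Henstock_Kurzweil_Integration.integral_diff integrable_continuous_interval
      continuous_on_flow_compose[OF assms(1)] continuous_on_flow_compose[OF assms(2)] continuous_intros)
  then show ?thesis unfolding fields drift_def prod.case by (simp only: right_diff_distrib)
qed

lemma transport_diff:
  assumes "continuous_on UNIV (Q i)" "continuous_on UNIV (Q' i)"
  shows "transport L k P Q i p - transport L k P' Q' i p
    = transport L k (\<lambda>i p. P i p - P' i p) (\<lambda>i p. Q i p - Q' i p) i p"
  unfolding transport_def case_prod_beta
  by (intro damp_diff continuous_on_flow_compose[OF assms(1)] continuous_on_flow_compose[OF assms(2)] continuous_intros)

lemma transport_t_derivative:
  assumes "\<And>t. ((\<lambda>t. P i (0, t, x)) has_real_derivative P' i (0, t, x)) (at t)"
    and "\<And>s t. ((\<lambda>t. Q i (s, t, x)) has_real_derivative Q' i (s, t, x)) (at t)"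
    and "continuous_on UNIV (Q i)" "continuous_on UNIV (Q' i)"
  shows "((\<lambda>t. transport L k P Q i (t, x)) has_real_derivative transport L k P' Q' i (t, x)) (at t)"
  unfolding transport_def prod.case
  by (rule damp_has_real_derivative) (use assms(1,2) in
    \<open>auto simp: case_prod_beta intro!: continuous_intros continuous_on_flow_compose[OF assms(3)]
      continuous_on_flow_compose[OF assms(4)]\<close>)

lemma drift_t_derivative:
  assumes "\<And>s t. ((\<lambda>t. A i (s, t, x)) has_real_derivative A' i (s, t, x)) (at t)"
    and "continuous_on UNIV (A i)" "continuous_on UNIV (A' i)"
  shows "((\<lambda>t. drift L A i (s, t, x)) has_real_derivative drift L A' i (s, t, x)) (at t)"
proof -
  let ?\<sigma> = "\<lambda>q. clip L x + q * (clip L s - clip L x)"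
  have "((\<lambda>t. integral (cbox 0 1) (\<lambda>q. A i (?\<sigma> q, t, x))) has_field_derivative
      integral (cbox 0 1) (\<lambda>q. A' i (?\<sigma> q, t, x))) (at t within UNIV)"
  proof (rule leibniz_rule_field_derivative)
    show "(\<lambda>q. A i (?\<sigma> q, t, x)) integrable_on cbox 0 1" for t
      by (intro integrable_continuous continuous_on_flow_compose[OF assms(2)] continuous_intros)
    show "continuous_on (UNIV \<times> cbox 0 1) (\<lambda>(t, q). A' i (?\<sigma> q, t, x))"
      unfolding case_prod_beta by (intro continuous_on_flow_compose[OF assms(3)] continuous_intros)
  qed (use assms(1) in auto)
  then show ?thesis unfolding drift_def by (auto intro!: derivative_eq_intros)
qed

lemma pull_t_derivative:
  assumes "t_derivative f f'"
    and "((\<lambda>t. y i (s, t, x)) has_real_derivative j i (s, t, x)) (at t)"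
  shows "((\<lambda>t. pull f y (\<lambda>_ _. 1) i (s, t, x)) has_real_derivative pull f' y j i (s, t, x)) (at t)"
  unfolding pull_def prod.case mult_1_right
  by (rule DERIV_chain2[of "\<lambda>t. f i (t, s)"]) (use assms in \<open>auto simp: t_derivative_def\<close>)

text \<open>Here \<open>\<alpha>\<close> is dt/dx along characteristics, \<open>G\<close> the source
  without the damping -k u, and \<open>h\<close> the inflow value. \<open>G\<close> has Lipschitz
  constant k + \<delta>, where k is compensated by the damping and \<delta> has to be small;
  \<open>l\<close> bounds time variation of the fields, \<open>m\<close> the deviation of Jacobians
  from 1. \<open>N1\<close> and \<open>N2\<close> give the contraction factor \<theta> in the
  profile and in the flow component, \<open>N3\<close> and \<open>N4\<close> keep the bounds R and 1
  + m.\<close>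

locale char_map =
  fixes L T R k \<kappa> \<theta>0 \<theta> l m M C C2 \<delta> c0 Ba :: real
    and \<alpha> G h :: "profile \<Rightarrow> profile" and \<alpha>' G' h' :: "profile \<Rightarrow> profile \<Rightarrow> profile"
  assumes L: "L > 0" and T: "T > 0" and R: "R \<ge> 0" and k: "k \<ge> 0" and \<kappa>: "0 \<le> \<kappa>" "\<kappa> < 1"
    and \<theta>0: "1 - exp (- k * L) * (1 - \<kappa>) \<le> \<theta>0" and \<theta>: "0 \<le> \<theta>" "\<theta> < 1"
    and pos: "0 \<le> l" "0 \<le> m" "m \<le> 1" "0 < M" "0 \<le> C" "0 \<le> C2" "0 \<le> \<delta>" "0 \<le> c0" "0 \<le> Ba"
    and \<alpha>: "admissible T R C Ba l l C2 \<alpha> \<alpha>'"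
    and G: "admissible T R (k + \<delta>) (k * R + c0) (k * R + c0) l C2 G G'"
    and h: "admissible T R \<kappa> (\<kappa> * R + c0) (\<kappa> * R + c0) l C2 h h'"
    and l: "k * R + c0 \<le> l" "\<kappa> * R + c0 \<le> l"
    and N1: "\<theta>0 + (1 + L) * ((\<delta> + k + 1) * m + \<delta> + l * M) \<le> \<theta>"
    and N2: "L * (C * (1 + m) + l * M) \<le> M * \<theta>"
    and N3: "\<theta>0 * R + (1 + L) * (c0 * (1 + m) + (k + 1) * m * R) \<le> R"
    and N4: "L * l * (1 + m) \<le> m"
begin

abbreviation "lipp \<equiv> lip_profile T R"
abbreviation "bddp \<equiv> bounded_profile T R"
abbreviation "flw \<equiv> periodic_flow T"
abbreviation "jac \<equiv> bounded_jacobian T m"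
abbreviation one :: flow where "one \<equiv> \<lambda>_ _. 1"

text \<open>\<open>fibre_map z\<close> is the derivative in time of \<open>base_map\<close> at \<open>z\<close>, applied to candidates \<open>(w, j)\<close> for
  the time derivatives of the profile and of the flow.\<close>

definition base_map :: "profile \<times> flow \<Rightarrow> profile \<times> flow" where
  "base_map = (\<lambda>(u, y). (transport L k (pull (h u) y one) (pull (G u) y one),
     \<lambda>i (s, t, x). t + drift L (pull (\<alpha> u) y one) i (s, t, x)))"

definition fibre_map :: "profile \<times> flow \<Rightarrow> profile \<times> flow \<Rightarrow> profile \<times> flow" where
  "fibre_map = (\<lambda>(u, y) (w, j). (transport L k (pull (h' u w) y j) (pull (G' u w) y j),
     \<lambda>i p. 1 + drift L (pull (\<alpha>' u w) y j) i p))"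

lemma transport_bound:
  assumes "continuous_on UNIV (Q i)" "0 \<le> b" "0 \<le> c"
    and P: "\<bar>P i (0, t, x)\<bar> \<le> \<kappa> * b + c"
    and Q: "\<And>s. 0 \<le> s \<Longrightarrow> s \<le> L \<Longrightarrow> \<bar>Q i (s, t, x)\<bar> \<le> k * b + c"
  shows "\<bar>transport L k P Q i (t, x)\<bar> \<le> \<theta>0 * b + (1 + L) * c"
  unfolding transport_def prod.case
proof (rule damp_bound[where \<kappa> = \<kappa>])
  show "\<bar>Q i (q * clip L x, t, x)\<bar> \<le> k * b + c" if "0 \<le> q" "q \<le> 1" for q
    using that clip_mem[OF L, of x] mult_mono[of q 1 "clip L x" L] by (intro Q) auto
  show "continuous_on {0..1} (\<lambda>q. Q i (q * clip L x, t, x))"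
    by (intro continuous_on_flow_compose[OF assms(1)] continuous_intros)
qed (use clip_mem[OF L, of x] k \<kappa> \<theta>0 assms in auto)

lemma pull_near:
  assumes f: "\<And>t t' x. \<bar>f i (t, x) - f i (t', x)\<bar> \<le> l * \<bar>t - t'\<bar>"
    and n: "near a f g" "near b y z"
  shows "\<bar>pull f y one i (s, t, x) - pull g z one i (s, t, x)\<bar> \<le> a + l * b"
proof -
  let ?y = "y i (s, t, x)" and ?z = "z i (s, t, x)"
  have "\<bar>f i (?y, s) - f i (?z, s)\<bar> \<le> l * \<bar>?y - ?z\<bar>" by (rule f)
  also have "\<dots> \<le> l * b" using nearD[OF n(2)] pos by (intro mult_left_mono) auto
  finally show ?thesis using nearD[OF n(1), of i "(?z, s)"] unfolding pull_def by simp
qed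

text \<open>A flow error \<open>M * d\<close> changes a pulled back field by at most
  \<open>l * M * d\<close>, and a profile error d changes the source by (k + \<delta>) d. The share
  k d is absorbed by the damping estimate; only (\<delta> + l M) d counts as remainder. The terms
  with \<open>m\<close> in \<open>N1\<close> and \<open>N2\<close> leave room for the Jacobian in
  the linearised map.\<close>

lemma base_map_contraction:
  assumes u: "lipp u" "lipp v" and y: "flw y" "flw z" and n: "near2 M d (u, y) (v, z)"
  shows "near2 M (\<theta> * d) (base_map (u, y)) (base_map (v, z))"
proof -
  have n1: "near d u v" and n2: "near (M * d) y z" using n by (auto simp: near2_def)
  have d: "d \<ge> 0" using nearD[OF n1, of True "(0,0)"] by simp
  have near: "near (C * d) (\<alpha> u) (\<alpha> v)" "near ((k + \<delta>) * d) (G u) (G v)" "near (\<kappa> * d) (h u) (h v)"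
    using admissible_near[OF \<alpha> u n1] admissible_near[OF G u n1] admissible_near[OF h u n1] by auto
  have c: "continuous_on UNIV (\<alpha> u i)" "continuous_on UNIV (G u i)" "continuous_on UNIV (h u i)" 
    if "lipp u" for u i
    using that admissible_continuous[OF \<alpha>] admissible_continuous[OF G] admissible_continuous[OF h] by auto
  have yc: "continuous_on UNIV (y i)" "continuous_on UNIV (z i)" for i
    using y unfolding periodic_flow_def by blast+
  note pc = pull_continuous[OF _ yc(1)] pull_continuous[OF _ yc(2)]
  have lip: "\<bar>\<alpha> u i (t, x) - \<alpha> u i (t', x)\<bar> \<le> l * \<bar>t - t'\<bar>" "\<bar>G u i (t, x) - G u i (t', x)\<bar> \<le> l * \<bar>t - t'\<bar>"
    "\<bar>h u i (t, x) - h u i (t', x)\<bar> \<le> l * \<bar>t - t'\<bar>" for i t t' x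
    using admissible_lip[OF \<alpha> u(1)] admissible_lip[OF G u(1)] admissible_lip[OF h u(1)] by auto
  have "\<bar>transport L k (pull (h u) y one) (pull (G u) y one) i (t, x)
      - transport L k (pull (h v) z one) (pull (G v) z one) i (t, x)\<bar> \<le> \<theta> * d" for i t x
  proof -
    have "\<bar>transport L k (pull (h u) y one) (pull (G u) y one) i (t, x)
      - transport L k (pull (h v) z one) (pull (G v) z one) i (t, x)\<bar> \<le> \<theta>0 * d + (1 + L) * ((\<delta> + l * M) * d)"
    proof (subst transport_diff)
      show "\<bar>transport L k (\<lambda>i p. pull (h u) y one i p - pull (h v) z one i p)
        (\<lambda>i p. pull (G u) y one i p - pull (G v) z one i p) i (t, x)\<bar> \<le> \<theta>0 * d + (1 + L) * ((\<delta> + l * M) * d)"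
      proof (rule transport_bound)
        show "\<bar>pull (h u) y one i (0, t, x) - pull (h v) z one i (0, t, x)\<bar> \<le> \<kappa> * d + (\<delta> + l * M) * d"
          using pull_near[OF lip(3) near(3) n2, where i = i and s = 0 and t = t and x = x] pos d by (simp add: algebra_simps add_increasing)
        show "\<bar>pull (G u) y one i (s, t, x) - pull (G v) z one i (s, t, x)\<bar> \<le> k * d + (\<delta> + l * M) * d" for s
          using pull_near[OF lip(2) near(2) n2, where i = i and s = s and t = t and x = x] by (simp add: algebra_simps)
        show "continuous_on UNIV (\<lambda>p. pull (G u) y one i p - pull (G v) z one i p)"
          by (intro continuous_intros pc c u)
      qed (use d pos in auto)
    qed (intro pc c u continuous_intros)+
    also have "\<dots> \<le> (\<theta>0 + (1 + L) * ((\<delta> + k + 1) * m + \<delta> + l * M)) * d"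
    proof -
      have "0 \<le> (1 + L) * ((\<delta> + k + 1) * m) * d" using pos k L d by simp
      then show ?thesis by (simp add: algebra_simps)
    qed
    also have "\<dots> \<le> \<theta> * d" using N1 d by (intro mult_right_mono)
    finally show ?thesis .
  qed
  moreover have "\<bar>drift L (pull (\<alpha> u) y one) i (s, t, x) - drift L (pull (\<alpha> v) z one) i (s, t, x)\<bar> \<le> M * (\<theta> * d)" for i s t x
  proof -
    have "\<bar>drift L (pull (\<alpha> u) y one) i (s, t, x) - drift L (pull (\<alpha> v) z one) i (s, t, x)\<bar> \<le> L * (C * d + l * (M * d))"
    proof (subst drift_diff)
      show "\<bar>drift L (\<lambda>i p. pull (\<alpha> u) y one i p - pull (\<alpha> v) z one i p) i (s, t, x)\<bar> \<le> L * (C * d + l * (M * d))"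
        by (rule drift_bound) (use pull_near[OF lip(1) near(1) n2] in \<open>auto intro!: continuous_intros pc c u L\<close>)
    qed (intro pc c u continuous_intros)+
    also have "\<dots> \<le> (L * (C * (1 + m) + l * M)) * d"
    proof -
      have "0 \<le> L * (C * m) * d" using pos L d by simp
      then show ?thesis by (simp add: algebra_simps)
    qed
    also have "\<dots> \<le> (M * \<theta>) * d" using N2 d by (intro mult_right_mono)
    finally show ?thesis by (simp add: mult_ac)
  qed
  ultimately show ?thesis unfolding near2_def near_def base_map_def by auto
qed

text \<open>The difference of products is split as (f(y) - g1(z)) j + g1(z) (j - j'). In the first
  bracket one passes from f to g to g1 at y and then from y to z inside g1. That last move has no
  Lipschitz modulus, because g1 is itself a time derivative; it is charged to \<rho>. The factor 4
  is 2 (1 + m) with m \<le> 1.\<close>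

lemma pull_fibre_near:
  assumes f: "near a f g" "near \<rho> g g1" "\<rho> \<ge> 0" "a \<ge> 0"
    and g1: "\<And>s. 0 \<le> s \<Longrightarrow> s \<le> L \<Longrightarrow> \<bar>g1 i (y i (s, t, x), s) - g1 i (z i (s, t, x), s)\<bar> \<le> \<rho>"
    and b: "\<And>p. \<bar>g1 i p\<bar> \<le> B" and j: "jac j" and n: "near b j j'"
    and s: "0 \<le> s" "s \<le> L"
  shows "\<bar>pull f y j i (s, t, x) - pull g1 z j' i (s, t, x)\<bar> \<le> a * (1 + m) + B * b + 4 * \<rho>"
proof -
  let ?y = "(y i (s, t, x), s)" and ?z = "(z i (s, t, x), s)" and ?j = "j i (s, t, x)" and ?k = "j' i (s, t, x)"
  have J: "\<bar>?j\<bar> \<le> 1 + m" using j by (auto simp: bounded_jacobian_def)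
  have "\<bar>f i ?y - g1 i ?z\<bar> \<le> a + 2 * \<rho>"
    using nearD[OF f(1), of i ?y] nearD[OF f(2), of i ?y] g1[OF s] by linarith
  then have 1: "\<bar>(f i ?y - g1 i ?z) * ?j\<bar> \<le> (a + 2 * \<rho>) * (1 + m)"
    using J f unfolding abs_mult by (intro mult_mono) auto
  have 2: "\<bar>g1 i ?z * (?j - ?k)\<bar> \<le> B * b"
    using b nearD[OF n] unfolding abs_mult by (intro mult_mono) (auto intro: order_trans[OF abs_ge_zero])
  have eq: "f i ?y * ?j - g1 i ?z * ?k = (f i ?y - g1 i ?z) * ?j + g1 i ?z * (?j - ?k)"
    by (simp add: algebra_simps)
  have "\<rho> * m \<le> \<rho> * 1" using f pos by (intro mult_left_mono) auto
  then show ?thesis unfolding pull_def prod.case eq using 1 2 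
    by (intro order_trans[OF abs_triangle_ineq]) (simp add: algebra_simps)
qed

text \<open>In the candidates (w, j) the linearised map contracts like the nonlinear one. A change
  of base point costs a multiple of \<rho>, which bounds both the change of the linearised fields
  and their oscillation between the two flows; the summand 1/M in its factor converts the flow error
  into the units of \<open>near2\<close>. For equal base points \<rho> = 0 is possible and the map
  is a genuine contraction.\<close>

lemma fibre_map_near:
  assumes u: "lipp u" "lipp v" and y: "flw y" "flw z" and w: "bddp w" "bddp w'" and j: "jac j" "jac j'"
    and n: "near2 M d (w, j) (w', j')" and \<rho>: "\<rho> \<ge> 0"
    and nu: "near e u v" and e: "C2 * e \<le> \<rho>"
    and osc: "\<And>g i s t x. g \<in> {\<alpha>' v w', G' v w', h' v w'} \<Longrightarrow> 0 \<le> s \<Longrightarrow> s \<le> L \<Longrightarrow>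
       \<bar>g i (y i (s, t, x), s) - g i (z i (s, t, x), s)\<bar> \<le> \<rho>"
  shows "near2 M (\<theta> * d + 4 * (1 + L) * (1 + 1 / M) * \<rho>) (fibre_map (u, y) (w, j)) (fibre_map (v, z) (w', j'))"
proof -
  have n1: "near d w w'" and n2: "near (M * d) j j'" using n by (auto simp: near2_def)
  have d: "d \<ge> 0" using nearD[OF n1, of True "(0,0)"] by simp
  have near: "near (C * d) (\<alpha>' u w) (\<alpha>' u w')" "near ((k + \<delta>) * d) (G' u w) (G' u w')" "near (\<kappa> * d) (h' u w) (h' u w')"
    using admissible_derivative_near[OF \<alpha> u(1) w n1] admissible_derivative_near[OF G u(1) w n1]
      admissible_derivative_near[OF h u(1) w n1] by auto
  have "near (C2 * e) (\<alpha>' u w') (\<alpha>' v w')" "near (C2 * e) (G' u w') (G' v w')" "near (C2 * e) (h' u w') (h' v w')"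
    using admissible_derivative_near_base[OF \<alpha> u w(2) nu] admissible_derivative_near_base[OF G u w(2) nu]
      admissible_derivative_near_base[OF h u w(2) nu] by auto
  then have near': "near \<rho> (\<alpha>' u w') (\<alpha>' v w')" "near \<rho> (G' u w') (G' v w')" "near \<rho> (h' u w') (h' v w')"
    using near_mono[OF _ e] by blast+
  have c: "continuous_on UNIV (\<alpha>' u w i)" "continuous_on UNIV (G' u w i)" "continuous_on UNIV (h' u w i)" 
    if "lipp u" "bddp w" for u w i
    using that admissible_derivative_continuous[OF \<alpha>] admissible_derivative_continuous[OF G]
      admissible_derivative_continuous[OF h] by auto
  have "\<bar>\<alpha>' v w' i (t, x)\<bar> \<le> l" "\<bar>G' v w' i (t, x)\<bar> \<le> k * R + c0" "\<bar>h' v w' i (t, x)\<bar> \<le> \<kappa> * R + c0" for i t x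
    using admissible_derivative_bounded[OF \<alpha> u(2) w(2)] admissible_derivative_bounded[OF G u(2) w(2)]
      admissible_derivative_bounded[OF h u(2) w(2)] by (auto simp: bounded_profile_def)
  then have bd: "\<bar>\<alpha>' v w' i p\<bar> \<le> l" "\<bar>G' v w' i p\<bar> \<le> l" "\<bar>h' v w' i p\<bar> \<le> l" for i p
    using l by (cases p; metis order_trans)+
  have yc: "continuous_on UNIV (y i)" "continuous_on UNIV (z i)" for i
    using y unfolding periodic_flow_def by blast+
  have jc: "continuous_on UNIV (j i)" "continuous_on UNIV (j' i)" for i
    using j unfolding bounded_jacobian_def by blast+
  note pc = pull_continuous[OF _ yc(1) jc(1)] pull_continuous[OF _ yc(2) jc(2)]
  have pn: "\<bar>pull f y j i (s, t, x) - pull g z j' i (s, t, x)\<bar> \<le> a * (1 + m) + l * (M * d) + 4 * \<rho>"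
    if "near a f f1" "near \<rho> f1 g" "a \<ge> 0" "g \<in> {\<alpha>' v w', G' v w', h' v w'}" "0 \<le> s" "s \<le> L" for f f1 g a i s t x
    by (rule pull_fibre_near[OF that(1,2) \<rho> that(3) osc[OF that(4)] _ j(1) n2]) (use that bd in auto)
  have m\<rho>: "4 * (1 + L) * \<rho> \<le> 4 * (1 + L) * (1 + 1 / M) * \<rho>"
    using \<rho> L pos by (intro mult_right_mono) (auto simp: field_simps)
  have "\<bar>transport L k (pull (h' u w) y j) (pull (G' u w) y j) i (t, x)
      - transport L k (pull (h' v w') z j') (pull (G' v w') z j') i (t, x)\<bar> \<le> \<theta> * d + 4 * (1 + L) * (1 + 1 / M) * \<rho>" for i t x
  proof -
    let ?c = "((\<delta> + k + 1) * m + \<delta> + l * M) * d + 4 * \<rho>"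
    have "\<bar>transport L k (pull (h' u w) y j) (pull (G' u w) y j) i (t, x)
      - transport L k (pull (h' v w') z j') (pull (G' v w') z j') i (t, x)\<bar> \<le> \<theta>0 * d + (1 + L) * ?c"
    proof (subst transport_diff)
      show "\<bar>transport L k (\<lambda>i p. pull (h' u w) y j i p - pull (h' v w') z j' i p)
        (\<lambda>i p. pull (G' u w) y j i p - pull (G' v w') z j' i p) i (t, x)\<bar> \<le> \<theta>0 * d + (1 + L) * ?c"
      proof (rule transport_bound)
        have "\<kappa> * d * m \<le> 1 * d * m" using \<kappa> d pos by (intro mult_right_mono) auto
        moreover have "0 \<le> (\<delta> + k) * m * d" "0 \<le> \<delta> * d" using pos k d by auto
        ultimately have "\<kappa> * d * (1 + m) + l * (M * d) + 4 * \<rho> \<le> \<kappa> * d + ?c" by (simp add: algebra_simps)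
        then show "\<bar>pull (h' u w) y j i (0, t, x) - pull (h' v w') z j' i (0, t, x)\<bar> \<le> \<kappa> * d + ?c"
          using L d \<kappa> by (intro order_trans[OF pn[OF near(3) near'(3)]]) auto
        have "0 \<le> m * d" using pos d by auto
        then have "(k + \<delta>) * d * (1 + m) + l * (M * d) + 4 * \<rho> \<le> k * d + ?c" by (simp add: algebra_simps)
        then show "\<bar>pull (G' u w) y j i (s, t, x) - pull (G' v w') z j' i (s, t, x)\<bar> \<le> k * d + ?c" 
          if "0 \<le> s" "s \<le> L" for s
          using that k pos d by (intro order_trans[OF pn[OF near(2) near'(2)]]) auto
        show "continuous_on UNIV (\<lambda>p. pull (G' u w) y j i p - pull (G' v w') z j' i p)"
          by (intro continuous_intros pc c u w)
      qed (use d pos k \<rho> in auto)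
    qed (intro pc c u w continuous_intros)+
    also have "\<dots> = (\<theta>0 + (1 + L) * ((\<delta> + k + 1) * m + \<delta> + l * M)) * d + 4 * (1 + L) * \<rho>"
      by (simp add: algebra_simps)
    also have "\<dots> \<le> \<theta> * d + 4 * (1 + L) * (1 + 1 / M) * \<rho>" using d by (intro add_mono m\<rho> mult_right_mono N1)
    finally show ?thesis .
  qed
  moreover have "\<bar>drift L (pull (\<alpha>' u w) y j) i (s, t, x) - drift L (pull (\<alpha>' v w') z j') i (s, t, x)\<bar>
      \<le> M * (\<theta> * d + 4 * (1 + L) * (1 + 1 / M) * \<rho>)" for i s t x
  proof -
    have "\<bar>drift L (pull (\<alpha>' u w) y j) i (s, t, x) - drift L (pull (\<alpha>' v w') z j') i (s, t, x)\<bar>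
      \<le> L * (C * d * (1 + m) + l * (M * d) + 4 * \<rho>)"
    proof (subst drift_diff)
      show "\<bar>drift L (\<lambda>i p. pull (\<alpha>' u w) y j i p - pull (\<alpha>' v w') z j' i p) i (s, t, x)\<bar>
          \<le> L * (C * d * (1 + m) + l * (M * d) + 4 * \<rho>)"
        by (rule drift_bound) (use pn[OF near(1) near'(1)] d pos in \<open>auto intro!: continuous_intros pc c u w L\<close>)
    qed (intro pc c u w continuous_intros)+
    also have "\<dots> = (L * (C * (1 + m) + l * M)) * d + 4 * L * \<rho>" by (simp add: algebra_simps)
    also have "\<dots> \<le> (M * \<theta>) * d + 4 * ((1 + L) * (1 + M)) * \<rho>"
      using N2 d \<rho> L pos by (intro add_mono mult_right_mono mult_left_mono) (auto simp: algebra_simps)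
    also have "\<dots> = M * (\<theta> * d + 4 * (1 + L) * (1 + 1 / M) * \<rho>)"
      using pos by (simp add: field_simps)
    finally show ?thesis .
  qed
  ultimately show ?thesis unfolding near2_def near_def fibre_map_def by auto
qed

end

section \<open>Fibre contraction\<close>

definition flow_t_derivative :: "flow \<Rightarrow> flow \<Rightarrow> bool" where
  "flow_t_derivative y j \<longleftrightarrow> (\<forall>i s t x. ((\<lambda>t. y i (s, t, x)) has_real_derivative j i (s, t, x)) (at t))"

text \<open>Uniform convergence of the derivatives plus convergence of the values at one point
  differentiates the limit; pointwise convergence then identifies this limit with
  \<open>u\<close>.\<close>

lemma t_derivative_limit:
  assumes "\<And>n. t_derivative (f n) (f' n)"
    and lim: "\<And>i p. (\<lambda>n. f n i p) \<longlonglongrightarrow> u i p"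
    and near: "\<And>r. r > 0 \<Longrightarrow> \<forall>\<^sub>F n in sequentially. near r (f' n) w"
  shows "t_derivative u w"
  unfolding t_derivative_def
proof (intro allI)
  fix i t x
  have "\<exists>g. \<forall>t\<in>UNIV. (\<lambda>n. f n i (t, x)) \<longlonglongrightarrow> g t \<and> (g has_derivative times (w i (t, x))) (at t within UNIV)"
  proof (rule has_derivative_sequence[where f' = "\<lambda>n t. times (f' n i (t, x))" and ?x0.0 = 0])
    show "((\<lambda>t. f n i (t, x)) has_derivative times (f' n i (t, x))) (at t within UNIV)" for n t
      using assms(1) by (simp add: t_derivative_def has_field_derivative_def)
    fix e :: real assume "e > 0"
    from near[OF this] show "\<forall>\<^sub>F n in sequentially. \<forall>t\<in>UNIV. \<forall>d.
        norm (f' n i (t, x) * d - w i (t, x) * d) \<le> e * norm d"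
      by eventually_elim (auto simp: near_def abs_mult mult_right_mono simp flip: left_diff_distrib)
  next
    show "(\<lambda>n. f n i (0, x)) \<longlonglongrightarrow> u i (0, x)" by (rule lim)
  qed auto
  then obtain g where g: "\<And>t. (\<lambda>n. f n i (t, x)) \<longlonglongrightarrow> g t" 
    "\<And>t. (g has_derivative times (w i (t, x))) (at t)"
    by auto
  have "g = (\<lambda>t. u i (t, x))" using LIMSEQ_unique[OF g(1) lim] by auto
  then show "((\<lambda>t. u i (t, x)) has_real_derivative w i (t, x)) (at t)"
    using g(2)[of t] by (simp add: has_field_derivative_def)
qed

section \<open>Joint iteration of the solution and its time derivative\<close>

context char_map begin

lemma fibre_map_bounded:
  assumes "lipp u" "flw y" "bddp w" "jac j"
  shows "bddp (fst (fibre_map (u, y) (w, j)))" "jac (snd (fibre_map (u, y) (w, j)))"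
proof -
  have bd: "bounded_profile T l (\<alpha>' u w)" "bounded_profile T (k * R + c0) (G' u w)" "bounded_profile T (\<kappa> * R + c0) (h' u w)"
    using admissible_derivative_bounded[OF \<alpha>] admissible_derivative_bounded[OF G]
      admissible_derivative_bounded[OF h] assms by auto
  have pb: "continuous_on UNIV (pull f y j i)" "\<bar>pull f y j i (s, t, x)\<bar> \<le> B * (1 + m)"
    "pull f y j i (s, t + T, x) = pull f y j i (s, t, x)"
    if "bounded_profile T B f" for f B i s t x
  proof -
    show "continuous_on UNIV (pull f y j i)"
      using that assms by (auto intro!: pull_continuous simp: bounded_profile_def periodic_flow_def bounded_jacobian_def)
    have "\<bar>f i (t, x)\<bar> \<le> B" for t x using that by (simp add: bounded_profile_def)
    moreover from this have "0 \<le> B" using abs_ge_zero order_trans by blast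
    ultimately show "\<bar>pull f y j i (s, t, x)\<bar> \<le> B * (1 + m)"
      using assms unfolding pull_def bounded_jacobian_def by (simp add: abs_mult mult_mono)
    show "pull f y j i (s, t + T, x) = pull f y j i (s, t, x)"
      using that assms by (simp add: pull_def bounded_profile_def periodic_flow_def bounded_jacobian_def)
  qed
  show "bddp (fst (fibre_map (u, y) (w, j)))"
    unfolding bounded_profile_def fibre_map_def prod.case fst_conv
  proof (intro allI conjI)
    fix i t x
    \<comment> \<open>The excess over \<kappa> R and k R that is produced by the constant c0 and by
      the factor 1 + m bounding the Jacobian; it is the quantity allowed for in
      \<open>N3\<close>.\<close>
    let ?c = "c0 * (1 + m) + (k + 1) * m * R"
    have c: "0 \<le> ?c" using pos k R by simp
    have "\<kappa> * R * m \<le> 1 * R * m" using \<kappa> R pos by (intro mult_right_mono) auto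
    moreover have "0 \<le> k * m * R" using k pos R by simp
    ultimately have 1: "(\<kappa> * R + c0) * (1 + m) \<le> \<kappa> * R + ?c"
      by (simp add: algebra_simps)
    have 2: "(k * R + c0) * (1 + m) \<le> k * R + ?c"
      using pos R by (simp add: algebra_simps)
    have "\<bar>transport L k (pull (h' u w) y j) (pull (G' u w) y j) i (t, x)\<bar> \<le> \<theta>0 * R + (1 + L) * ?c"
      by (intro transport_bound pb(1)[OF bd(2)] R c order_trans[OF pb(2)[OF bd(3)] 1] order_trans[OF pb(2)[OF bd(2)] 2])
    then show "\<bar>transport L k (pull (h' u w) y j) (pull (G' u w) y j) i (t, x)\<bar> \<le> R"
      using N3 by linarith
    show "transport L k (pull (h' u w) y j) (pull (G' u w) y j) i (t + T, x)
        = transport L k (pull (h' u w) y j) (pull (G' u w) y j) i (t, x)"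
      by (rule transport_periodic) (rule pb(3)[OF bd(3)] pb(3)[OF bd(2)])+
  qed (intro transport_continuous pb(1)[OF bd(3)] pb(1)[OF bd(2)])
  show "jac (snd (fibre_map (u, y) (w, j)))"
    unfolding bounded_jacobian_def fibre_map_def prod.case snd_conv
  proof (intro allI conjI)
    fix i s t x
    have "\<bar>drift L (pull (\<alpha>' u w) y j) i (s, t, x)\<bar> \<le> L * (l * (1 + m))"
      using L by (intro drift_bound pb[OF bd(1)])
    then show "\<bar>1 + drift L (pull (\<alpha>' u w) y j) i (s, t, x)\<bar> \<le> 1 + m"
      using N4 by (simp add: mult_ac)
    show "1 + drift L (pull (\<alpha>' u w) y j) i (s, t + T, x) = 1 + drift L (pull (\<alpha>' u w) y j) i (s, t, x)"
      by (simp add: drift_periodic pb(3)[OF bd(1)])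
  qed (intro continuous_intros drift_continuous pb(1)[OF bd(1)])
qed

text \<open>The constants of the fields leave the ball of radius R invariant without any Jacobian
  factor. The third claim says that characteristics stay at bounded distance from lines of constant
  time, which makes the initial distance of the iteration finite although flows are
  unbounded.\<close>

lemma base_map_bounded:
  assumes "lipp u" "flw y"
  shows "bddp (fst (base_map (u, y)))" "flw (snd (base_map (u, y)))"
    "near (L * Ba) (snd (base_map (u, y))) (\<lambda>i (s, t, x). t)"
proof -
  have bd: "bounded_profile T Ba (\<alpha> u)" "bounded_profile T (k * R + c0) (G u)" "bounded_profile T (\<kappa> * R + c0) (h u)"
    using admissible_bounded[OF \<alpha>] admissible_bounded[OF G] admissible_bounded[OF h] assms by auto
  have pb: "continuous_on UNIV (pull f y one i)" "\<bar>pull f y one i (s, t, x)\<bar> \<le> B"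
    "pull f y one i (s, t + T, x) = pull f y one i (s, t, x)"
    if "bounded_profile T B f" for f B i s t x
  proof -
    show "continuous_on UNIV (pull f y one i)"
      using that assms by (auto intro!: pull_continuous simp: bounded_profile_def periodic_flow_def)
    show "\<bar>pull f y one i (s, t, x)\<bar> \<le> B" using that by (simp add: pull_def bounded_profile_def)
    show "pull f y one i (s, t + T, x) = pull f y one i (s, t, x)"
      using that assms by (simp add: pull_def bounded_profile_def periodic_flow_def)
  qed
  show "bddp (fst (base_map (u, y)))"
    unfolding bounded_profile_def base_map_def prod.case fst_conv
  proof (intro allI conjI)
    fix i t x
    have "\<bar>transport L k (pull (h u) y one) (pull (G u) y one) i (t, x)\<bar> \<le> \<theta>0 * R + (1 + L) * c0"
      by (rule transport_bound) (use pb(1)[OF bd(2)] R pos pb(2)[OF bd(3)] pb(2)[OF bd(2)] in auto)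
    moreover have "(1 + L) * c0 \<le> (1 + L) * (c0 * (1 + m) + (k + 1) * m * R)"
      using L pos k R by (intro mult_left_mono) (auto simp: algebra_simps)
    ultimately show "\<bar>transport L k (pull (h u) y one) (pull (G u) y one) i (t, x)\<bar> \<le> R"
      using N3 by linarith
    show "transport L k (pull (h u) y one) (pull (G u) y one) i (t + T, x)
        = transport L k (pull (h u) y one) (pull (G u) y one) i (t, x)"
      by (rule transport_periodic) (rule pb(3)[OF bd(3)] pb(3)[OF bd(2)])+
  qed (intro transport_continuous pb(1)[OF bd(3)] pb(1)[OF bd(2)])
  show "flw (snd (base_map (u, y)))"
    unfolding periodic_flow_def base_map_def prod.case snd_conv
    by (intro allI conjI) (auto simp: case_prod_beta drift_periodic pb(3)[OF bd(1)]
      intro!: continuous_intros drift_continuous pb(1)[OF bd(1)])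
  show "near (L * Ba) (snd (base_map (u, y))) (\<lambda>i (s, t, x). t)"
    unfolding near_def base_map_def prod.case snd_conv
    using drift_bound[OF pb(1)[OF bd(1)] L pb(2)[OF bd(1)]] by auto
qed

lemma base_map_t_derivative:
  assumes "lipp u" "flw y" "bddp w" "jac j" and d: "t_derivative u w" "flow_t_derivative y j"
  shows "t_derivative (fst (base_map (u, y))) (fst (fibre_map (u, y) (w, j)))"
    "flow_t_derivative (snd (base_map (u, y))) (snd (fibre_map (u, y) (w, j)))"
proof -
  have c: "continuous_on UNIV (y i)" "continuous_on UNIV (j i)" "continuous_on UNIV (one i)" for i
    using assms by (auto simp: periodic_flow_def bounded_jacobian_def)
  have c': "continuous_on UNIV (pull (\<alpha> u) y one i)" "continuous_on UNIV (pull (G u) y one i)" "continuous_on UNIV (pull (h u) y one i)"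
    "continuous_on UNIV (pull (\<alpha>' u w) y j i)" "continuous_on UNIV (pull (G' u w) y j i)" "continuous_on UNIV (pull (h' u w) y j i)" for i
    using admissible_continuous[OF \<alpha>] admissible_continuous[OF G] admissible_continuous[OF h] 
      admissible_derivative_continuous[OF \<alpha>] admissible_derivative_continuous[OF G]
      admissible_derivative_continuous[OF h] assms by (auto intro!: pull_continuous c)
  have D: "((\<lambda>t. pull f y one i (s, t, x)) has_real_derivative pull f' y j i (s, t, x)) (at t)"
    if "t_derivative f f'" for f f' i s t x
    by (rule pull_t_derivative[OF that]) (use d in \<open>simp add: flow_t_derivative_def\<close>)
  note D' = D[OF admissible_t_derivative[OF \<alpha> assms(1,3) d(1)]] D[OF admissible_t_derivative[OF G assms(1,3) d(1)]]
    D[OF admissible_t_derivative[OF h assms(1,3) d(1)]]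
  show "t_derivative (fst (base_map (u, y))) (fst (fibre_map (u, y) (w, j)))"
    unfolding t_derivative_def base_map_def fibre_map_def prod.case fst_conv
    by (intro allI transport_t_derivative D' c')
  show "flow_t_derivative (snd (base_map (u, y))) (snd (fibre_map (u, y) (w, j)))"
    unfolding flow_t_derivative_def base_map_def fibre_map_def prod.case snd_conv
    by (auto intro!: derivative_eq_intros drift_t_derivative D' c')
qed

text \<open>The start is the zero profile with characteristics of constant time, paired with their
  exact time derivatives 0 and 1. Since the second map is the time derivative of the first, the
  second pair remains the derivative of the first at every stage.\<close>

definition iterates :: "nat \<Rightarrow> (profile \<times> flow) \<times> (profile \<times> flow)" where
  "iterates = rec_nat (((\<lambda>_ _. 0), (\<lambda>i (s, t, x). t)), ((\<lambda>_ _. 0), one))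
     (\<lambda>_ (z, \<omega>). (base_map z, fibre_map z \<omega>))"

definition "base n = fst (iterates n)"
definition "fibre n = snd (iterates n)"

lemma iterates_simps:
  "base 0 = ((\<lambda>_ _. 0), (\<lambda>i (s, t, x). t))" "fibre 0 = ((\<lambda>_ _. 0), one)"
  "base (Suc n) = base_map (base n)" "fibre (Suc n) = fibre_map (base n) (fibre n)"
  by (auto simp: iterates_def base_def fibre_def case_prod_beta)

definition C1_state :: "profile \<times> flow \<Rightarrow> profile \<times> flow \<Rightarrow> bool" where
  "C1_state z \<omega> \<longleftrightarrow> lipp (fst z) \<and> flw (snd z) \<and> bddp (fst \<omega>) \<and> jac (snd \<omega>) \<and>
     t_derivative (fst z) (fst \<omega>) \<and> flow_t_derivative (snd z) (snd \<omega>)"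

lemma C1_state_iterates: "C1_state (base n) (fibre n)"
proof (rule nat.induct[where P = "\<lambda>n. C1_state (base n) (fibre n)"])
  show "C1_state (base 0) (fibre 0)" using R pos
    by (auto simp: C1_state_def iterates_simps lip_profile_def bounded_profile_def periodic_flow_def bounded_jacobian_def
      t_derivative_def flow_t_derivative_def case_prod_beta intro!: continuous_intros)
next
  fix n assume IH: "C1_state (base n) (fibre n)"
  obtain u y w j where e: "base n = (u, y)" "fibre n = (w, j)" by fastforce
  note I = IH[unfolded C1_state_def e fst_conv snd_conv]
  have b: "bddp (fst (base_map (u, y)))" "flw (snd (base_map (u, y)))"
    "bddp (fst (fibre_map (u, y) (w, j)))" "jac (snd (fibre_map (u, y) (w, j)))"
    "t_derivative (fst (base_map (u, y))) (fst (fibre_map (u, y) (w, j)))"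
    "flow_t_derivative (snd (base_map (u, y))) (snd (fibre_map (u, y) (w, j)))"
    using I by (auto intro!: base_map_bounded fibre_map_bounded base_map_t_derivative)
  show "C1_state (base (Suc n)) (fibre (Suc n))"
    using b t_derivative_lip_profile[OF b(1,3,5)] by (simp add: C1_state_def iterates_simps e)
qed

lemmas iterates_invariant = C1_state_iterates[unfolded C1_state_def]

lemma base_limit:
  obtains u y e where "lipp u" "flw y" "base_map (u, y) = (u, y)" "e \<longlonglongrightarrow> 0"
    "\<And>n. near2 M (e n) (base n) (u, y)"
proof -
  define V where "V = {z. lipp (fst z) \<and> flw (snd z)}"
  have V: "base n \<in> V" for n using iterates_invariant by (simp add: V_def)
  obtain s e where s: "s \<in> V" "base_map s = s" "e \<longlonglongrightarrow> 0" "\<And>n. near2 M (e n) (base n) s"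
  proof (rule contraction_limit[of base base_map V M \<theta>, OF iterates_simps(3) V _ _ _ \<theta>])
    show "near2 M (\<theta> * d) (base_map f) (base_map g)" if "f \<in> V" "g \<in> V" "near2 M d f g" for f g d
      using base_map_contraction[of "fst f" "fst g" "snd f" "snd g" d] that by (simp add: V_def)
    have "near R (fst (base (Suc 0))) (fst (base 0))"
      using iterates_invariant[of "Suc 0"] by (auto simp: near_def iterates_simps(1) lip_profile_def bounded_profile_def)
    moreover have "near (L * Ba) (snd (base (Suc 0))) (snd (base 0))"
      using base_map_bounded(3)[of "fst (base 0)" "snd (base 0)"] iterates_invariant[of 0]
      by (simp add: iterates_simps)
    \<comment> \<open>Dividing by \<open>M\<close> expresses the flow distance L Ba in the units of
      \<open>near2\<close>.\<close>
    ultimately show "near2 M (R + L * Ba / M) (base (Suc 0)) (base 0)"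
      unfolding near2_def using R L pos by (auto elim!: near_mono simp: field_simps)
    fix s e assume n: "\<And>n. near2 M (e n) (base n) s" and e: "e \<longlonglongrightarrow> 0"
    have "lipp (fst s)"
      by (rule lip_profile_near_limit[of _ _ "\<lambda>n. fst (base n)" e]) (use iterates_invariant n e in \<open>auto simp: near2_def\<close>)
    moreover have "flw (snd s)"
      by (rule periodic_flow_near_limit[of _ "\<lambda>n. snd (base n)" "\<lambda>n. M * e n"])
        (use iterates_invariant n tendsto_mult_right_zero[OF e] in \<open>auto simp: near2_def\<close>)
    ultimately show "s \<in> V" by (simp add: V_def)
  qed blast
  then show ?thesis using that[of "fst s" "snd s" e] by (simp add: V_def)
qed

text \<open>Over a frozen base point the fibre map is a contraction, with both error parameters
  zero. The fixed point solves the formally differentiated equation; that it really is a derivative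
  requires the convergence of the iterates.\<close>

lemma fibre_fixed_point:
  assumes u: "lipp u" and y: "flw y"
  obtains w j where "bddp w" "jac j" "fibre_map (u, y) (w, j) = (w, j)"
proof -
  define V where "V = {z. bddp (fst z) \<and> jac (snd z)}"
  define z where "z n = (fibre_map (u, y) ^^ n) ((\<lambda>_ _. 0), one)" for n
  have V: "z n \<in> V" for n
  proof (induction n)
    case 0 show ?case using R pos by (simp add: z_def V_def bounded_profile_def bounded_jacobian_def)
  next
    case (Suc n)
    then show ?case using fibre_map_bounded[OF u y, of "fst (z n)" "snd (z n)"] by (simp add: z_def V_def)
  qed
  obtain s e where s: "s \<in> V" "fibre_map (u, y) s = s" "e \<longlonglongrightarrow> 0" "\<And>n. near2 M (e n) (z n) s"
  proof (rule contraction_limit[of z "fibre_map (u, y)" V M \<theta>, OF _ V _ _ _ \<theta>])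
    show "near2 M (\<theta> * d) (fibre_map (u, y) f) (fibre_map (u, y) g)" if "f \<in> V" "g \<in> V" "near2 M d f g" for f g d
      using fibre_map_near[OF u u y y, of "fst f" "fst g" "snd f" "snd g" d 0 0] that by (simp add: V_def near_def)
    \<comment> \<open>Two profiles bounded by R differ by at most 2R, and two Jacobians bounded by 1
      + m \<le> 2 by at most 4.\<close>
    have "near2 M (2 * R + 4 / M) (z (Suc 0)) (z 0)"
      unfolding near2_def near_def
    proof (intro conjI allI)
      fix i and p :: "real \<times> real" and p' :: "real \<times> real \<times> real"
      have "\<bar>fst (z n) i p\<bar> \<le> R" for n using V[of n] by (cases p) (simp add: V_def bounded_profile_def)
      from this[of 0] this[of "Suc 0"] show "\<bar>fst (z (Suc 0)) i p - fst (z 0) i p\<bar> \<le> 2 * R + 4 / M"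
        using pos by (smt (verit) divide_nonneg_pos)
      have "\<bar>snd (z n) i p'\<bar> \<le> 1 + m" for n using V[of n] by (cases p') (simp add: V_def bounded_jacobian_def)
      from this[of 0] this[of "Suc 0"] have "\<bar>snd (z (Suc 0)) i p' - snd (z 0) i p'\<bar> \<le> 0 + 4"
        using pos by linarith
      also have "\<dots> \<le> M * (2 * R) + 4" using pos R by (intro add_mono) auto
      also have "\<dots> = M * (2 * R + 4 / M)" using pos by (simp add: field_simps)
      finally show "\<bar>snd (z (Suc 0)) i p' - snd (z 0) i p'\<bar> \<le> M * (2 * R + 4 / M)" .
    qed
    then show "near2 M (2 * R + 4 / M) (z (Suc 0)) (z 0)" .
    fix s e assume n: "\<And>n. near2 M (e n) (z n) s" and e: "e \<longlonglongrightarrow> 0"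
    have "bddp (fst s)"
      by (rule bounded_profile_near_limit[of _ _ "\<lambda>n. fst (z n)" e]) (use V n e in \<open>auto simp: near2_def V_def\<close>)
    moreover have "jac (snd s)"
      by (rule bounded_jacobian_near_limit[of _ _ "\<lambda>n. snd (z n)" "\<lambda>n. M * e n"])
        (use V n tendsto_mult_right_zero[OF e] in \<open>auto simp: near2_def V_def\<close>)
    ultimately show "s \<in> V" by (simp add: V_def)
  qed (auto simp: z_def)
  then show ?thesis using that[of "fst s" "snd s"] by (simp add: V_def)
qed

lemma profile_uniformly_continuous:
  assumes "bounded_profile T B f" "e > 0"
  obtains d where "d > 0" "\<And>i t t' x. 0 \<le> x \<Longrightarrow> x \<le> L \<Longrightarrow> \<bar>t - t'\<bar> < d \<Longrightarrow> \<bar>f i (t, x) - f i (t', x)\<bar> < e"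
proof -
  have "\<exists>d>0. \<forall>t t' x. 0 \<le> x \<longrightarrow> x \<le> L \<longrightarrow> \<bar>t - t'\<bar> < d \<longrightarrow> \<bar>f i (t, x) - f i (t', x)\<bar> < e" for i
    by (rule periodic_uniformly_continuous[of "f i" T e L]) (use assms T in \<open>auto simp: bounded_profile_def\<close>)
  then obtain d where d: "\<And>i. d i > 0"
    "\<And>i t t' x. 0 \<le> x \<longrightarrow> x \<le> L \<longrightarrow> \<bar>t - t'\<bar> < d i \<longrightarrow> \<bar>f i (t, x) - f i (t', x)\<bar> < e"
    by metis
  show ?thesis
  proof (rule that[of "min (d True) (d False)"])
    fix i t t' x assume a: "0 \<le> x" "x \<le> L" "\<bar>t - t'\<bar> < min (d True) (d False)"
    then show "\<bar>f i (t, x) - f i (t', x)\<bar> < e" using d(2)[of x t t' i] by (cases i) auto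
  qed (use d(1) in auto)
qed

text \<open>The fibre contraction principle. A modulus of continuity is needed only for the
  linearised fields at the limit (u, w); by periodicity it is uniform in time, and the flows
  converge uniformly, so the base point error tends to zero. Hence the derivatives of the iterates
  converge uniformly to \<open>w\<close>.\<close>

lemma fixed_point:
  obtains u y w where "lipp u" "flw y" "bddp w" "t_derivative u w" "base_map (u, y) = (u, y)"
proof -
  obtain u y e where u: "lipp u" and y: "flw y" and fix_uy: "base_map (u, y) = (u, y)" and e: "e \<longlonglongrightarrow> 0"
    and near: "\<And>n. near2 M (e n) (base n) (u, y)"
    by (rule base_limit) blast
  obtain w j where w: "bddp w" and j: "jac j" and fix_wj: "fibre_map (u, y) (w, j) = (w, j)"
    by (rule fibre_fixed_point[OF u y]) blast
  have *: "\<forall>\<^sub>F n in sequentially. near2 M r (fibre n) (w, j)" if "r > 0" for r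
  proof (rule perturbed_contraction_limit[OF _ _ \<theta> _ that])
    fix r :: real assume r: "r > 0"
    define K where "K = 4 * (1 + L) * (1 + 1 / M)"
    have K: "K > 0" using L pos by (simp add: K_def add_pos_pos)
    \<comment> \<open>\<open>K\<close> is the factor of \<rho> in \<open>fibre_map_near\<close>, so
      the total base point error becomes exactly r.\<close>
    define \<rho> where "\<rho> = r / K"
    have \<rho>: "\<rho> > 0" using r K by (simp add: \<rho>_def)
    have bd: "bounded_profile T l (\<alpha>' u w)" "bounded_profile T (k * R + c0) (G' u w)" "bounded_profile T (\<kappa> * R + c0) (h' u w)"
      using admissible_derivative_bounded[OF \<alpha> u w] admissible_derivative_bounded[OF G u w]
        admissible_derivative_bounded[OF h u w] by auto
    obtain d1 where d1: "d1 > 0" "\<And>i t t' x. 0 \<le> x \<Longrightarrow> x \<le> L \<Longrightarrow> \<bar>t - t'\<bar> < d1 \<Longrightarrow> \<bar>\<alpha>' u w i (t, x) - \<alpha>' u w i (t', x)\<bar> < \<rho>"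
      using profile_uniformly_continuous[OF bd(1) \<rho>] by blast
    obtain d2 where d2: "d2 > 0" "\<And>i t t' x. 0 \<le> x \<Longrightarrow> x \<le> L \<Longrightarrow> \<bar>t - t'\<bar> < d2 \<Longrightarrow> \<bar>G' u w i (t, x) - G' u w i (t', x)\<bar> < \<rho>"
      using profile_uniformly_continuous[OF bd(2) \<rho>] by blast
    obtain d3 where d3: "d3 > 0" "\<And>i t t' x. 0 \<le> x \<Longrightarrow> x \<le> L \<Longrightarrow> \<bar>t - t'\<bar> < d3 \<Longrightarrow> \<bar>h' u w i (t, x) - h' u w i (t', x)\<bar> < \<rho>"
      using profile_uniformly_continuous[OF bd(3) \<rho>] by blast
    define d where "d = Min {d1, d2, d3}"
    have d: "d > 0" "d \<le> d1" "d \<le> d2" "d \<le> d3" using d1 d2 d3 by (auto simp: d_def)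
    have "(\<lambda>n. C2 * e n) \<longlonglongrightarrow> 0" "(\<lambda>n. M * e n) \<longlonglongrightarrow> 0"
      using tendsto_mult_right_zero[OF e] by auto
    then have "\<forall>\<^sub>F n in sequentially. C2 * e n < \<rho> \<and> M * e n < d"
      using \<rho> d by (intro eventually_conj order_tendstoD(2)) auto
    then obtain N where N: "\<And>n. n \<ge> N \<Longrightarrow> C2 * e n < \<rho> \<and> M * e n < d"
      by (auto simp: eventually_sequentially)
    show "\<exists>N. \<forall>n\<ge>N. \<forall>d. near2 M d (fibre n) (w, j) \<longrightarrow> near2 M (\<theta> * d + r) (fibre (Suc n)) (w, j)"
    proof (intro exI allI impI)
      fix n d' assume n: "n \<ge> N" and a: "near2 M d' (fibre n) (w, j)"
      note I = iterates_invariant[of n]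
      have "near2 M (\<theta> * d' + 4 * (1 + L) * (1 + 1 / M) * \<rho>)
          (fibre_map (fst (base n), snd (base n)) (fst (fibre n), snd (fibre n))) (fibre_map (u, y) (w, j))"
      proof (rule fibre_map_near)
        show "near (e n) (fst (base n)) u" using near[of n] by (simp add: near2_def)
        show "\<bar>g i (snd (base n) i (s, t, x), s) - g i (y i (s, t, x), s)\<bar> \<le> \<rho>"
          if "g \<in> {\<alpha>' u w, G' u w, h' u w}" "0 \<le> s" "s \<le> L" for g i s t x
        proof -
          have "\<bar>snd (base n) i (s, t, x) - y i (s, t, x)\<bar> \<le> M * e n"
            using near[of n] by (auto simp: near2_def near_def)
          then have lt: "\<bar>snd (base n) i (s, t, x) - y i (s, t, x)\<bar> < d" using N[OF n] by linarith
          show ?thesis using that(1) d1(2)[OF that(2,3)] d2(2)[OF that(2,3)] d3(2)[OF that(2,3)] lt d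
            by (auto intro!: less_imp_le)
        qed
      qed (use I u y w j a N[OF n] \<rho> in auto)
      moreover have "4 * (1 + L) * (1 + 1 / M) * \<rho> = r"
        using K unfolding \<rho>_def K_def by (metis nonzero_mult_div_cancel_left less_irrefl times_divide_eq_right)
      ultimately show "near2 M (\<theta> * d' + r) (fibre (Suc n)) (w, j)"
        by (simp add: iterates_simps fix_wj)
    qed
  next
    fix n
    note I = iterates_invariant[of n]
    show "near2 M (2 * R + 4 / M) (fibre n) (w, j)"
      unfolding near2_def near_def fst_conv snd_conv
    proof (intro conjI allI)
      fix i and p :: "real \<times> real" and p' :: "real \<times> real \<times> real"
      have "\<bar>fst (fibre n) i p\<bar> \<le> R" "\<bar>w i p\<bar> \<le> R" using I w by (cases p; simp add: bounded_profile_def)+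
      moreover have "0 \<le> 4 / M" using pos by simp
      ultimately show "\<bar>fst (fibre n) i p - w i p\<bar> \<le> 2 * R + 4 / M" by linarith
      have "\<bar>snd (fibre n) i p'\<bar> \<le> 1 + m" "\<bar>j i p'\<bar> \<le> 1 + m" using I j by (cases p'; simp add: bounded_jacobian_def)+
      then have "\<bar>snd (fibre n) i p' - j i p'\<bar> \<le> 0 + 4"
        using pos by linarith
      also have "\<dots> \<le> M * (2 * R) + 4" using pos R by (intro add_mono) auto
      also have "\<dots> = M * (2 * R + 4 / M)" using pos by (simp add: field_simps)
      finally show "\<bar>snd (fibre n) i p' - j i p'\<bar> \<le> M * (2 * R + 4 / M)" .
    qed
  qed (use pos in auto)
  have fib: "\<forall>\<^sub>F n in sequentially. near r (fst (fibre n)) w" if "r > 0" for r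
    using *[OF that] by eventually_elim (simp add: near2_def)
  have nu: "near (e n) (fst (base n)) u" for n using near[of n] by (simp add: near2_def)
  have "t_derivative u w"
    by (rule t_derivative_limit[OF _ near_tendsto[OF nu e] fib]) (use iterates_invariant in auto)
  then show ?thesis using that u y w fix_uy by blast
qed

end

section \<open>The differential equation\<close>

context char_map begin

context
  fixes u y w
  assumes u: "lipp u" and y: "flw y" and w: "bddp w" and uw: "t_derivative u w"
    and fixed: "base_map (u, y) = (u, y)"
begin

lemma flow_continuous: "continuous_on UNIV (y i)"
  using y by (simp add: periodic_flow_def)

lemma alpha_along_continuous: "continuous_on UNIV (\<lambda>r. \<alpha> u i (y i (r, t, x), r))"
  by (intro continuous_on_profile_compose[OF admissible_continuous[OF \<alpha> u]]
    continuous_on_flow_compose[OF flow_continuous] continuous_intros)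

lemma G_along_continuous: "continuous_on UNIV (\<lambda>r. G u i (y i (r, t, x), r))"
  by (intro continuous_on_profile_compose[OF admissible_continuous[OF G u]]
    continuous_on_flow_compose[OF flow_continuous] continuous_intros)

lemma flow_integral:
  assumes "0 \<le> s" "s \<le> L" "0 \<le> x" "x \<le> L"
  shows "y i (s, t, x) = t + (s - x) *
    integral {0..1} (\<lambda>q. \<alpha> u i (y i (x + q * (s - x), t, x), x + q * (s - x)))"
proof -
  have "y = snd (base_map (u, y))" by (simp add: fixed)
  then have "y i (s, t, x) = snd (base_map (u, y)) i (s, t, x)" by simp
  then show ?thesis using assms by (simp add: base_map_def drift_def pull_def clip_id)
qed

lemma flow_diagonal: "0 \<le> x \<Longrightarrow> x \<le> L \<Longrightarrow> y i (x, t, x) = t"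
  using flow_integral[of x x i t] by simp

lemma flow_derivative:
  assumes "0 \<le> x" "x \<le> L" "0 \<le> s" "s \<le> L"
  shows "((\<lambda>s. y i (s, t, x)) has_real_derivative \<alpha> u i (y i (s, t, x), s)) (at s within {0..L})"
proof -
  obtain F where F: "\<And>r. (F has_real_derivative \<alpha> u i (y i (r, t, x), r)) (at r)"
    "\<And>x' s. (s - x') * integral {0..1} (\<lambda>q. \<alpha> u i (y i (x' + q * (s - x'), t, x), x' + q * (s - x'))) = F s - F x'"
    using mean_integral_antiderivative[OF alpha_along_continuous[of i t x]] by blast
  have eq: "t + (F r - F x) = y i (r, t, x)" if "r \<in> {0..L}" for r
    using that assms by (subst flow_integral) (auto simp only: F(2) atLeastAtMost_iff)
  have "((\<lambda>s. t + (F s - F x)) has_real_derivative \<alpha> u i (y i (s, t, x), s)) (at s within {0..L})"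
    by (auto intro!: derivative_eq_intros DERIV_subset[OF F(1)])
  then show ?thesis
    by (rule has_field_derivative_transform_within[OF _ zero_less_one _ eq]) (use assms in simp_all)
qed

text \<open>Both sides solve the same characteristic equation in s and agree at s0. Instead of a
  Gronwall estimate, the maximum of their distance over [0, L] is bounded by L l times itself.
  \<open>N4\<close> gives L l (1 + m) \<le> m, hence L l < 1 and the maximum vanishes.\<close>

lemma flow_cocycle:
  assumes x: "0 \<le> x" "x \<le> L" and s0: "0 \<le> s0" "s0 \<le> L" and s: "0 \<le> s" "s \<le> L"
  shows "y i (s, y i (s0, t, x), s0) = y i (s, t, x)"
proof -
  define c where "c r = y i (r, t, x)" for r
  define b where "b r = y i (r, c s0, s0)" for r
  define D where "D r = c r - b r" for r
  have "continuous_on {0..L} (\<lambda>r. \<bar>D r\<bar>)"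
    unfolding D_def b_def c_def
    by (intro continuous_intros continuous_on_flow_compose[OF flow_continuous])
  then obtain s1 where s1: "s1 \<in> {0..L}" "\<And>r. r \<in> {0..L} \<Longrightarrow> \<bar>D r\<bar> \<le> \<bar>D s1\<bar>"
    using continuous_attains_sup[of "{0..L}" "\<lambda>r. \<bar>D r\<bar>"] L by auto
  have "norm (D s1 - D s0) \<le> (l * \<bar>D s1\<bar>) * norm (s1 - s0)"
  proof (rule field_differentiable_bound)
    show "(D has_field_derivative \<alpha> u i (c r, r) - \<alpha> u i (b r, r)) (at r within {0..L})" if "r \<in> {0..L}" for r
      unfolding D_def b_def c_def using that s0 x by (intro DERIV_diff flow_derivative) auto
    show "norm (\<alpha> u i (c r, r) - \<alpha> u i (b r, r)) \<le> l * \<bar>D s1\<bar>" if "r \<in> {0..L}" for r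
    proof -
      have "norm (\<alpha> u i (c r, r) - \<alpha> u i (b r, r)) \<le> l * \<bar>D r\<bar>"
        using admissible_lip[OF \<alpha> u] by (simp add: D_def)
      also have "\<dots> \<le> l * \<bar>D s1\<bar>" using s1 that pos by (intro mult_left_mono) auto
      finally show ?thesis .
    qed
  qed (use s0 s1 in auto)
  moreover have "D s0 = 0" using flow_diagonal[of s0 i "c s0"] s0 by (simp add: D_def b_def)
  moreover have "(l * \<bar>D s1\<bar>) * norm (s1 - s0) \<le> (l * \<bar>D s1\<bar>) * L"
    using s0 s1 pos by (intro mult_left_mono) auto
  ultimately have 1: "\<bar>D s1\<bar> \<le> (L * l) * \<bar>D s1\<bar>" by (simp add: mult_ac)
  have "L * l < 1"
  proof (rule ccontr)
    assume "\<not> L * l < 1"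
    then have "1 * (1 + m) \<le> (L * l) * (1 + m)" using pos by (intro mult_right_mono) auto
    then show False using N4 by simp
  qed
  then have "\<bar>D s1\<bar> = 0" using 1 mult_strict_right_mono[of "L * l" 1 "\<bar>D s1\<bar>"] by fastforce
  then have "D s = 0" using s1(2)[of s] s by simp
  then show ?thesis by (simp add: D_def b_def c_def)
qed

text \<open>Taking e^(-kx) out leaves an integrand that depends on q and x, apart from the choice of
  characteristic, only through the section q x. Thus the integral is a difference of an
  antiderivative along that characteristic.\<close>

lemma fixed_point_integral:
  assumes "0 \<le> x" "x \<le> L"
  shows "u i (t, x) = exp (- k * x) * (h u i (y i (0, t, x), 0)
    + x * integral {0..1} (\<lambda>q. exp (k * (q * x)) * G u i (y i (q * x, t, x), q * x)))"
proof -
  have "u = fst (base_map (u, y))" by (simp add: fixed)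
  then have "u i (t, x) = fst (base_map (u, y)) i (t, x)" by simp
  also have "\<dots> = exp (- k * x) * h u i (y i (0, t, x), 0)
    + x * integral {0..1} (\<lambda>q. exp (- k * x * (1 - q)) * G u i (y i (q * x, t, x), q * x))"
    using assms by (simp add: base_map_def transport_def damp_def pull_def clip_id)
  also have "(\<lambda>q. exp (- k * x * (1 - q)) * G u i (y i (q * x, t, x), q * x))
    = (\<lambda>q. exp (- k * x) * (exp (k * (q * x)) * G u i (y i (q * x, t, x), q * x)))"
  proof
    fix q
    have "exp (- k * x * (1 - q)) = exp (- k * x) * exp (k * (q * x))"
      by (simp add: algebra_simps flip: exp_add)
    then show "exp (- k * x * (1 - q)) * G u i (y i (q * x, t, x), q * x)
      = exp (- k * x) * (exp (k * (q * x)) * G u i (y i (q * x, t, x), q * x))" by simp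
  qed
  finally show ?thesis by (simp add: distrib_left)
qed

lemma fixed_point_boundary: "u i (t, 0) = h u i (t, 0)"
  using fixed_point_integral[of 0 i t] flow_diagonal[of 0 i t] L by simp

text \<open>By the cocycle identity every point of the characteristic through (t, x) has the same
  inflow point and the same integrand. Along it u is therefore e^(-ks) times a constant plus an
  antiderivative, and is differentiated directly.\<close>

lemma fixed_point_along:
  assumes x: "0 \<le> x" "x \<le> L"
  shows "((\<lambda>s. u i (y i (s, t, x), s)) has_real_derivative - k * u i (t, x) + G u i (t, x)) (at x within {0..L})"
proof -
  define f where "f r = exp (k * r) * G u i (y i (r, t, x), r)" for r
  have "continuous_on UNIV f"
    unfolding f_def by (intro continuous_intros G_along_continuous)
  then obtain F where F: "\<And>r. (F has_real_derivative f r) (at r)"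
    "\<And>x s. (s - x) * integral {0..1} (\<lambda>q. f (x + q * (s - x))) = F s - F x"
    using mean_integral_antiderivative by blast
  define H where "H s = exp (- k * s) * (h u i (y i (0, t, x), 0) + (F s - F 0))" for s
  have eq: "H s = u i (y i (s, t, x), s)" if s: "s \<in> {0..L}" for s
  proof -
    have "integral {0..1} (\<lambda>q. exp (k * (q * s)) * G u i (y i (q * s, y i (s, t, x), s), q * s))
      = integral {0..1} (\<lambda>q. f (0 + q * (s - 0)))"
    proof (rule Henstock_Kurzweil_Integration.integral_cong)
      fix q :: real assume q: "q \<in> {0..1}"
      have "0 \<le> q * s" "q * s \<le> L" using q s mult_mono[of q 1 s L] by auto
      then show "exp (k * (q * s)) * G u i (y i (q * s, y i (s, t, x), s), q * s) = f (0 + q * (s - 0))"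
        using s x by (simp add: f_def flow_cocycle)
    qed
    then have "u i (y i (s, t, x), s) = exp (- k * s) * (h u i (y i (0, y i (s, t, x), s), 0)
        + (s - 0) * integral {0..1} (\<lambda>q. f (0 + q * (s - 0))))"
      using fixed_point_integral[of s i "y i (s, t, x)"] s by simp
    then show ?thesis unfolding F(2) H_def using flow_cocycle[of x s 0] s x L by simp
  qed
  have "(H has_real_derivative - k * H x + exp (- k * x) * f x) (at x within {0..L})"
    unfolding H_def by (auto intro!: derivative_eq_intros DERIV_subset[OF F(1)] simp: algebra_simps)
  moreover have "exp (- k * x) * f x = G u i (t, x)"
    using flow_diagonal[OF x, of i t] by (simp add: f_def flip: exp_add mult.assoc)
  moreover have "H x = u i (t, x)" using eq[of x] x flow_diagonal[OF x, of i t] by simp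
  ultimately have "(H has_real_derivative - k * u i (t, x) + G u i (t, x)) (at x within {0..L})"
    by simp
  then show ?thesis
    by (rule has_field_derivative_transform_within[OF _ zero_less_one _ eq]) (use x in simp_all)
qed

text \<open>The mean value theorem in time writes the increment as w(\<xi>, s) (y(s) - t) with \<xi>
  between t and y(s); joint continuity of w passes to the limit. No differentiability of u in x is
  presupposed.\<close>

lemma fixed_point_t_increment:
  assumes x: "0 \<le> x" "x \<le> L"
  shows "((\<lambda>s. u i (y i (s, t, x), s) - u i (t, s)) has_real_derivative w i (t, x) * \<alpha> u i (t, x)) (at x within {0..L})"
proof -
  define c where "c s = y i (s, t, x)" for s
  have "\<exists>\<xi>. \<bar>\<xi> - t\<bar> \<le> \<bar>c s - t\<bar> \<and> u i (c s, s) - u i (t, s) = w i (\<xi>, s) * (c s - t)" for s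
  proof (cases "c s = t")
    case False
    have d: "((\<lambda>t. u i (t, s)) has_real_derivative w i (r, s)) (at r)" for r
      using uw by (simp add: t_derivative_def)
    show ?thesis
    proof (cases "c s < t")
      case True
      from MVT2[OF this d] obtain \<xi> where "c s < \<xi>" "\<xi> < t" "u i (t, s) - u i (c s, s) = (t - c s) * w i (\<xi>, s)" 
        by blast
      then show ?thesis by (intro exI[of _ \<xi>]) (auto simp: algebra_simps)
    next
      case F: False
      then have "t < c s" using False by simp
      from MVT2[OF this d] obtain \<xi> where "t < \<xi>" "\<xi> < c s" "u i (c s, s) - u i (t, s) = (c s - t) * w i (\<xi>, s)" 
        by blast
      then show ?thesis by (intro exI[of _ \<xi>]) (auto simp: algebra_simps)
    qed
  qed auto
  then obtain \<xi> where \<xi>: "\<And>s. \<bar>\<xi> s - t\<bar> \<le> \<bar>c s - t\<bar>" "\<And>s. u i (c s, s) - u i (t, s) = w i (\<xi> s, s) * (c s - t)"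
    by metis
  let ?F = "at x within {0..L}"
  have cx: "c x = t" using flow_diagonal[OF x] by (simp add: c_def)
  have cd: "(c has_real_derivative \<alpha> u i (t, x)) ?F"
    using flow_derivative[OF x x, of i t] flow_diagonal[OF x, of i t] by (simp add: c_def[abs_def])
  then have "(c \<longlongrightarrow> t) ?F"
    using DERIV_continuous[of c] cx by (metis continuous_within)
  then have "((\<lambda>s. \<bar>c s - t\<bar>) \<longlongrightarrow> 0) ?F"
    by (intro tendsto_rabs_zero LIM_zero)
  then have "((\<lambda>s. \<xi> s - t) \<longlongrightarrow> 0) ?F"
    by (rule Lim_null_comparison[rotated]) (use \<xi>(1) in auto)
  then have "(\<xi> \<longlongrightarrow> t) ?F" by (rule LIM_zero_cancel)
  then have "((\<lambda>s. (\<xi> s, s)) \<longlongrightarrow> (t, x)) ?F" by (intro tendsto_intros)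
  moreover have "isCont (w i) (t, x)"
    using w by (simp add: bounded_profile_def continuous_on_eq_continuous_at)
  ultimately have "((\<lambda>s. w i (\<xi> s, s)) \<longlongrightarrow> w i (t, x)) ?F"
    using isCont_tendsto_compose by blast
  moreover have "((\<lambda>s. (c s - c x) / (s - x)) \<longlongrightarrow> \<alpha> u i (t, x)) ?F"
    using cd by (simp add: has_field_derivative_iff)
  ultimately have "((\<lambda>s. w i (\<xi> s, s) * ((c s - c x) / (s - x))) \<longlongrightarrow> w i (t, x) * \<alpha> u i (t, x)) ?F"
    by (rule tendsto_mult)
  then show ?thesis
    unfolding has_field_derivative_iff c_def[symmetric] \<xi>(2) by (simp add: cx)
qed

text \<open>Moving along the characteristic and subtracting the change in time at a fixed section
  leaves the change in x.\<close>

lemma fixed_point_x_derivative: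
  assumes x: "0 \<le> x" "x \<le> L"
  shows "((\<lambda>x. u i (t, x)) has_real_derivative
    - k * u i (t, x) + G u i (t, x) - w i (t, x) * \<alpha> u i (t, x)) (at x within {0..L})"
  using DERIV_diff[OF fixed_point_along[OF x, of i t] fixed_point_t_increment[OF x, of i t]] by simp

end

theorem transport_solution:
  obtains u w where "lipp u" "bddp w" "t_derivative u w" "\<And>i t. u i (t, 0) = h u i (t, 0)"
    "\<And>i t x. 0 \<le> x \<Longrightarrow> x \<le> L \<Longrightarrow> ((\<lambda>x. u i (t, x)) has_real_derivative
       - k * u i (t, x) + G u i (t, x) - w i (t, x) * \<alpha> u i (t, x)) (at x within {0..L})"
proof -
  obtain u y w where *: "lipp u" "flw y" "bddp w" "t_derivative u w" "base_map (u, y) = (u, y)"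
    by (rule fixed_point)
  show ?thesis
    by (rule that[OF *(1,3,4) fixed_point_boundary[OF *] fixed_point_x_derivative[OF *]])
qed

end

section \<open>The reflected Riemann invariants\<close>

lemma abs_mult_le:
  fixes x y X Y :: real
  shows "\<bar>x\<bar> \<le> X \<Longrightarrow> \<bar>y\<bar> \<le> Y \<Longrightarrow> \<bar>x * y\<bar> \<le> X * Y"
  by (simp add: abs_mult mult_mono order_trans[OF abs_ge_zero])

lemma abs_mult_diff_le:
  fixes x y x' y' X Y dx dy :: real
  assumes "\<bar>x\<bar> \<le> X" "\<bar>y'\<bar> \<le> Y" "\<bar>x - x'\<bar> \<le> dx" "\<bar>y - y'\<bar> \<le> dy"
  shows "\<bar>x * y - x' * y'\<bar> \<le> X * dy + dx * Y"
proof -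
  have "x * y - x' * y' = x * (y - y') + (x - x') * y'" by (simp add: algebra_simps)
  then show ?thesis using abs_mult_le[OF assms(1,4)] abs_mult_le[OF assms(3,2)] by linarith
qed

lemma abs_add_le:
  fixes x y X Y :: real
  shows "\<bar>x\<bar> \<le> X \<Longrightarrow> \<bar>y\<bar> \<le> Y \<Longrightarrow> \<bar>x + y\<bar> \<le> X + Y"
  by linarith

lemma bounded_profile_mono: "bounded_profile T B u \<Longrightarrow> B \<le> B' \<Longrightarrow> bounded_profile T B' u"
  unfolding bounded_profile_def by (meson order_trans)

lemma admissible_mono:
  assumes "admissible T R c B0 B0' l C2 f f'" "B0 \<le> B1" "B0' \<le> B1'" "l \<le> l'" "C2 \<le> C2'"
  shows "admissible T R c B1 B1' l' C2' f f'"
proof -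
  have "\<bar>f u i (t, x) - f u i (t', x)\<bar> \<le> l' * \<bar>t - t'\<bar>" if "lip_profile T R u" for u i t t' x
    using admissible_lip[OF assms(1) that, of i t x t'] mult_right_mono[OF assms(4), of "\<bar>t - t'\<bar>"] by simp
  moreover have "near (C2' * d) (f' u w) (f' v w)"
    if "lip_profile T R u" "lip_profile T R v" "bounded_profile T R w" "near d u v" for u v w d
  proof (rule near_mono[OF admissible_derivative_near_base[OF assms(1) that]])
    have "d \<ge> 0" using nearD[OF that(4), of True "(0,0)"] by simp
    then show "C2 * d \<le> C2' * d" using assms(5) by (intro mult_right_mono)
  qed
  moreover have "bounded_profile T B1 (f u)" if "lip_profile T R u" for u
    by (rule bounded_profile_mono[OF admissible_bounded[OF assms(1) that] assms(2)])
  moreover have "bounded_profile T B1' (f' u w)" if "lip_profile T R u" "bounded_profile T R w" for u w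
    by (rule bounded_profile_mono[OF admissible_derivative_bounded[OF assms(1) that] assms(3)])
  ultimately show ?thesis
    unfolding admissible_def using admissible_near[OF assms(1)]
      admissible_derivative_near[OF assms(1)] admissible_t_derivative[OF assms(1)]
    by (intro conjI allI impI) metis+
qed

text \<open>The component moving towards decreasing \<open>x\<close> is described in the reflected variable \<open>L - x\<close>,
  so that both components enter at \<open>0\<close>; the other component is then seen at the reflected point.\<close>

definition partner :: "real \<Rightarrow> profile \<Rightarrow> profile" where
  "partner L u = (\<lambda>i (t, x). u (\<not> i) (t, L - x))"

lemma partner_bounded: "bounded_profile T R u \<Longrightarrow> bounded_profile T R (partner L u)"
  unfolding bounded_profile_def partner_def case_prod_beta
  by (auto intro!: continuous_intros continuous_on_profile_compose)

lemma partner_lip: "lip_profile T R u \<Longrightarrow> lip_profile T R (partner L u)"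
  using partner_bounded by (auto simp: lip_profile_def partner_def)

lemma partner_near: "near d u v \<Longrightarrow> near d (partner L u) (partner L v)"
  by (auto simp: near_def partner_def)

lemma partner_t_derivative: "t_derivative u w \<Longrightarrow> t_derivative (partner L u) (partner L w)"
  by (auto simp: t_derivative_def partner_def)

text \<open>After reflection the component \<open>False\<close> has speed -\<lambda>1 = \<mu> - (p
  \<phi>1 + q \<phi>2), while \<open>True\<close> has \<lambda>2 = \<mu> + (p \<phi>2 + q \<phi>1).
  In both, p multiplies the component itself and q its partner; only the sign differs.\<close>

definition sgn_of :: "bool \<Rightarrow> real" where "sgn_of i = (if i then 1 else -1)"

lemma abs_sgn_of [simp]: "\<bar>sgn_of i\<bar> = 1" by (simp add: sgn_of_def)

text \<open>The number \<mu> is the background sound speed, b bounds the friction, \<epsilon> its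
  time derivative and the boundary data, and e1 its deviation from the constant value encoded in k.
  \<open>RS\<close> keeps the perturbed speeds at least \<mu>/2. The friction carries an index
  because each component sees it in its own space variable.\<close>

locale reflected_system =
  fixes L T R \<mu> p q k b \<epsilon> e1 \<kappa> :: real and \<beta> \<beta>' :: profile and \<phi>b \<phi>b' :: "bool \<Rightarrow> real \<Rightarrow> real"
    and \<kappa>b :: "bool \<Rightarrow> real"
  assumes R: "R \<ge> 0" and \<mu>: "\<mu> > 0" and k: "k \<ge> 0" and b: "b \<ge> 0" and \<epsilon>: "\<epsilon> \<ge> 0" and \<kappa>: "\<kappa> \<ge> 0"
    and RS: "(\<bar>p\<bar> + \<bar>q\<bar>) * R \<le> \<mu> / 2"
    and \<beta>: "bounded_profile T b \<beta>" "bounded_profile T \<epsilon> \<beta>'" "t_derivative \<beta> \<beta>'"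
    and \<beta>k: "\<And>i z. \<bar>\<beta> i z / (2 * \<mu>) + k\<bar> \<le> e1"
    and \<phi>b: "\<And>i t. (\<phi>b i has_real_derivative \<phi>b' i t) (at t)" "\<And>i. continuous_on UNIV (\<phi>b' i)"
      "\<And>i t. \<phi>b i (t + T) = \<phi>b i t" "\<And>i t. \<phi>b' i (t + T) = \<phi>b' i t"
      "\<And>i t. \<bar>\<phi>b i t\<bar> \<le> \<epsilon>" "\<And>i t. \<bar>\<phi>b' i t\<bar> \<le> \<epsilon>"
    and \<kappa>b: "\<And>i. \<bar>\<kappa>b i\<bar> \<le> \<kappa>"
begin

text \<open>On speeds at least \<mu>/2 the reciprocal has Lipschitz constant 4/\<mu>^2; the
  remaining factor is that of the speed as a function of the profile.\<close>

definition "N = 4 * (\<bar>p\<bar> + \<bar>q\<bar>) / \<mu>\<^sup>2"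
definition "\<nu>0 = N * R * b / 2 + e1"

text \<open>The reciprocal speed dt/dx, which is the coefficient of the time derivative once the
  equation is solved for the derivative in x.\<close>

definition slow :: "profile \<Rightarrow> profile" where
  "slow u = (\<lambda>i z. 1 / (\<mu> + sgn_of i * (p * u i z + q * partner L u i z)))"

definition slow' :: "profile \<Rightarrow> profile \<Rightarrow> profile" where
  "slow' u w = (\<lambda>i z. - sgn_of i * (p * w i z + q * partner L w i z) * (slow u i z * slow u i z))"

text \<open>After division by the speed the right side is (slow \<beta> / 2) (u + partner).
  Subtracting and adding k (u + partner) gives -k u, which is handled by the exponential, the
  coupling -k partner of gain exactly k, and a remainder with the small coefficient slow \<beta> / 2
  + k.\<close>

definition src :: "profile \<Rightarrow> profile" where
  "src u = (\<lambda>i z. - k * partner L u i z + (slow u i z * \<beta> i z / 2 + k) * (u i z + partner L u i z))"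

definition src' :: "profile \<Rightarrow> profile \<Rightarrow> profile" where
  "src' u w = (\<lambda>i z. - k * partner L w i z + ((slow' u w i z * \<beta> i z + slow u i z * \<beta>' i z) / 2) * (u i z + partner L u i z)
      + (slow u i z * \<beta> i z / 2 + k) * (w i z + partner L w i z))"

definition bdry :: "profile \<Rightarrow> profile" where
  "bdry u = (\<lambda>i (t, x). \<phi>b i t + \<kappa>b i * u (\<not> i) (t, L))"

definition bdry' :: "profile \<Rightarrow> profile \<Rightarrow> profile" where
  "bdry' u w = (\<lambda>i (t, x). \<phi>b' i t + \<kappa>b i * w (\<not> i) (t, L))"

abbreviation "lipp \<equiv> lip_profile T R"
abbreviation "bddp \<equiv> bounded_profile T R"

section \<open>Estimates for the slowness, the source and the boundary operator\<close>

lemma N_nonneg: "N \<ge> 0" by (simp add: N_def)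
lemma e1_nonneg: "e1 \<ge> 0" using \<beta>k[of True "(0,0)"] by linarith
lemma \<nu>0_nonneg: "\<nu>0 \<ge> 0" using N_nonneg R b e1_nonneg by (simp add: \<nu>0_def)

lemma bddD:
  assumes "bounded_profile T B u"
  shows "\<bar>u i z\<bar> \<le> B" "\<bar>partner L u i z\<bar> \<le> B"
  using assms partner_bounded[OF assms] by (cases z; simp add: bounded_profile_def)+

lemma lippD: "lipp u \<Longrightarrow> bddp u" by (simp add: lip_profile_def)

lemma lin_bound:
  fixes x y d :: real
  assumes "\<bar>x\<bar> \<le> d" "\<bar>y\<bar> \<le> d"
  shows "\<bar>sgn_of i * (p * x + q * y)\<bar> \<le> (\<bar>p\<bar> + \<bar>q\<bar>) * d"
proof -
  have "\<bar>p * x + q * y\<bar> \<le> \<bar>p\<bar> * d + \<bar>q\<bar> * d"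
    by (intro abs_add_le abs_mult_le assms order_refl)
  then show ?thesis by (simp add: abs_mult distrib_right)
qed

lemma speed_lower:
  assumes "bddp u"
  shows "\<mu> + sgn_of i * (p * u i z + q * partner L u i z) \<ge> \<mu> / 2"
  using lin_bound[OF bddD[OF assms], of i i z i z] RS by linarith

lemma slow_bounds:
  assumes "bddp u"
  shows "0 < slow u i z" "\<bar>slow u i z\<bar> \<le> 2 / \<mu>" 
proof -
  let ?D = "\<mu> + sgn_of i * (p * u i z + q * partner L u i z)"
  have D: "?D \<ge> \<mu> / 2" by (rule speed_lower[OF assms])
  then show 0: "0 < slow u i z" using \<mu> by (simp add: slow_def)
  have "slow u i z \<le> 1 / (\<mu> / 2)" unfolding slow_def using D \<mu> by (intro divide_left_mono) auto
  then show "\<bar>slow u i z\<bar> \<le> 2 / \<mu>" using 0 by simp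
qed

lemma inverse_speed_diff:
  fixes x y X Y d :: real
  assumes "\<mu> + x \<ge> \<mu> / 2" "\<mu> + y \<ge> \<mu> / 2" "\<bar>x - y\<bar> \<le> (\<bar>p\<bar> + \<bar>q\<bar>) * d"
  shows "\<bar>1 / (\<mu> + x) - 1 / (\<mu> + y)\<bar> \<le> N * d"
proof -
  have p: "\<mu> + x > 0" "\<mu> + y > 0" using assms \<mu> by auto
  have "1 / (\<mu> + x) - 1 / (\<mu> + y) = (y - x) * (1 / (\<mu> + x) * (1 / (\<mu> + y)))"
    using p by (simp add: field_simps)
  also have "\<bar>\<dots>\<bar> \<le> ((\<bar>p\<bar> + \<bar>q\<bar>) * d) * (1 / (\<mu> / 2) * (1 / (\<mu> / 2)))"
    using assms p \<mu> by (intro abs_mult_le) (auto simp: abs_minus_commute divide_simps)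
  also have "\<dots> = N * d" using \<mu> by (simp add: N_def power2_eq_square field_simps)
  finally show ?thesis .
qed

lemma slow_diff:
  assumes "bddp u" "bddp v" "\<bar>u i z - v i z'\<bar> \<le> d" "\<bar>partner L u i z - partner L v i z'\<bar> \<le> d"
  shows "\<bar>slow u i z - slow v i z'\<bar> \<le> N * d"
proof -
  have "sgn_of i * (p * u i z + q * partner L u i z) - sgn_of i * (p * v i z' + q * partner L v i z')
    = sgn_of i * (p * (u i z - v i z') + q * (partner L u i z - partner L v i z'))"
    by (simp add: algebra_simps)
  then have "\<bar>sgn_of i * (p * u i z + q * partner L u i z) - sgn_of i * (p * v i z' + q * partner L v i z')\<bar>
    \<le> (\<bar>p\<bar> + \<bar>q\<bar>) * d"
    using lin_bound[OF assms(3,4)] by simp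
  then show ?thesis unfolding slow_def by (intro inverse_speed_diff speed_lower assms)
qed

lemma slow_diff_const:
  assumes "bddp u"
  shows "\<bar>slow u i z - 1 / \<mu>\<bar> \<le> N * R"
  using inverse_speed_diff[of "sgn_of i * (p * u i z + q * partner L u i z)" 0 R]
    speed_lower[OF assms, of i z] lin_bound[OF bddD[OF assms], of i i z i z] \<mu>
  by (simp add: slow_def)

lemma near_both:
  assumes "near d u v"
  shows "\<bar>u i z - v i z\<bar> \<le> d" "\<bar>partner L u i z - partner L v i z\<bar> \<le> d"
  using nearD[OF assms] nearD[OF partner_near[OF assms]] by auto

lemma lip_both:
  assumes "lipp u"
  shows "\<bar>u i (t, x) - u i (t', x)\<bar> \<le> R * \<bar>t - t'\<bar>" "\<bar>partner L u i (t, x) - partner L u i (t', x)\<bar> \<le> R * \<bar>t - t'\<bar>"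
  using assms partner_lip[OF assms, of L] by (auto simp: lip_profile_def)

lemma continuous_both:
  assumes "bounded_profile T B u"
  shows "continuous_on UNIV (u i)" "continuous_on UNIV (partner L u i)"
  using assms partner_bounded[OF assms, of L] by (auto simp: bounded_profile_def)

lemma periodic_both:
  assumes "bounded_profile T B u"
  shows "u i (t + T, x) = u i (t, x)" "partner L u i (t + T, x) = partner L u i (t, x)"
  using assms partner_bounded[OF assms, of L] by (auto simp: bounded_profile_def)

lemma t_derivative_both:
  assumes "t_derivative u w"
  shows "((\<lambda>t. u i (t, x)) has_real_derivative w i (t, x)) (at t)"
    "((\<lambda>t. partner L u i (t, x)) has_real_derivative partner L w i (t, x)) (at t)"
  using assms partner_t_derivative[OF assms, of L] by (auto simp: t_derivative_def)

lemma slow_continuous: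
  assumes "bddp u"
  shows "continuous_on UNIV (slow u i)"
  unfolding slow_def using speed_lower[OF assms] \<mu>
  by (intro continuous_intros continuous_both[OF assms]) (smt (verit) half_gt_zero)

lemma slow_sq_diff:
  assumes "bddp u" "bddp v" "\<bar>slow u i z - slow v i z\<bar> \<le> N * d"
  shows "\<bar>slow u i z * slow u i z - slow v i z * slow v i z\<bar> \<le> 4 / \<mu> * N * d"
  using abs_mult_diff_le[OF slow_bounds(2)[OF assms(1)] slow_bounds(2)[OF assms(2)] assms(3) assms(3)]
  by (simp add: mult_ac)

lemma slow'_bound:
  assumes "bddp u" "\<bar>w1\<bar> \<le> d" "\<bar>w2\<bar> \<le> d"
  shows "\<bar>- sgn_of i * (p * w1 + q * w2) * (slow u i z * slow u i z)\<bar> \<le> N * d"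
proof -
  have "\<bar>(sgn_of i * (p * w1 + q * w2)) * (slow u i z * slow u i z)\<bar> \<le> ((\<bar>p\<bar> + \<bar>q\<bar>) * d) * (2 / \<mu> * (2 / \<mu>))"
    by (intro abs_mult_le[of _ _ "slow u i z * slow u i z"] lin_bound assms abs_mult_le slow_bounds(2))
  also have "\<dots> = N * d" by (simp add: N_def power2_eq_square)
  finally show ?thesis by simp
qed

lemma admissible_slow:
  "admissible T R N (2 / \<mu>) (N * R) (N * R) ((\<bar>p\<bar> + \<bar>q\<bar>) * R * (4 / \<mu> * N)) slow slow'"
  unfolding admissible_def
proof (intro conjI allI impI)
  fix u assume u: "lipp u"
  show "bounded_profile T (2 / \<mu>) (slow u)"
    unfolding bounded_profile_def using slow_continuous slow_bounds lippD[OF u]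
    by (auto simp: slow_def periodic_both[OF lippD[OF u]])
  show "\<bar>slow u i (t, x) - slow u i (t', x)\<bar> \<le> N * R * \<bar>t - t'\<bar>" for i t t' x
    using slow_diff[OF lippD[OF u] lippD[OF u] lip_both[OF u]] by (simp add: mult.assoc)
next
  fix u v :: profile and d assume "lipp u" "lipp v" "near d u v"
  then show "near (N * d) (slow u) (slow v)"
    unfolding near_def[of "N * d"] by (intro allI slow_diff lippD near_both)
next
  fix u w assume u: "lipp u" and w: "bddp w"
  show "bounded_profile T (N * R) (slow' u w)"
    unfolding bounded_profile_def slow'_def
    by (intro conjI allI continuous_intros slow_continuous continuous_both[OF w] lippD[OF u]
       slow'_bound bddD[OF w]) 
     (simp add: slow_def periodic_both[OF lippD[OF u]] periodic_both[OF w])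
next
  fix u w w' :: profile and d assume u: "lipp u" and "near d w w'"
  then have "\<bar>- sgn_of i * (p * (w i z - w' i z) + q * (partner L w i z - partner L w' i z)) * (slow u i z * slow u i z)\<bar> \<le> N * d" for i z
    by (intro slow'_bound near_both lippD)
  moreover have "slow' u w i z - slow' u w' i z
     = - sgn_of i * (p * (w i z - w' i z) + q * (partner L w i z - partner L w' i z)) * (slow u i z * slow u i z)" for i z
    by (simp add: slow'_def algebra_simps)
  ultimately show "near (N * d) (slow' u w) (slow' u w')" by (simp add: near_def)
next
  fix u v w d assume u: "lipp u" "lipp v" and w: "bddp w" and n: "near d u v"
  have "slow' u w i z - slow' v w i z = - ((sgn_of i * (p * w i z + q * partner L w i z)) * (slow u i z * slow u i z - slow v i z * slow v i z))" for i z
    by (simp add: slow'_def algebra_simps)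
  moreover have "\<bar>(sgn_of i * (p * w i z + q * partner L w i z)) * (slow u i z * slow u i z - slow v i z * slow v i z)\<bar>
    \<le> ((\<bar>p\<bar> + \<bar>q\<bar>) * R) * (4 / \<mu> * N * d)" for i z
    by (intro abs_mult_le lin_bound bddD[OF w] slow_sq_diff slow_diff near_both[OF n] lippD u)
  ultimately show "near ((\<bar>p\<bar> + \<bar>q\<bar>) * R * (4 / \<mu> * N) * d) (slow' u w) (slow' v w)"
    by (simp add: near_def mult.assoc)
next
  fix u w assume u: "lipp u" and w: "bddp w" and d: "t_derivative u w"
  show "t_derivative (slow u) (slow' u w)"
    unfolding t_derivative_def
  proof (intro allI)
    fix i t x
    have nz: "\<mu> + sgn_of i * (p * u i (t, x) + q * partner L u i (t, x)) \<noteq> 0"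
      using speed_lower[OF lippD[OF u], of i "(t, x)"] \<mu> by linarith
    show "((\<lambda>t. slow u i (t, x)) has_real_derivative slow' u w i (t, x)) (at t)"
      unfolding slow_def slow'_def
      by (rule derivative_eq_intros t_derivative_both[OF d] refl nz)+ (simp add: field_simps nz)
  qed
qed

lemma \<beta>_lip: "\<bar>\<beta> i (t, x) - \<beta> i (t', x)\<bar> \<le> \<epsilon> * \<bar>t - t'\<bar>"
proof -
  have "norm (\<beta> i (t, x) - \<beta> i (t', x)) \<le> \<epsilon> * norm (t - t')"
    by (rule field_differentiable_bound[of UNIV "\<lambda>t. \<beta> i (t, x)" "\<lambda>t. \<beta>' i (t, x)"])
      (use \<beta> in \<open>auto simp: t_derivative_def bounded_profile_def\<close>)
  then show ?thesis by simp
qed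

lemma \<beta>_bound: "\<bar>\<beta> i z\<bar> \<le> b" "\<bar>\<beta>' i z\<bar> \<le> \<epsilon>"
  using bddD[OF \<beta>(1)] bddD[OF \<beta>(2)] by auto

text \<open>The coefficient is small for two separate reasons: the slowness is close to 1/\<mu> for
  small profiles, and \<beta>/(2\<mu>) is close to -k by \<open>\<beta>k\<close>.\<close>

lemma \<nu>_bound:
  assumes "bddp u"
  shows "\<bar>slow u i z * \<beta> i z / 2 + k\<bar> \<le> \<nu>0"
proof -
  have "slow u i z * \<beta> i z / 2 + k = (slow u i z - 1 / \<mu>) * (\<beta> i z / 2) + (\<beta> i z / (2 * \<mu>) + k)"
    by (simp add: field_simps)
  also have "\<bar>\<dots>\<bar> \<le> (N * R) * (b / 2) + e1"
    by (intro abs_add_le abs_mult_le slow_diff_const assms \<beta>k) (use \<beta>_bound in simp)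
  finally show ?thesis by (simp add: \<nu>0_def)
qed

lemma damping_bound: "\<bar>x\<bar> \<le> d \<Longrightarrow> \<bar>- k * x\<bar> \<le> k * d"
  using k by (simp add: abs_mult mult_left_mono)

text \<open>One estimate for two purposes. Equal points, different profiles and e = 0 give the
  Lipschitz constant in the profile; one profile at two times gives the Lipschitz constant in
  time.\<close>

lemma src_diff:
  assumes u: "bddp u" "bddp v" and uv: "\<bar>u i z - v i z'\<bar> \<le> d" "\<bar>partner L u i z - partner L v i z'\<bar> \<le> d"
    and e: "\<bar>\<beta> i z - \<beta> i z'\<bar> \<le> e"
  shows "\<bar>src u i z - src v i z'\<bar> \<le> (k + (2 * \<nu>0 + N * b * R)) * d + 2 / \<mu> * R * e"
proof -
  have "\<bar>slow u i z * \<beta> i z - slow v i z' * \<beta> i z'\<bar> \<le> 2 / \<mu> * e + N * d * b"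
    by (intro abs_mult_diff_le slow_bounds \<beta>_bound slow_diff u uv e)
  moreover have "(slow u i z * \<beta> i z / 2 + k) - (slow v i z' * \<beta> i z' / 2 + k)
      = (slow u i z * \<beta> i z - slow v i z' * \<beta> i z') / 2"
    by (simp add: field_simps)
  ultimately have "\<bar>(slow u i z * \<beta> i z / 2 + k) - (slow v i z' * \<beta> i z' / 2 + k)\<bar> \<le> e / \<mu> + N * d * b / 2"
    by simp
  moreover have "\<bar>v i z' + partner L v i z'\<bar> \<le> R + R"
    by (intro abs_add_le bddD u)
  moreover have "\<bar>(u i z + partner L u i z) - (v i z' + partner L v i z')\<bar> \<le> d + d"
    using uv by linarith
  ultimately have "\<bar>(slow u i z * \<beta> i z / 2 + k) * (u i z + partner L u i z)
      - (slow v i z' * \<beta> i z' / 2 + k) * (v i z' + partner L v i z')\<bar>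
    \<le> \<nu>0 * (d + d) + (e / \<mu> + N * d * b / 2) * (R + R)"
    by (intro abs_mult_diff_le \<nu>_bound u)
  moreover have "\<bar>- k * (partner L u i z - partner L v i z')\<bar> \<le> k * d" 
    by (intro damping_bound uv)
  moreover have "src u i z - src v i z' = - k * (partner L u i z - partner L v i z')
    + ((slow u i z * \<beta> i z / 2 + k) * (u i z + partner L u i z)
      - (slow v i z' * \<beta> i z' / 2 + k) * (v i z' + partner L v i z'))"
    by (simp add: src_def algebra_simps)
  ultimately have "\<bar>src u i z - src v i z'\<bar> \<le> k * d + (\<nu>0 * (d + d) + (e / \<mu> + N * d * b / 2) * (R + R))"
    by (simp only: abs_add_le)
  also have "\<dots> = (k + (2 * \<nu>0 + N * b * R)) * d + 2 / \<mu> * R * e"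
    by (simp add: algebra_simps)
  finally show ?thesis .
qed

text \<open>What the source and its derivative may exceed k R by. When R, e1 and \<epsilon> are of
  the same small order, this is quadratic in that order.\<close>

definition "c1 = 2 * \<nu>0 * R + (N * R * b + 2 / \<mu> * \<epsilon>) * R"
text \<open>The Lipschitz constant of \<open>src'\<close> in the base profile. It multiplies the
  distance between an iterate and its limit, so no smallness is asked of it.\<close>

definition "C2src = (((\<bar>p\<bar> + \<bar>q\<bar>) * R * (4 / \<mu> * N) * b + N * \<epsilon>) / 2) * (R + R)
   + ((N * R * b + 2 / \<mu> * \<epsilon>) / 2) * 2 + N * b / 2 * (R + R)"

lemma slow'_bound':
  assumes "lipp u" "bddp w"
  shows "\<bar>slow' u w i z\<bar> \<le> N * R"
  unfolding slow'_def by (intro slow'_bound lippD assms bddD)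

lemma \<nu>'_bound:
  assumes "lipp u" "bddp w"
  shows "\<bar>(slow' u w i z * \<beta> i z + slow u i z * \<beta>' i z) / 2\<bar> \<le> (N * R * b + 2 / \<mu> * \<epsilon>) / 2"
proof -
  have "\<bar>slow' u w i z * \<beta> i z + slow u i z * \<beta>' i z\<bar> \<le> N * R * b + 2 / \<mu> * \<epsilon>"
    by (intro abs_add_le abs_mult_le slow'_bound' \<beta>_bound slow_bounds lippD assms)
  then show ?thesis by simp
qed

lemma admissible_src:
  "admissible T R (k + (2 * \<nu>0 + N * b * R)) (k * R + c1) (k * R + c1) (k * R + c1) C2src src src'"
  unfolding admissible_def
proof (intro conjI allI impI)
  fix u assume u: "lipp u"
  note bu = lippD[OF u]
  show "bounded_profile T (k * R + c1) (src u)"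
    unfolding bounded_profile_def
  proof (intro conjI allI)
    fix i t x
    show "continuous_on UNIV (src u i)"
      unfolding src_def by (intro continuous_intros slow_continuous continuous_both[OF bu] continuous_both[OF \<beta>(1)] bu) auto
    show "src u i (t + T, x) = src u i (t, x)"
      by (simp add: src_def slow_def periodic_both[OF bu] periodic_both[OF \<beta>(1)])
    have "\<bar>src u i (t, x)\<bar> \<le> k * R + \<nu>0 * (R + R)"
      unfolding src_def by (rule abs_add_le[OF damping_bound[OF bddD(2)[OF bu]]
        abs_mult_le[OF \<nu>_bound[OF bu] abs_add_le[OF bddD[OF bu]]]])
    also have "\<dots> \<le> k * R + c1" using N_nonneg R b \<epsilon> \<mu> by (simp add: c1_def algebra_simps)
    finally show "\<bar>src u i (t, x)\<bar> \<le> k * R + c1" .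
  qed
  show "\<bar>src u i (t, x) - src u i (t', x)\<bar> \<le> (k * R + c1) * \<bar>t - t'\<bar>" for i t t' x
    using src_diff[OF bu bu lip_both[OF u] \<beta>_lip] by (simp add: c1_def algebra_simps)
next
  fix u v :: profile and d assume u: "lipp u" "lipp v" and n: "near d u v"
  show "near ((k + (2 * \<nu>0 + N * b * R)) * d) (src u) (src v)"
    using src_diff[OF lippD[OF u(1)] lippD[OF u(2)] near_both[OF n], where e = 0] by (auto simp: near_def)
next
  fix u w assume u: "lipp u" and w: "bddp w"
  note bu = lippD[OF u]
  note sl' = admissible_derivative_bounded[OF admissible_slow u w]
  show "bounded_profile T (k * R + c1) (src' u w)"
    unfolding bounded_profile_def
  proof (intro conjI allI)
    fix i t x
    show "continuous_on UNIV (src' u w i)"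
      unfolding src'_def by (intro continuous_intros slow_continuous continuous_both[OF bu] 
        continuous_both[OF \<beta>(1)] continuous_both[OF \<beta>(2)] continuous_both[OF w] continuous_both[OF sl'] bu) auto
    show "src' u w i (t + T, x) = src' u w i (t, x)"
      by (simp add: src'_def slow'_def slow_def periodic_both[OF bu] periodic_both[OF \<beta>(1)] periodic_both[OF \<beta>(2)] periodic_both[OF w])
    have "\<bar>src' u w i (t, x)\<bar> \<le> k * R + ((N * R * b + 2 / \<mu> * \<epsilon>) / 2) * (R + R) + \<nu>0 * (R + R)"
      unfolding src'_def by (rule abs_add_le[OF abs_add_le[OF damping_bound[OF bddD(2)[OF w]]
        abs_mult_le[OF \<nu>'_bound[OF u w] abs_add_le[OF bddD[OF bu]]]]
        abs_mult_le[OF \<nu>_bound[OF bu] abs_add_le[OF bddD[OF w]]]])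
    also have "\<dots> = k * R + c1" by (simp add: c1_def algebra_simps)
    finally show "\<bar>src' u w i (t, x)\<bar> \<le> k * R + c1" .
  qed
next
  fix u w w' :: profile and d assume u: "lipp u" and w: "bddp w" "bddp w'" and n: "near d w w'"
  show "near ((k + (2 * \<nu>0 + N * b * R)) * d) (src' u w) (src' u w')"
    unfolding near_def
  proof (intro allI)
    fix i z
    have "\<bar>slow' u w i z - slow' u w' i z\<bar> \<le> N * d"
      using admissible_derivative_near[OF admissible_slow u w n] by (rule nearD)
    then have "\<bar>(slow' u w i z - slow' u w' i z) * (\<beta> i z / 2)\<bar> \<le> (N * d) * (b / 2)"
      by (intro abs_mult_le) (use \<beta>_bound in auto)
    then have "\<bar>- k * (partner L w i z - partner L w' i z) + ((slow' u w i z - slow' u w' i z) * (\<beta> i z / 2)) * (u i z + partner L u i z)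
      + (slow u i z * \<beta> i z / 2 + k) * ((w i z - w' i z) + (partner L w i z - partner L w' i z))\<bar>
      \<le> k * d + ((N * d) * (b / 2)) * (R + R) + \<nu>0 * (d + d)"
      by (rule abs_add_le[OF abs_add_le[OF damping_bound[OF near_both(2)[OF n]]
        abs_mult_le[OF _ abs_add_le[OF bddD[OF lippD[OF u]]]]]
        abs_mult_le[OF \<nu>_bound[OF lippD[OF u]] abs_add_le[OF near_both[OF n]]]])
    moreover have "src' u w i z - src' u w' i z = - k * (partner L w i z - partner L w' i z)
      + ((slow' u w i z - slow' u w' i z) * (\<beta> i z / 2)) * (u i z + partner L u i z)
      + (slow u i z * \<beta> i z / 2 + k) * ((w i z - w' i z) + (partner L w i z - partner L w' i z))"
      by (simp add: src'_def field_simps)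
    ultimately have "\<bar>src' u w i z - src' u w' i z\<bar> \<le> k * d + ((N * d) * (b / 2)) * (R + R) + \<nu>0 * (d + d)"
      by simp
    then show "\<bar>src' u w i z - src' u w' i z\<bar> \<le> (k + (2 * \<nu>0 + N * b * R)) * d"
      by (simp add: algebra_simps)
  qed
next
  fix u v w d assume u: "lipp u" "lipp v" and w: "bddp w" and n: "near d u v"
  show "near (C2src * d) (src' u w) (src' v w)"
    unfolding near_def
  proof (intro allI)
    fix i z
    have d1: "\<bar>slow u i z - slow v i z\<bar> \<le> N * d"
      by (intro slow_diff lippD u near_both n)
    have "\<bar>slow' u w i z - slow' v w i z\<bar> \<le> (\<bar>p\<bar> + \<bar>q\<bar>) * R * (4 / \<mu> * N) * d"
      using admissible_derivative_near_base[OF admissible_slow u w n] by (rule nearD)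
    from abs_add_le[OF abs_mult_le[OF this \<beta>_bound(1)[of i z]] abs_mult_le[OF d1 \<beta>_bound(2)[of i z]]]
    have "\<bar>(slow' u w i z - slow' v w i z) * \<beta> i z + (slow u i z - slow v i z) * \<beta>' i z\<bar>
      \<le> (\<bar>p\<bar> + \<bar>q\<bar>) * R * (4 / \<mu> * N) * d * b + N * d * \<epsilon>"
      .
    moreover have "(slow' u w i z * \<beta> i z + slow u i z * \<beta>' i z) / 2 - (slow' v w i z * \<beta> i z + slow v i z * \<beta>' i z) / 2
      = ((slow' u w i z - slow' v w i z) * \<beta> i z + (slow u i z - slow v i z) * \<beta>' i z) / 2"
      by (simp add: field_simps)
    ultimately have d2: "\<bar>(slow' u w i z * \<beta> i z + slow u i z * \<beta>' i z) / 2 - (slow' v w i z * \<beta> i z + slow v i z * \<beta>' i z) / 2\<bar>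
      \<le> ((\<bar>p\<bar> + \<bar>q\<bar>) * R * (4 / \<mu> * N) * d * b + N * d * \<epsilon>) / 2"
      by (simp only: abs_divide abs_numeral divide_right_mono zero_le_numeral)
    have d3: "\<bar>(u i z + partner L u i z) - (v i z + partner L v i z)\<bar> \<le> d + d"
      using near_both[OF n, of i z] by linarith
    have d4: "\<bar>v i z + partner L v i z\<bar> \<le> R + R" by (intro abs_add_le bddD lippD u)
    have d5: "\<bar>w i z + partner L w i z\<bar> \<le> R + R" by (intro abs_add_le bddD w)
    have "\<bar>(slow u i z - slow v i z) * (\<beta> i z / 2)\<bar> \<le> (N * d) * (b / 2)"
      by (intro abs_mult_le d1) (use \<beta>_bound in auto)
    from abs_mult_le[OF this d5] abs_mult_diff_le[OF \<nu>'_bound[OF u(1) w] d4 d2 d3]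
    have "\<bar>((slow u i z - slow v i z) * (\<beta> i z / 2)) * (w i z + partner L w i z)
      + ((slow' u w i z * \<beta> i z + slow u i z * \<beta>' i z) / 2 * (u i z + partner L u i z)
        - (slow' v w i z * \<beta> i z + slow v i z * \<beta>' i z) / 2 * (v i z + partner L v i z))\<bar>
      \<le> (N * d) * (b / 2) * (R + R) + ((N * R * b + 2 / \<mu> * \<epsilon>) / 2 * (d + d) +
        ((\<bar>p\<bar> + \<bar>q\<bar>) * R * (4 / \<mu> * N) * d * b + N * d * \<epsilon>) / 2 * (R + R))"
      by (rule abs_add_le)
    moreover have "src' u w i z - src' v w i z = ((slow u i z - slow v i z) * (\<beta> i z / 2)) * (w i z + partner L w i z)
      + ((slow' u w i z * \<beta> i z + slow u i z * \<beta>' i z) / 2 * (u i z + partner L u i z)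
        - (slow' v w i z * \<beta> i z + slow v i z * \<beta>' i z) / 2 * (v i z + partner L v i z))"
      by (simp add: src'_def algebra_simps)
    ultimately have "\<bar>src' u w i z - src' v w i z\<bar> \<le> (N * d) * (b / 2) * (R + R) + ((N * R * b + 2 / \<mu> * \<epsilon>) / 2 * (d + d) +
        ((\<bar>p\<bar> + \<bar>q\<bar>) * R * (4 / \<mu> * N) * d * b + N * d * \<epsilon>) / 2 * (R + R))"
      by (simp only:)
    also have "\<dots> = C2src * d" by (simp add: C2src_def field_simps)
    finally show "\<bar>src' u w i z - src' v w i z\<bar> \<le> C2src * d" .
  qed
next
  fix u w assume u: "lipp u" and w: "bddp w" and d: "t_derivative u w"
  show "t_derivative (src u) (src' u w)"
    unfolding t_derivative_def src_def src'_def
    by (intro allI) (rule derivative_eq_intros t_derivative_both[OF d] t_derivative_both[OF \<beta>(3)]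
       t_derivative_both[OF admissible_t_derivative[OF admissible_slow u w d]] refl | simp add: field_simps)+
qed

text \<open>The boundary operator is affine in the profile, so its derivative does not depend on the
  base point and the corresponding constant is 0.\<close>

lemma admissible_bdry:
  "admissible T R \<kappa> (\<kappa> * R + \<epsilon>) (\<kappa> * R + \<epsilon>) (\<kappa> * R + \<epsilon>) 0 bdry bdry'"
proof -
  have kb: "\<bar>\<kappa>b i * x\<bar> \<le> \<kappa> * d" if "\<bar>x\<bar> \<le> d" for i x d
    using \<kappa>b that by (rule abs_mult_le)
  have \<phi>c: "continuous_on UNIV (\<phi>b i)" for i
    using \<phi>b(1) by (meson DERIV_isCont continuous_at_imp_continuous_on)
  have \<phi>lip: "\<bar>\<phi>b i t - \<phi>b i t'\<bar> \<le> \<epsilon> * \<bar>t - t'\<bar>" for i t t'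
    using field_differentiable_bound[of UNIV "\<phi>b i" "\<phi>b' i" \<epsilon> t t'] \<phi>b by auto
  show ?thesis
    unfolding admissible_def
  proof (intro conjI allI impI)
    fix u assume u: "lipp u"
    note bu = lippD[OF u]
    show "bounded_profile T (\<kappa> * R + \<epsilon>) (bdry u)"
      unfolding bounded_profile_def
    proof (intro conjI allI)
      fix i t x
      show "continuous_on UNIV (bdry u i)"
        unfolding bdry_def case_prod_beta 
        by (intro continuous_intros continuous_on_profile_compose[OF continuous_both(1)[OF bu]] continuous_on_compose2[OF \<phi>c]) auto
      show "bdry u i (t + T, x) = bdry u i (t, x)"
        by (simp add: bdry_def periodic_both[OF bu] \<phi>b)
      show "\<bar>bdry u i (t, x)\<bar> \<le> \<kappa> * R + \<epsilon>"
        using abs_add_le[OF kb[OF bddD(1)[OF bu]] \<phi>b(5)] by (simp add: bdry_def add.commute)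
    qed
    fix i t t' x
    have "\<bar>(\<phi>b i t - \<phi>b i t') + \<kappa>b i * (u (\<not> i) (t, L) - u (\<not> i) (t', L))\<bar> \<le> \<epsilon> * \<bar>t - t'\<bar> + \<kappa> * (R * \<bar>t - t'\<bar>)"
      by (intro abs_add_le \<phi>lip kb lip_both u)
    then show "\<bar>bdry u i (t, x) - bdry u i (t', x)\<bar> \<le> (\<kappa> * R + \<epsilon>) * \<bar>t - t'\<bar>"
      by (simp add: bdry_def algebra_simps)
  next
    fix u v :: profile and d assume n: "near d u v"
    show "near (\<kappa> * d) (bdry u) (bdry v)"
      using kb[OF near_both(1)[OF n]] by (auto simp: near_def bdry_def simp flip: right_diff_distrib)
  next
    fix u w assume w: "bddp w"
    show "bounded_profile T (\<kappa> * R + \<epsilon>) (bdry' u w)"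
      unfolding bounded_profile_def
    proof (intro conjI allI)
      fix i t x
      show "continuous_on UNIV (bdry' u w i)"
        unfolding bdry'_def case_prod_beta 
        by (intro continuous_intros continuous_on_profile_compose[OF continuous_both(1)[OF w]] continuous_on_compose2[OF \<phi>b(2)]) auto
      show "bdry' u w i (t + T, x) = bdry' u w i (t, x)"
        by (simp add: bdry'_def periodic_both[OF w] \<phi>b)
      show "\<bar>bdry' u w i (t, x)\<bar> \<le> \<kappa> * R + \<epsilon>"
        using abs_add_le[OF kb[OF bddD(1)[OF w]] \<phi>b(6)] by (simp add: bdry'_def add.commute)
    qed
  next
    fix u w w' :: profile and d assume n: "near d w w'"
    show "near (\<kappa> * d) (bdry' u w) (bdry' u w')"
      using kb[OF near_both(1)[OF n]] by (auto simp: near_def bdry'_def simp flip: right_diff_distrib)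
  next
    fix u v w :: profile and d :: real
    show "near (0 * d) (bdry' u w) (bdry' v w)" by (simp add: near_def bdry'_def)
  next
    fix u w assume d: "t_derivative u w"
    show "t_derivative (bdry u) (bdry' u w)"
      unfolding t_derivative_def bdry_def bdry'_def prod.case
      by (auto intro!: derivative_eq_intros \<phi>b(1) t_derivative_both[OF d])
  qed
qed

end

section \<open>Periodic extension and the given norms\<close>

text \<open>The shift moves the argument to a time not smaller than \<open>T\<close>, so only values
  on the half line are used, away from its endpoint where derivatives are one-sided.\<close>

definition periodic_extension :: "real \<Rightarrow> (real \<Rightarrow> 'a) \<Rightarrow> real \<Rightarrow> 'a" where
  "periodic_extension T f t = f (t + real (nat \<lceil>\<bar>t\<bar> / T\<rceil> + 1) * T)"

lemma periodic_multiple: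
  assumes "\<And>t. t \<ge> 0 \<Longrightarrow> f (t + T) = f t" "T > 0" "t \<ge> 0"
  shows "f (t + real n * T) = f t"
proof (induction n)
  case (Suc n)
  have "f (t + real (Suc n) * T) = f ((t + real n * T) + T)" by (simp add: algebra_simps)
  then show ?case using Suc assms by simp
qed simp

lemma periodic_extension_eq:
  assumes f: "\<And>t. t \<ge> 0 \<Longrightarrow> f (t + T) = f t" and T: "T > 0" and t: "t + real n * T \<ge> 0"
  shows "periodic_extension T f t = f (t + real n * T)"
proof -
  define m where "m = nat \<lceil>\<bar>t\<bar> / T\<rceil> + 1"
  have "\<bar>t\<bar> / T \<le> real m" by (simp add: m_def) linarith
  then have m: "t + real m * T \<ge> 0" using T by (simp add: field_simps)
  have "f (t + real m * T) = f (t + real n * T)"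
  proof (cases "m \<le> n")
    case True
    have eq: "t + real n * T = (t + real m * T) + real (n - m) * T"
      using True by (simp add: of_nat_diff algebra_simps)
    show ?thesis unfolding eq by (rule periodic_multiple[of f, symmetric, OF f T m])
  next
    case False
    then have eq: "t + real m * T = (t + real n * T) + real (m - n) * T"
      by (simp add: of_nat_diff algebra_simps)
    show ?thesis unfolding eq by (rule periodic_multiple[of f, OF f T t])
  qed
  then show ?thesis by (simp add: periodic_extension_def m_def)
qed

lemma periodic_extension_nonneg:
  assumes "\<And>t. t \<ge> 0 \<Longrightarrow> f (t + T) = f t" "T > 0" "t \<ge> 0"
  shows "periodic_extension T f t = f t"
  using periodic_extension_eq[of f T t 0] assms by simp

lemma ex_positive_shift:
  fixes t T :: real
  assumes "T > 0"
  obtains n where "t + real n * T > 0"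
proof -
  obtain n where "- t < real n * T" using reals_Archimedean3[OF assms] by blast
  then show ?thesis by (intro that[of n]) simp
qed

lemma periodic_extension_obtain:
  assumes "\<And>t. t \<ge> 0 \<Longrightarrow> f (t + T) = f t" "T > 0"
  obtains s where "s > 0" "periodic_extension T f t = f s"
  using ex_positive_shift[OF assms(2), of t] periodic_extension_eq[of f T t] assms
  by (metis less_imp_le)

lemma periodic_extension_periodic:
  assumes f: "\<And>t. t \<ge> 0 \<Longrightarrow> f (t + T) = f t" and T: "T > 0"
  shows "periodic_extension T f (t + T) = periodic_extension T f t"
proof -
  obtain n where n: "t + real n * T > 0" using ex_positive_shift[OF T] by blast
  then have "periodic_extension T f (t + T) = f (t + T + real n * T)"
    using T by (intro periodic_extension_eq f) auto
  also have "\<dots> = f (t + real n * T)" using f[of "t + real n * T"] n by (simp add: algebra_simps)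
  finally show ?thesis using periodic_extension_eq[of f T t n] f T n by simp
qed

text \<open>Near any time the extension is a shift by one fixed number of periods to a positive
  time. Hence two-sided differentiability at positive times suffices, and the endpoint 0 causes no
  kink.\<close>

lemma periodic_extension_has_derivative:
  assumes f: "\<And>t. t \<ge> 0 \<Longrightarrow> f (t + T) = f t" and f': "\<And>t. t \<ge> 0 \<Longrightarrow> f' (t + T) = f' t" and T: "T > 0"
    and d: "\<And>t. t > 0 \<Longrightarrow> (f has_real_derivative f' t) (at t)"
  shows "(periodic_extension T f has_real_derivative periodic_extension T f' t) (at t)"
proof -
  obtain n where n: "t + real n * T > 0" using ex_positive_shift[OF T] by blast
  have "((\<lambda>t. f (t + real n * T)) has_real_derivative f' (t + real n * T)) (at t)"
    using d[OF n] DERIV_shift[of f] by blast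
  moreover have "\<forall>\<^sub>F s in nhds t. f (s + real n * T) = periodic_extension T f s"
  proof -
    have "\<forall>\<^sub>F s in nhds t. s \<in> {- real n * T<..}"
      using n by (intro eventually_nhds_in_open) auto
    then show ?thesis
    proof eventually_elim
      case (elim s)
      then have "s + real n * T \<ge> 0" by simp
      then show ?case using periodic_extension_eq[of f T s n] f T by simp
    qed
  qed
  ultimately have "(periodic_extension T f has_real_derivative f' (t + real n * T)) (at t)"
    by (rule DERIV_cong_ev[OF refl _ refl, THEN iffD1, rotated])
  then show ?thesis using periodic_extension_eq[of f' T t n] f' T n by simp
qed

text \<open>The open half planes t > -n T cover the plane, and on each of them one fixed shift
  represents the extension.\<close>

lemma periodic_extension_continuous:
  fixes g :: "real \<times> real \<Rightarrow> real"
  assumes g: "continuous_on ({0..} \<times> UNIV) g" and p: "\<And>t x. t \<ge> 0 \<Longrightarrow> g (t + T, x) = g (t, x)" and T: "T > 0"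
  shows "continuous_on UNIV (\<lambda>(t, x). periodic_extension T (\<lambda>s. g (s, x)) t)"
proof -
  define S where "S n = {- real n * T<..} \<times> (UNIV :: real set)" for n
  have "continuous_on (\<Union>n. S n) (\<lambda>(t, x). periodic_extension T (\<lambda>s. g (s, x)) t)"
  proof (rule continuous_on_open_UN)
    show "open (S n)" for n by (auto simp: S_def open_Times)
    have "continuous_on (S n) (\<lambda>z. g (fst z + real n * T, snd z))" for n
      by (rule continuous_on_compose2[OF g]) (auto simp: S_def intro!: continuous_intros)
    moreover have "g (fst z + real n * T, snd z) = (\<lambda>(t, x). periodic_extension T (\<lambda>s. g (s, x)) t) z" if "z \<in> S n" for n z
      using periodic_extension_eq[of "\<lambda>s. g (s, snd z)" T "fst z" n] p T that by (cases z) (simp add: S_def)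
    ultimately show "continuous_on (S n) (\<lambda>(t, x). periodic_extension T (\<lambda>s. g (s, x)) t)" for n
      by (rule continuous_on_eq)
  qed
  moreover have "(\<Union>n. S n) = UNIV"
  proof -
    have "\<exists>n. - real n * T < t" for t
      using ex_positive_shift[OF T, of t] by (smt (verit) mult_minus_left)
    then show ?thesis by (auto simp: S_def)
  qed
  ultimately show ?thesis by simp
qed

section \<open>Sup norms and one-sided derivatives on the half strip\<close>

lemma sup_norm_le_iff:
  fixes f :: "'a \<Rightarrow> 'b::euclidean_space"
  shows "sup_norm S f \<le> ereal e \<longleftrightarrow> (\<forall>b\<in>Basis. \<forall>p\<in>S. \<bar>f p \<bullet> b\<bar> \<le> e)"
  unfolding sup_norm_def by (subst Max_le_iff) (auto simp: SUP_le_iff)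

lemma sup_norm_real_le_iff:
  fixes f :: "'a \<Rightarrow> real"
  shows "sup_norm S f \<le> ereal e \<longleftrightarrow> (\<forall>p\<in>S. \<bar>f p\<bar> \<le> e)"
  by (simp add: sup_norm_le_iff)

lemma sup_norm_vec2_le:
  fixes f :: "'a \<Rightarrow> real^2"
  assumes "\<And>p. p \<in> S \<Longrightarrow> \<bar>f p $ 1\<bar> \<le> e \<and> \<bar>f p $ 2\<bar> \<le> e"
  shows "sup_norm S f \<le> ereal e"
  unfolding sup_norm_le_iff
proof (intro ballI)
  fix b :: "real^2" and p assume b: "b \<in> Basis" and p: "p \<in> S"
  then obtain i where "b = axis i 1" by (auto simp: Basis_vec_def)
  then show "\<bar>f p \<bullet> b\<bar> \<le> e" using assms[OF p] exhaust_2[of i] by (auto simp: inner_axis)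
qed

lemma vec2_eq_axis: "vector [a, b] = a *\<^sub>R axis 1 1 + b *\<^sub>R (axis 2 1 :: real^2)" for a b :: real
  by (simp add: vec_eq_iff forall_2 axis_def)

lemma has_vector_derivative_vec2:
  fixes f g :: "real \<Rightarrow> real"
  assumes "(f has_real_derivative f') (at x within S)" "(g has_real_derivative g') (at x within S)"
  shows "((\<lambda>s. vector [f s, g s] :: real^2) has_vector_derivative vector [f', g']) (at x within S)"
  unfolding vec2_eq_axis using assms
  by (auto intro!: derivative_eq_intros simp: has_real_derivative_iff_has_vector_derivative)

lemma continuous_on_vec2:
  fixes f g :: "'a::topological_space \<Rightarrow> real"
  assumes "continuous_on S f" "continuous_on S g"
  shows "continuous_on S (\<lambda>s. vector [f s, g s] :: real^2)"
  unfolding vec2_eq_axis by (intro continuous_intros assms)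

lemma half_line_not_singleton: "{0..} \<noteq> {t :: real}"
  by (metis atLeast_iff order_refl singletonD zero_le_one zero_neq_one)

lemma Icc_not_singleton: "L > 0 \<Longrightarrow> {0..L} \<noteq> {t :: real}"
  by (metis atLeastAtMost_iff less_eq_real_def less_irrefl order_refl singletonD)

lemma vector_derivative_at_convex:
  fixes f :: "real \<Rightarrow> 'b::real_normed_vector"
  assumes "(f has_vector_derivative f') (at x within S)" "connected S" "x \<in> S" "\<And>y. S \<noteq> {y}"
  shows "vector_derivative f (at x within S) = f'"
proof (rule vector_derivative_within[OF _ assms(1)])
  show "at x within S \<noteq> bot"
    using connected_imp_perfect[OF assms(2,3,4)] by (simp add: trivial_limit_within)
qed

lemma dom_D_sections:
  shows "0 \<le> x \<Longrightarrow> x \<le> L \<Longrightarrow> {s. (s, x) \<in> dom_D L} = {0..}"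
    and "0 \<le> t \<Longrightarrow> {y. (t, y) \<in> dom_D L} = {0..L}"
  by (auto simp: dom_D_def)

lemma C1_on2_dom_DI:
  fixes f ft fx :: "real \<times> real \<Rightarrow> 'b::euclidean_space"
  assumes L: "L > 0"
    and t: "\<And>t x. 0 \<le> t \<Longrightarrow> 0 \<le> x \<Longrightarrow> x \<le> L \<Longrightarrow> ((\<lambda>s. f (s, x)) has_vector_derivative ft (t, x)) (at t within {0..})"
    and x: "\<And>t x. 0 \<le> t \<Longrightarrow> 0 \<le> x \<Longrightarrow> x \<le> L \<Longrightarrow> ((\<lambda>y. f (t, y)) has_vector_derivative fx (t, x)) (at x within {0..L})"
    and c: "continuous_on (dom_D L) f" "continuous_on (dom_D L) ft" "continuous_on (dom_D L) fx"
  shows "C1_on2 (dom_D L) f" "\<And>p. p \<in> dom_D L \<Longrightarrow> partial_t (dom_D L) f p = ft p"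
    "\<And>p. p \<in> dom_D L \<Longrightarrow> partial_x (dom_D L) f p = fx p"
proof -
  show pt: "partial_t (dom_D L) f p = ft p" if "p \<in> dom_D L" for p
  proof -
    obtain t' x' where p: "p = (t', x')" "0 \<le> t'" "0 \<le> x'" "x' \<le> L" using \<open>p \<in> dom_D L\<close> by (auto simp: dom_D_def)
    show ?thesis unfolding partial_t_def p(1) prod.case dom_D_sections(1)[OF p(3,4)]
      by (rule vector_derivative_at_convex[OF t[OF p(2-4)]]) (use p half_line_not_singleton in auto)
  qed
  show px: "partial_x (dom_D L) f p = fx p" if "p \<in> dom_D L" for p
  proof -
    obtain t' x' where p: "p = (t', x')" "0 \<le> t'" "0 \<le> x'" "x' \<le> L" using \<open>p \<in> dom_D L\<close> by (auto simp: dom_D_def)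
    show ?thesis unfolding partial_x_def p(1) prod.case dom_D_sections(2)[OF p(2)]
      by (rule vector_derivative_at_convex[OF x[OF p(2-4)]]) (use p Icc_not_singleton[OF L] in auto)
  qed
  have "continuous_on (dom_D L) (partial_t (dom_D L) f)" "continuous_on (dom_D L) (partial_x (dom_D L) f)"
    using c pt px by (auto intro: continuous_on_eq)
  then show "C1_on2 (dom_D L) f"
    unfolding C1_on2_def
  proof (intro conjI c(1) ballI, clarify)
    fix t' x' assume "(t', x') \<in> dom_D L"
    then have p: "0 \<le> t'" "0 \<le> x'" "x' \<le> L" by (auto simp: dom_D_def)
    show "(\<lambda>s. f (s, x')) differentiable at t' within {s. (s, x') \<in> dom_D L} \<and>
        (\<lambda>y. f (t', y)) differentiable at x' within {y. (t', y) \<in> dom_D L}"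
      unfolding dom_D_sections(1)[OF p(2,3)] dom_D_sections(2)[OF p(1)]
      using differentiableI_vector[OF t[OF p]] differentiableI_vector[OF x[OF p]] by blast
  qed
qed

lemma C1_on2_dom_D_derivatives:
  fixes f :: "real \<times> real \<Rightarrow> real"
  assumes f: "C1_on2 (dom_D L) f" and tx: "0 \<le> t" "0 \<le> x" "x \<le> L"
  shows "((\<lambda>s. f (s, x)) has_real_derivative partial_t (dom_D L) f (t, x)) (at t within {0..})"
    "((\<lambda>y. f (t, y)) has_real_derivative partial_x (dom_D L) f (t, x)) (at x within {0..L})"
proof -
  have "(t, x) \<in> dom_D L" using tx by (simp add: dom_D_def)
  then have "(\<lambda>s. f (s, x)) differentiable at t within {s. (s, x) \<in> dom_D L}"
      "(\<lambda>y. f (t, y)) differentiable at x within {y. (t, y) \<in> dom_D L}"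
    using f unfolding C1_on2_def by blast+
  then show "((\<lambda>s. f (s, x)) has_real_derivative partial_t (dom_D L) f (t, x)) (at t within {0..})"
    "((\<lambda>y. f (t, y)) has_real_derivative partial_x (dom_D L) f (t, x)) (at x within {0..L})"
    unfolding partial_t_def partial_x_def prod.case dom_D_sections(1)[OF tx(2,3)] dom_D_sections(2)[OF tx(1)]
      has_real_derivative_iff_has_vector_derivative
    using vector_derivative_works by blast+
qed

lemma half_line_derivative:
  assumes "(f has_real_derivative d) (at t within {0..})" "t > 0"
  shows "(f has_real_derivative d) (at t)"
  using assms at_within_interior[of t "{0..}"] by simp

text \<open>At t = 0 the derivative is one-sided while at T it is two-sided; restricting the latter
  to the half line makes both derivatives of the same function within the same set, where they are
  unique.\<close>

lemma derivative_periodic: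
  assumes f: "\<And>t. t \<ge> 0 \<Longrightarrow> f (t + T) = f t" and T: "T > 0"
    and d: "\<And>t. t \<ge> 0 \<Longrightarrow> (f has_real_derivative f' t) (at t within {0..})" and t: "t \<ge> 0"
  shows "f' (t + T) = f' t"
proof -
  have "(f has_real_derivative f' (t + T)) (at (t + T))"
    using d[of "t + T"] t T by (intro half_line_derivative) auto
  then have "((\<lambda>s. f (s + T)) has_real_derivative f' (t + T)) (at t)" by (simp add: DERIV_shift)
  then have "((\<lambda>s. f (s + T)) has_real_derivative f' (t + T)) (at t within {0..})"
    by (rule DERIV_subset) simp
  then have "(f has_real_derivative f' (t + T)) (at t within {0..})"
    by (rule has_field_derivative_transform_within[OF _ zero_less_one]) (use t f in auto)
  moreover have "at t within {0..} \<noteq> bot"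
    using t half_line_not_singleton connected_imp_perfect[of "{0..}" t] by (simp add: trivial_limit_within)
  ultimately show ?thesis
    using d[OF t] vector_derivative_within has_real_derivative_iff_has_vector_derivative by metis
qed

section \<open>Small data\<close>

text \<open>The contraction factor is the midpoint of \<theta>0 and 1, hence at least 1/2. With m =
  2 L l \<le> 1/2 one has L l (1 + m) \<le> m and l M \<le> 2 N for M = 8 L N, so the flow part is
  at most 4 L N = M/2. Using kmax instead of k makes the requirements independent of the particular
  friction.\<close>

lemma (in reflected_system) reflected_solution:
  fixes kmax \<theta>0 l m M c0 :: real
  assumes L: "L > 0" and T: "T > 0" and \<kappa>1: "\<kappa> < 1" and kmax: "k \<le> kmax"
    and \<theta>0: "1 - exp (- kmax * L) * (1 - \<kappa>) \<le> \<theta>0" "0 \<le> \<theta>0" "\<theta>0 < 1"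
    and pq: "\<bar>p\<bar> + \<bar>q\<bar> > 0"
    and c0: "c1 \<le> c0" "\<epsilon> \<le> c0" "0 \<le> c0"
    and l: "(kmax + 1 + N) * R + c0 \<le> l" and m: "m = 2 * L * l" "m \<le> 1 / 2" and M: "M = 8 * L * N"
    and N1: "(1 + L) * ((2 * \<nu>0 + N * b * R + kmax + 1) * m + (2 * \<nu>0 + N * b * R) + l * M) \<le> (1 - \<theta>0) / 2"
    and N3: "(1 + L) * (c0 * (1 + m) + (kmax + 1) * m * R) \<le> (1 - \<theta>0) * R"
  obtains u w ux :: profile where "bddp u" "bddp w" "t_derivative u w"
    "\<And>i t. u i (t, 0) = \<phi>b i t + \<kappa>b i * u (\<not> i) (t, L)"
    "\<And>i t x. 0 \<le> x \<Longrightarrow> x \<le> L \<Longrightarrow> ((\<lambda>x. u i (t, x)) has_real_derivative ux i (t, x)) (at x within {0..L})"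
    "\<And>i. continuous_on UNIV (ux i)" "\<And>i z. \<bar>ux i z\<bar> \<le> 2 * kmax * R + c0 + 2 / \<mu> * R"
    "\<And>i z. w i z + (\<mu> + sgn_of i * (p * u i z + q * partner L u i z)) * ux i z
       = \<beta> i z / 2 * (u i z + partner L u i z)"
proof -
  have N: "N > 0" using pq \<mu> by (simp add: N_def)
  have kR: "k * R \<le> kmax * R" using kmax R by (intro mult_right_mono)
  have \<kappa>R: "\<kappa> * R \<le> 1 * R" using \<kappa>1 R by (intro mult_right_mono) auto
  have kmax0: "kmax \<ge> 0" using k kmax by simp
  have NR: "0 \<le> N * R" using N R by simp
  have split_l: "kmax * R + R + N * R + c0 \<le> l" using l by (simp add: algebra_simps)
  have kR0: "0 \<le> kmax * R" using kmax0 R by simp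
  have l0: "l \<ge> 0" using split_l kR0 R NR c0 by linarith
  have m0: "m \<ge> 0" using m l0 L by simp
  define C2 where "C2 = max 0 (max ((\<bar>p\<bar> + \<bar>q\<bar>) * R * (4 / \<mu> * N)) C2src)"
  have \<nu>: "0 \<le> 2 * \<nu>0 + N * b * R" using \<nu>0_nonneg NR N b R by simp
  have Ll: "L * l \<le> 1 / 4" using m by simp
  interpret cm: char_map L T R k \<kappa> \<theta>0 "(1 + \<theta>0) / 2" l m M N C2 "2 * \<nu>0 + N * b * R" c0 "2 / \<mu>" slow src bdry slow' src' bdry'
  proof
    have "exp (- kmax * L) * (1 - \<kappa>) \<le> exp (- k * L) * (1 - \<kappa>)"
      using kmax L \<kappa>1 by (intro mult_right_mono) auto
    then show "1 - exp (- k * L) * (1 - \<kappa>) \<le> \<theta>0" using \<theta>0 by linarith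
    show "admissible T R N (2 / \<mu>) l l C2 slow slow'"
      by (rule admissible_mono[OF admissible_slow]) (use split_l kR0 R NR c0 in \<open>auto simp: C2_def\<close>)
    show "admissible T R (k + (2 * \<nu>0 + N * b * R)) (k * R + c0) (k * R + c0) l C2 src src'"
      by (rule admissible_mono[OF admissible_src]) (use split_l kR R NR c0 in \<open>auto simp: C2_def\<close>)
    show "admissible T R \<kappa> (\<kappa> * R + c0) (\<kappa> * R + c0) l C2 bdry bdry'"
      by (rule admissible_mono[OF admissible_bdry]) (use split_l kR0 \<kappa>R NR c0 in \<open>auto simp: C2_def\<close>)
    show "k * R + c0 \<le> l" "\<kappa> * R + c0 \<le> l" using split_l kR kR0 \<kappa>R R NR by linarith+
    have "(1 + L) * ((2 * \<nu>0 + N * b * R + k + 1) * m + (2 * \<nu>0 + N * b * R) + l * M)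
       \<le> (1 + L) * ((2 * \<nu>0 + N * b * R + kmax + 1) * m + (2 * \<nu>0 + N * b * R) + l * M)"
      using kmax m0 L by (intro mult_left_mono add_right_mono mult_right_mono) auto
    then show "\<theta>0 + (1 + L) * ((2 * \<nu>0 + N * b * R + k + 1) * m + (2 * \<nu>0 + N * b * R) + l * M) \<le> (1 + \<theta>0) / 2"
      using N1 by argo
    have "L * l * (1 + m) \<le> L * l * 2" using L l0 m by (intro mult_left_mono) auto
    then show "L * l * (1 + m) \<le> m" using m by simp
    have "N * (1 + m) + l * M \<le> N * 2 + N * 2"
    proof (rule add_mono)
      show "N * (1 + m) \<le> N * 2" using N m by simp
      have "l * M = 8 * N * (L * l)" by (simp add: M)
      also have "\<dots> \<le> 8 * N * (1 / 4)" using Ll N by (intro mult_left_mono) auto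
      finally show "l * M \<le> N * 2" by simp
    qed
    then have "L * (N * (1 + m) + l * M) \<le> L * (4 * N)" using L by (intro mult_left_mono) auto
    also have "\<dots> \<le> M * ((1 + \<theta>0) / 2)" using L N \<theta>0 by (simp add: M algebra_simps)
    finally show "L * (N * (1 + m) + l * M) \<le> M * ((1 + \<theta>0) / 2)" .
    have "(1 + L) * (c0 * (1 + m) + (k + 1) * m * R) \<le> (1 + L) * (c0 * (1 + m) + (kmax + 1) * m * R)"
      using kmax m0 L R by (intro mult_left_mono[of "_ + _"] add_left_mono mult_right_mono) auto
    then show "\<theta>0 * R + (1 + L) * (c0 * (1 + m) + (k + 1) * m * R) \<le> R"
      using N3 by (simp add: algebra_simps)
  qed (use L T R k \<kappa> \<kappa>1 \<theta>0 l0 m0 m M N \<nu> c0 \<mu> in \<open>auto simp: C2_def\<close>)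
  obtain u w where u: "lipp u" and w: "bddp w" and uw: "t_derivative u w" and b0: "\<And>i t. u i (t, 0) = bdry u i (t, 0)"
    and ux: "\<And>i t x. 0 \<le> x \<Longrightarrow> x \<le> L \<Longrightarrow> ((\<lambda>x. u i (t, x)) has_real_derivative
       - k * u i (t, x) + src u i (t, x) - w i (t, x) * slow u i (t, x)) (at x within {0..L})"
    using cm.transport_solution by blast
  note bu = lippD[OF u]
  show ?thesis
  proof (rule that[OF bu w uw, of "\<lambda>i z. - k * u i z + src u i z - w i z * slow u i z"])
    show "u i (t, 0) = \<phi>b i t + \<kappa>b i * u (\<not> i) (t, L)" for i t
      using b0 by (simp add: bdry_def)
    show "continuous_on UNIV (\<lambda>z. - k * u i z + src u i z - w i z * slow u i z)" for i
      by (intro continuous_intros continuous_both[OF bu] continuous_both[OF w] slow_continuous[OF bu]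
        admissible_continuous[OF admissible_src u])
    show "\<bar>- k * u i z + src u i z - w i z * slow u i z\<bar> \<le> 2 * kmax * R + c0 + 2 / \<mu> * R" for i z
    proof -
      have "\<bar>- k * u i z\<bar> \<le> k * R" by (intro damping_bound bddD bu)
      moreover have "\<bar>src u i z\<bar> \<le> k * R + c1" 
        using bddD(1)[OF admissible_bounded[OF admissible_src u]] .
      moreover have "\<bar>w i z * slow u i z\<bar> \<le> R * (2 / \<mu>)"
        by (intro abs_mult_le bddD w slow_bounds bu)
      ultimately show ?thesis using kR c0 by (simp add: mult.commute[of R])
    qed
    show "w i z + (\<mu> + sgn_of i * (p * u i z + q * partner L u i z)) * (- k * u i z + src u i z - w i z * slow u i z)
       = \<beta> i z / 2 * (u i z + partner L u i z)" for i z
    proof -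
      define s where "s = \<mu> + sgn_of i * (p * u i z + q * partner L u i z)"
      have s: "slow u i z * s = 1" using slow_bounds(1)[OF bu, of i z] by (auto simp: slow_def s_def)
      \<comment> \<open>The two artificial terms with k cancel here, which leaves the original
        equation divided by the speed.\<close>
      have "- k * u i z + src u i z - w i z * slow u i z
         = slow u i z * (\<beta> i z / 2 * (u i z + partner L u i z) - w i z)"
        by (simp add: src_def algebra_simps)
      then have "w i z + s * (- k * u i z + src u i z - w i z * slow u i z)
        = w i z + (slow u i z * s) * (\<beta> i z / 2 * (u i z + partner L u i z) - w i z)" by simp
      then show ?thesis unfolding s by (simp add: s_def)
    qed
  qed (rule ux)
qed

lemma eventually_linear_le:
  fixes Q r :: real
  assumes "r > 0"
  shows "\<forall>\<^sub>F \<epsilon> in at_right 0. Q * \<epsilon> \<le> r"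
proof -
  have "((\<lambda>\<epsilon>. Q * \<epsilon>) \<longlongrightarrow> 0) (at_right 0)"
    by (auto intro!: tendsto_eq_intros)
  then have "\<forall>\<^sub>F \<epsilon> in at_right 0. Q * \<epsilon> < r" using assms by (rule order_tendstoD)
  then show ?thesis by eventually_elim simp
qed

text \<open>With radius R = \<open>R0 * \<epsilon>\<close> every requirement becomes a bound on a
  fixed constant times \<epsilon>, and finitely many such bounds hold for all small \<epsilon>. The
  constants depend only on the listed parameters, so the threshold is fixed before the friction and
  the boundary data are given.\<close>

lemma reflected_solution_small:
  fixes L T \<mu> p q kmax b E \<kappa> :: real
  assumes L: "L > 0" and T: "T > 0" and \<mu>: "\<mu> > 0" and pq: "\<bar>p\<bar> + \<bar>q\<bar> > 0" and kmax: "kmax \<ge> 0"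
    and b: "b \<ge> 0" and E: "E \<ge> 0" and \<kappa>01: "0 \<le> \<kappa>" "\<kappa> < 1"
  obtains \<epsilon>1 K R0 where "\<epsilon>1 > 0" "K > 0" "R0 > 0" "\<And>\<epsilon>. 0 < \<epsilon> \<Longrightarrow> \<epsilon> < \<epsilon>1 \<Longrightarrow> (\<bar>p\<bar> + \<bar>q\<bar>) * (R0 * \<epsilon>) \<le> \<mu> / 2"
    "\<And>\<epsilon> k \<beta> \<beta>' \<phi>b \<phi>b' \<kappa>b. 0 < \<epsilon> \<Longrightarrow> \<epsilon> < \<epsilon>1 \<Longrightarrow> k \<le> kmax \<Longrightarrow>
      reflected_system T (R0 * \<epsilon>) \<mu> p q k b \<epsilon> (E * \<epsilon>) \<kappa> \<beta> \<beta>' \<phi>b \<phi>b' \<kappa>b \<Longrightarrow>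
      \<exists>u w ux :: profile. bounded_profile T (K * \<epsilon>) u \<and> bounded_profile T (K * \<epsilon>) w \<and> t_derivative u w \<and>
        (\<forall>i t. u i (t, 0) = \<phi>b i t + \<kappa>b i * u (\<not> i) (t, L)) \<and>
        (\<forall>i t x. 0 \<le> x \<longrightarrow> x \<le> L \<longrightarrow> ((\<lambda>x. u i (t, x)) has_real_derivative ux i (t, x)) (at x within {0..L})) \<and>
        (\<forall>i. continuous_on UNIV (ux i)) \<and> (\<forall>i z. \<bar>ux i z\<bar> \<le> K * \<epsilon>) \<and>
        (\<forall>i z. w i z + (\<mu> + sgn_of i * (p * u i z + q * partner L u i z)) * ux i z
          = \<beta> i z / 2 * (u i z + partner L u i z))"
proof -
  define \<theta>0 where "\<theta>0 = 1 - exp (- kmax * L) * (1 - \<kappa>)"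
  have "exp (- kmax * L) * (1 - \<kappa>) \<le> 1 * 1" using kmax L \<kappa>01 by (intro mult_mono) auto
  then have \<theta>0: "0 \<le> \<theta>0" "\<theta>0 < 1" using \<kappa>01 by (auto simp: \<theta>0_def)
  define Nc where "Nc = 4 * (\<bar>p\<bar> + \<bar>q\<bar>) / \<mu>\<^sup>2"
  have Nc: "Nc > 0" using pq \<mu> by (simp add: Nc_def)
  \<comment> \<open>The requirement on R asks that (1 + L) times the remainder not exceed (1 -
    \<theta>0) R. The remainder will be at most 8\<epsilon>, with 4\<epsilon> from the data and
    4\<epsilon> from the Jacobian correction.\<close>
  define R0 where "R0 = 8 * (1 + L) / (1 - \<theta>0)"
  have R0: "R0 > 0" using L \<theta>0 by (simp add: R0_def)
  \<comment> \<open>These are the coefficients of \<epsilon>: \<open>\<nu>0\<close> is V \<epsilon>,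
    the excess Lipschitz constant of the source is D \<epsilon>, and the time Lipschitz constant of
    the fields is l1 \<epsilon>.\<close>
  define V where "V = Nc * R0 * b / 2 + E"
  define D where "D = 2 * V + Nc * b * R0"
  define l1 where "l1 = (kmax + 1 + Nc) * R0 + 2"
  \<comment> \<open>R itself plus the bound on the derivative in x, which consists of 2 kmax R, the
    constant 2\<epsilon> and 2 R/\<mu>.\<close>
  define K where "K = (1 + 2 * kmax + 2 / \<mu>) * R0 + 2"
  have K: "K > 0" using kmax \<mu> R0 by (simp add: K_def add_pos_pos add_pos_nonneg)
  have VD: "V \<ge> 0" "D \<ge> 0" using Nc R0 b E by (auto simp: V_def D_def)
  have l1: "l1 > 0" using kmax Nc R0 by (simp add: l1_def add_nonneg_pos)
  have "\<forall>\<^sub>F \<epsilon> in at_right 0. 1 * \<epsilon> \<le> 1 \<and> (\<bar>p\<bar> + \<bar>q\<bar>) * R0 * \<epsilon> \<le> \<mu> / 2 \<and> 2 * L * l1 * \<epsilon> \<le> 1 / 2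
     \<and> (kmax + 1) * (2 * L * l1) * R0 * \<epsilon> \<le> 4 \<and> (2 * V + Nc * R0 * b + 2 / \<mu>) * R0 * \<epsilon> \<le> 1
     \<and> (1 + L) * ((D + kmax + 1) * (2 * L * l1) + D + l1 * (8 * L * Nc)) * \<epsilon> \<le> (1 - \<theta>0) / 2"
    by (intro eventually_conj eventually_linear_le) (use \<mu> \<theta>0 in auto)
  then obtain \<epsilon>1 where \<epsilon>1: "\<epsilon>1 > 0" "\<And>\<epsilon>. 0 < \<epsilon> \<Longrightarrow> \<epsilon> < \<epsilon>1 \<Longrightarrow> 1 * \<epsilon> \<le> 1 \<and> (\<bar>p\<bar> + \<bar>q\<bar>) * R0 * \<epsilon> \<le> \<mu> / 2 \<and> 2 * L * l1 * \<epsilon> \<le> 1 / 2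
     \<and> (kmax + 1) * (2 * L * l1) * R0 * \<epsilon> \<le> 4 \<and> (2 * V + Nc * R0 * b + 2 / \<mu>) * R0 * \<epsilon> \<le> 1
     \<and> (1 + L) * ((D + kmax + 1) * (2 * L * l1) + D + l1 * (8 * L * Nc)) * \<epsilon> \<le> (1 - \<theta>0) / 2"
    unfolding eventually_at_right_field by blast
  show ?thesis
  proof (rule that[OF \<epsilon>1(1) K R0])
    show "(\<bar>p\<bar> + \<bar>q\<bar>) * (R0 * \<epsilon>) \<le> \<mu> / 2" if "0 < \<epsilon>" "\<epsilon> < \<epsilon>1" for \<epsilon>
      using \<epsilon>1(2)[OF that] by (simp add: mult.assoc)
    fix \<epsilon> k \<beta> \<beta>' \<phi>b \<phi>b' \<kappa>b
    assume \<epsilon>: "0 < \<epsilon>" "\<epsilon> < \<epsilon>1" and k_le: "k \<le> kmax"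
      and sys: "reflected_system T (R0 * \<epsilon>) \<mu> p q k b \<epsilon> (E * \<epsilon>) \<kappa> \<beta> \<beta>' \<phi>b \<phi>b' \<kappa>b"
    note small = \<epsilon>1(2)[OF \<epsilon>]
    interpret reflected_system L T "R0 * \<epsilon>" \<mu> p q k b \<epsilon> "E * \<epsilon>" \<kappa> \<beta> \<beta>' \<phi>b \<phi>b' \<kappa>b
      by (rule sys)
    have NN: "N = Nc" by (simp add: N_def Nc_def)
    have \<nu>V: "\<nu>0 = V * \<epsilon>" by (simp add: \<nu>0_def NN V_def algebra_simps)
    have D\<epsilon>: "2 * \<nu>0 + Nc * b * (R0 * \<epsilon>) = D * \<epsilon>" by (simp add: \<nu>V NN D_def algebra_simps)
    define m where "m = 2 * L * (l1 * \<epsilon>)"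
    have m: "m \<le> 1 / 2" "m \<ge> 0" using small L l1 \<epsilon> by (auto simp: m_def mult.assoc)
    have Rb: "R0 * \<epsilon> \<le> K * \<epsilon>" 
      using \<epsilon> R0 kmax \<mu> by (intro mult_right_mono) (auto simp: K_def algebra_simps intro!: add_nonneg_nonneg)
    obtain u w ux :: profile where s: "bddp u" "bddp w" "t_derivative u w"
      "\<And>i t. u i (t, 0) = \<phi>b i t + \<kappa>b i * u (\<not> i) (t, L)"
      "\<And>i t x. 0 \<le> x \<Longrightarrow> x \<le> L \<Longrightarrow> ((\<lambda>x. u i (t, x)) has_real_derivative ux i (t, x)) (at x within {0..L})"
      "\<And>i. continuous_on UNIV (ux i)" "\<And>i z. \<bar>ux i z\<bar> \<le> 2 * kmax * (R0 * \<epsilon>) + 2 * \<epsilon> + 2 / \<mu> * (R0 * \<epsilon>)"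
      "\<And>i z. w i z + (\<mu> + sgn_of i * (p * u i z + q * partner L u i z)) * ux i z
         = \<beta> i z / 2 * (u i z + partner L u i z)"
    \<comment> \<open>The value 2\<epsilon> for c0 dominates both the boundary data, of size
      \<epsilon>, and the quadratic \<open>c1\<close>.\<close>
    proof (rule reflected_solution[OF L T \<kappa>01(2) k_le _ \<theta>0 pq, of "2 * \<epsilon>" "l1 * \<epsilon>" m "8 * L * N"])
      show "1 - exp (- kmax * L) * (1 - \<kappa>) \<le> \<theta>0" by (simp add: \<theta>0_def)
      have "c1 = ((2 * V + Nc * R0 * b + 2 / \<mu>) * R0 * \<epsilon>) * \<epsilon>" by (simp add: c1_def \<nu>V NN algebra_simps)
      also have "\<dots> \<le> 1 * \<epsilon>" using small \<epsilon> by (intro mult_right_mono) auto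
      finally show "c1 \<le> 2 * \<epsilon>" using \<epsilon> by simp
      show "(kmax + 1 + N) * (R0 * \<epsilon>) + 2 * \<epsilon> \<le> l1 * \<epsilon>" by (simp add: NN l1_def algebra_simps)
      show "(1 + L) * ((2 * \<nu>0 + N * b * (R0 * \<epsilon>) + kmax + 1) * m + (2 * \<nu>0 + N * b * (R0 * \<epsilon>))
          + l1 * \<epsilon> * (8 * L * N)) \<le> (1 - \<theta>0) / 2"
      proof -
        have "D * \<epsilon> \<le> D * 1" using small VD by (intro mult_left_mono) auto
        then have "(1 + L) * ((D * \<epsilon> + kmax + 1) * m + D * \<epsilon> + l1 * \<epsilon> * (8 * L * Nc))
          \<le> (1 + L) * ((D + kmax + 1) * m + D * \<epsilon> + l1 * \<epsilon> * (8 * L * Nc))"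
          using L m by (intro mult_left_mono add_right_mono mult_right_mono) auto
        also have "\<dots> = (1 + L) * ((D + kmax + 1) * (2 * L * l1) + D + l1 * (8 * L * Nc)) * \<epsilon>"
          by (simp add: m_def algebra_simps)
        finally show ?thesis unfolding NN D\<epsilon> using small by linarith
      qed
      show "(1 + L) * (2 * \<epsilon> * (1 + m) + (kmax + 1) * m * (R0 * \<epsilon>)) \<le> (1 - \<theta>0) * (R0 * \<epsilon>)"
      proof -
        have "2 * \<epsilon> * (1 + m) \<le> 2 * \<epsilon> * 2" using \<epsilon> m by (intro mult_left_mono) auto
        moreover have "(kmax + 1) * m * (R0 * \<epsilon>) \<le> 4 * \<epsilon>"
        proof -
          have "(kmax + 1) * m * (R0 * \<epsilon>) = ((kmax + 1) * (2 * L * l1) * R0 * \<epsilon>) * \<epsilon>" by (simp add: m_def algebra_simps)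
          also have "\<dots> \<le> 4 * \<epsilon>" using small \<epsilon> by (intro mult_right_mono) auto
          finally show ?thesis .
        qed
        ultimately have "(1 + L) * (2 * \<epsilon> * (1 + m) + (kmax + 1) * m * (R0 * \<epsilon>)) \<le> (1 + L) * (8 * \<epsilon>)"
          using L by (intro mult_left_mono) auto
        also have "\<dots> = (1 - \<theta>0) * (R0 * \<epsilon>)" using \<theta>0 by (simp add: R0_def)
        finally show ?thesis .
      qed
    qed (use \<epsilon> m in \<open>auto simp: m_def\<close>)
    have "2 * kmax * (R0 * \<epsilon>) + 2 * \<epsilon> + 2 / \<mu> * (R0 * \<epsilon>) \<le> K * \<epsilon>"
      using \<epsilon> R0 by (simp add: K_def algebra_simps)
    then have "\<bar>ux i z\<bar> \<le> K * \<epsilon>" for i z using s(7)[of i z] by linarith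
    then show "\<exists>u w ux :: profile. bounded_profile T (K * \<epsilon>) u \<and> bounded_profile T (K * \<epsilon>) w \<and> t_derivative u w \<and>
        (\<forall>i t. u i (t, 0) = \<phi>b i t + \<kappa>b i * u (\<not> i) (t, L)) \<and>
        (\<forall>i t x. 0 \<le> x \<longrightarrow> x \<le> L \<longrightarrow> ((\<lambda>x. u i (t, x)) has_real_derivative ux i (t, x)) (at x within {0..L})) \<and>
        (\<forall>i. continuous_on UNIV (ux i)) \<and> (\<forall>i z. \<bar>ux i z\<bar> \<le> K * \<epsilon>) \<and>
        (\<forall>i z. w i z + (\<mu> + sgn_of i * (p * u i z + q * partner L u i z)) * ux i z
          = \<beta> i z / 2 * (u i z + partner L u i z))"
      using s bounded_profile_mono[OF s(1) Rb] bounded_profile_mono[OF s(2) Rb]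
      by (intro exI[of _ u] exI[of _ w] exI[of _ ux]) blast
  qed
qed

section \<open>The initial-boundary value problem\<close>

text \<open>Extends the data to the whole time axis, where the fixed point lives. Periodicity is
  given at positive times only; continuity carries it to t = 0 before derivatives are
  compared.\<close>

lemma boundary_data_extension:
  fixes f :: "real \<Rightarrow> real"
  assumes C1: "C1_on {0..} f" and p: "\<And>t. t > 0 \<Longrightarrow> f (t + T) = f t" and bd: "C1_norm {0..} f \<le> ereal \<epsilon>" and T: "T > 0"
  defines "f' \<equiv> \<lambda>t. vector_derivative f (at t within {0..})"
  defines "F \<equiv> periodic_extension T f" and "F' \<equiv> periodic_extension T f'"
  shows "(F has_real_derivative F' t) (at t)" "continuous_on UNIV F'" "F (t + T) = F t" "F' (t + T) = F' t"
    "\<bar>F t\<bar> \<le> \<epsilon>" "\<bar>F' t\<bar> \<le> \<epsilon>" "t \<ge> 0 \<Longrightarrow> F t = f t"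
proof -
  have d: "(f has_real_derivative f' t) (at t within {0..})" if "t \<ge> 0" for t
    using C1 that unfolding C1_on_def f'_def
    by (simp add: vector_derivative_works has_real_derivative_iff_has_vector_derivative)
  have c: "continuous_on {0..} f'" using C1 by (simp add: C1_on_def f'_def)
  have fc: "continuous_on {0..} f" using d by (auto intro: DERIV_continuous_on)
  have fb: "\<bar>f t\<bar> \<le> \<epsilon>" "\<bar>f' t\<bar> \<le> \<epsilon>" if "t \<ge> 0" for t
    using bd that by (auto simp: C1_norm_def sup_norm_real_le_iff f'_def)
  have p0: "f (t + T) = f t" if "t \<ge> 0" for t
  proof (cases "t > 0")
    case False
    then have t: "t = 0" using that by simp
    define a where "a n = inverse (real (Suc n))" for n
    have a: "a \<longlonglongrightarrow> 0" "\<And>n. a n > 0" using LIMSEQ_inverse_real_of_nat by (simp_all add: a_def[abs_def])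
    have "(\<lambda>n. f (a n + T)) \<longlonglongrightarrow> f (0 + T)"
      by (rule continuous_on_tendsto_compose[OF fc]) (use T a tendsto_add[OF a(1) tendsto_const[of T]] in \<open>auto simp: less_imp_le\<close>)
    moreover have "(\<lambda>n. f (a n)) \<longlonglongrightarrow> f 0"
      by (rule continuous_on_tendsto_compose[OF fc]) (use a in \<open>auto simp: less_imp_le\<close>)
    ultimately show ?thesis using p a(2) LIMSEQ_unique by (simp add: t)
  qed (rule p)
  have p1: "f' (t + T) = f' t" if "t \<ge> 0" for t
    by (rule derivative_periodic[of f, OF p0 T d that])
  show "(F has_real_derivative F' t) (at t)"
    unfolding F_def F'_def by (intro periodic_extension_has_derivative p0 p1 T half_line_derivative d) auto
  define g :: "real \<times> real \<Rightarrow> real" where "g = f' \<circ> fst"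
  have "continuous_on ({0..} \<times> UNIV) g"
    unfolding g_def o_def by (rule continuous_on_compose2[OF c]) (auto intro!: continuous_intros)
  then have "continuous_on UNIV (\<lambda>(t, x). periodic_extension T (\<lambda>s. g (s, x)) t)"
    by (rule periodic_extension_continuous) (simp_all add: g_def p1 T)
  then have "continuous_on UNIV (\<lambda>(t, x :: real). F' t)" by (simp add: g_def F'_def)
  from continuous_on_profile_compose[OF this, of UNIV "\<lambda>t. t" "\<lambda>_. 0"]
  show "continuous_on UNIV F'" by simp
  show "F (t + T) = F t" "F' (t + T) = F' t"
    unfolding F_def F'_def by (intro periodic_extension_periodic p0 p1 T; assumption)+
  show "\<bar>F t\<bar> \<le> \<epsilon>" unfolding F_def
    using periodic_extension_obtain[of f T t] p0 T fb by (metis less_imp_le)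
  show "\<bar>F' t\<bar> \<le> \<epsilon>" unfolding F'_def
    using periodic_extension_obtain[of f' T t] p1 T fb by (metis less_imp_le)
  show "F t = f t" if "t \<ge> 0"
    unfolding F_def by (intro periodic_extension_nonneg p0 T that)
qed

lemma partial_t_periodic:
  fixes f :: "real \<times> real \<Rightarrow> real"
  assumes C1: "C1_on2 (dom_D L) f" and p: "\<And>t x. 0 \<le> t \<Longrightarrow> 0 \<le> x \<Longrightarrow> x \<le> L \<Longrightarrow> f (t + T, x) = f (t, x)"
    and T: "T > 0" and tx: "0 \<le> t" "0 \<le> x" "x \<le> L"
  shows "partial_t (dom_D L) f (t + T, x) = partial_t (dom_D L) f (t, x)"
  using derivative_periodic[of "\<lambda>s. f (s, x)" T "\<lambda>s. partial_t (dom_D L) f (s, x)" t]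
    p T tx C1_on2_dom_D_derivatives(1)[OF C1] by blast

text \<open>Periodicity moves any time into one period, so small derivatives control the total
  variation over the unbounded strip by a path of length at most T + L.\<close>

lemma slow_variation:
  fixes f :: "real \<times> real \<Rightarrow> real"
  assumes C1: "C1_on2 (dom_D L) f" and p: "\<And>t x. 0 \<le> t \<Longrightarrow> 0 \<le> x \<Longrightarrow> x \<le> L \<Longrightarrow> f (t + T, x) = f (t, x)"
    and T: "T > 0" and L: "L > 0" and \<epsilon>: "\<epsilon> \<ge> 0"
    and bt: "\<And>z. z \<in> dom_D L \<Longrightarrow> \<bar>partial_t (dom_D L) f z\<bar> \<le> \<epsilon>"
    and bx: "\<And>z. z \<in> dom_D L \<Longrightarrow> \<bar>partial_x (dom_D L) f z\<bar> \<le> \<epsilon>"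
    and tx: "0 \<le> t" "0 \<le> x" "x \<le> L"
  shows "\<bar>f (t, x) - f (0, 0)\<bar> \<le> \<epsilon> * (T + L)"
proof -
  define n where "n = nat \<lfloor>t / T\<rfloor>"
  define s where "s = t - real n * T"
  have n: "real n = of_int \<lfloor>t / T\<rfloor>" using tx T by (simp add: n_def)
  have "of_int \<lfloor>t / T\<rfloor> * T \<le> t" "t < (of_int \<lfloor>t / T\<rfloor> + 1) * T"
    using T by (simp_all add: pos_le_divide_eq[symmetric] pos_divide_less_eq[symmetric])
  then have s: "0 \<le> s" "s \<le> T" by (auto simp: s_def n algebra_simps)
  have "f (t, x) = f (s, x)"
    using periodic_multiple[of "\<lambda>s. f (s, x)" T s n] p tx T s by (simp add: s_def)
  moreover have "norm (f (s, x) - f (s, 0)) \<le> \<epsilon> * norm (x - 0)"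
    by (rule field_differentiable_bound[of "{0..L}" "\<lambda>x. f (s, x)" "\<lambda>x. partial_x (dom_D L) f (s, x)"])
      (use C1_on2_dom_D_derivatives(2)[OF C1] bx s tx in \<open>auto simp: dom_D_def\<close>)
  moreover have "norm (f (s, 0) - f (0, 0)) \<le> \<epsilon> * norm (s - 0)"
    by (rule field_differentiable_bound[of "{0..}" "\<lambda>s. f (s, 0)" "\<lambda>s. partial_t (dom_D L) f (s, 0)"])
      (use C1_on2_dom_D_derivatives(1)[OF C1] bt s L in \<open>auto simp: dom_D_def\<close>)
  moreover have "\<epsilon> * x \<le> \<epsilon> * L" "\<epsilon> * s \<le> \<epsilon> * T" using \<epsilon> tx s by (auto intro: mult_left_mono)
  ultimately show ?thesis using s tx by (simp add: distrib_left)
qed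

text \<open>The map \<open>r\<close> builds in the reflection, clipping continues the function
  constantly in x, and periodicity continues it in time; none of these enlarges the bound.\<close>

lemma periodic_extension_profile:
  fixes f :: "real \<times> real \<Rightarrow> real"
  assumes c: "continuous_on (dom_D L) f" and p: "\<And>t x. 0 \<le> t \<Longrightarrow> 0 \<le> x \<Longrightarrow> x \<le> L \<Longrightarrow> f (t + T, x) = f (t, x)"
    and T: "T > 0" and L: "L > 0" and bd: "\<And>z. z \<in> dom_D L \<Longrightarrow> \<bar>f z\<bar> \<le> B"
    and r: "\<And>i. continuous_on UNIV (r i)"
  shows "bounded_profile T B (\<lambda>i (t, x). periodic_extension T (\<lambda>s. f (s, clip L (r i x))) t)"
  unfolding bounded_profile_def prod.case
proof (intro allI conjI)
  fix i :: bool and t x :: real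
  have cl: "0 \<le> clip L y" "clip L y \<le> L" for y using clip_mem[OF L] by auto
  have "continuous_on ({0..} \<times> UNIV) (\<lambda>z. f (fst z, clip L (r i (snd z))))"
    by (rule continuous_on_compose2[OF c])
      (use cl in \<open>auto simp: dom_D_def intro!: continuous_intros continuous_on_compose2[OF r]\<close>)
  then have "continuous_on UNIV (\<lambda>(t, x). periodic_extension T (\<lambda>s. (\<lambda>z. f (fst z, clip L (r i (snd z)))) (s, x)) t)"
    using p cl by (intro periodic_extension_continuous T) auto
  then show "continuous_on UNIV (\<lambda>(t, x). periodic_extension T (\<lambda>s. f (s, clip L (r i x))) t)" by simp
  have p': "f (t + T, clip L (r i x)) = f (t, clip L (r i x))" if "t \<ge> 0" for t using p cl that by blast
  show "periodic_extension T (\<lambda>s. f (s, clip L (r i x))) (t + T) = periodic_extension T (\<lambda>s. f (s, clip L (r i x))) t"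
    by (rule periodic_extension_periodic[of "\<lambda>s. f (s, clip L (r i x))", OF p' T])
  obtain s where s: "s > 0" "periodic_extension T (\<lambda>s. f (s, clip L (r i x))) t = f (s, clip L (r i x))"
    using periodic_extension_obtain[of "\<lambda>s. f (s, clip L (r i x))" T t] p' T by blast
  show "\<bar>periodic_extension T (\<lambda>s. f (s, clip L (r i x))) t\<bar> \<le> B"
    unfolding s(2) using s(1) cl by (intro bd) (simp add: dom_D_def)
qed

theorem theorem2p1:
  fixes \<gamma> \<rho> L T \<beta>min \<kappa>1 \<kappa>2 :: real
  assumes "\<gamma> > 1" and "\<rho> > 0" and "L > 0" and "T > 0" and "\<beta>min < 0"
    and "\<bar>\<kappa>1\<bar> < 1" and "\<bar>\<kappa>2\<bar> < 1"
  shows "\<exists>\<epsilon>1>0. \<exists>C>0. \<forall>\<epsilon>. 0 < \<epsilon> \<and> \<epsilon> < \<epsilon>1 \<longrightarrow>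
    (\<forall>(\<beta> :: real \<times> real \<Rightarrow> real) (\<phi>1b :: real \<Rightarrow> real) (\<phi>2b :: real \<Rightarrow> real).
       C2_on2 (dom_D L) \<beta> \<and>
       (\<forall>p\<in>dom_D L. \<beta>min \<le> \<beta> p \<and> \<beta> p \<le> 0 \<and>
          \<bar>partial_t (dom_D L) \<beta> p\<bar> \<le> \<epsilon> \<and> \<bar>partial_x (dom_D L) \<beta> p\<bar> \<le> \<epsilon>) \<and>
       (\<forall>(t, x)\<in>dom_D L. \<beta> (t + T, x) = \<beta> (t, x)) \<and>
       C1_on {0..} \<phi>1b \<and> (\<forall>t>0. \<phi>1b (t + T) = \<phi>1b t) \<and> C1_norm {0..} \<phi>1b \<le> ereal \<epsilon> \<and>
       C1_on {0..} \<phi>2b \<and> (\<forall>t>0. \<phi>2b (t + T) = \<phi>2b t) \<and> C1_norm {0..} \<phi>2b \<le> ereal \<epsilon>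
     \<longrightarrow>
       (\<exists>\<phi>0 :: real \<Rightarrow> real^2.
          C1_on {0..L} \<phi>0 \<and> C1_norm {0..L} \<phi>0 \<le> ereal (C * \<epsilon>) \<and>
          (\<exists>\<phi> :: real \<times> real \<Rightarrow> real^2.
             IBVP_solution \<gamma> \<rho> L \<kappa>1 \<kappa>2 \<beta> \<phi>1b \<phi>2b \<phi>0 \<phi> \<and>
             (\<forall>(t, x)\<in>dom_D L. \<phi> (t + T, x) = \<phi> (t, x)) \<and>
             C1_norm2 (dom_D L) \<phi> \<le> ereal (C * \<epsilon>))))"
proof -
  note L = assms(3) and T = assms(4)
  define \<mu> where "\<mu> = sqrt \<gamma> * \<rho> powr ((\<gamma> - 1) / 2)"
  define p q where "p = (\<gamma> + 1) / 2" and "q = (3 - \<gamma>) / 2"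
  define \<kappa> where "\<kappa> = max \<bar>\<kappa>1\<bar> \<bar>\<kappa>2\<bar>"
  define b where "b = - \<beta>min"
  \<comment> \<open>The largest damping rate compatible with the lower bound on the friction; the
    next constant makes E \<epsilon> the variation of \<beta>/(2\<mu>) over the strip.\<close>
  define kmax where "kmax = b / (2 * \<mu>)"
  define E where "E = (T + L) / (2 * \<mu>)"
  have \<mu>: "\<mu> > 0" using assms by (simp add: \<mu>_def)
  have pq: "\<bar>p\<bar> + \<bar>q\<bar> > 0" using assms by (simp add: p_def add_pos_nonneg)
  have pos: "kmax \<ge> 0" "b \<ge> 0" "E \<ge> 0" "0 \<le> \<kappa>" "\<kappa> < 1"
    using assms \<mu> by (auto simp: kmax_def b_def E_def \<kappa>_def divide_nonpos_pos)
  obtain \<epsilon>1 K R0 where \<epsilon>1: "\<epsilon>1 > 0" and K: "K > 0" and R0: "R0 > 0"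
    and RS: "\<And>\<epsilon>. 0 < \<epsilon> \<Longrightarrow> \<epsilon> < \<epsilon>1 \<Longrightarrow> (\<bar>p\<bar> + \<bar>q\<bar>) * (R0 * \<epsilon>) \<le> \<mu> / 2"
    and sol: "\<And>\<epsilon> k \<beta> \<beta>' \<phi>b \<phi>b' \<kappa>b. 0 < \<epsilon> \<Longrightarrow> \<epsilon> < \<epsilon>1 \<Longrightarrow> k \<le> kmax \<Longrightarrow>
      reflected_system T (R0 * \<epsilon>) \<mu> p q k b \<epsilon> (E * \<epsilon>) \<kappa> \<beta> \<beta>' \<phi>b \<phi>b' \<kappa>b \<Longrightarrow>
      \<exists>u w ux :: profile. bounded_profile T (K * \<epsilon>) u \<and> bounded_profile T (K * \<epsilon>) w \<and> t_derivative u w \<and>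
        (\<forall>i t. u i (t, 0) = \<phi>b i t + \<kappa>b i * u (\<not> i) (t, L)) \<and>
        (\<forall>i t x. 0 \<le> x \<longrightarrow> x \<le> L \<longrightarrow> ((\<lambda>x. u i (t, x)) has_real_derivative ux i (t, x)) (at x within {0..L})) \<and>
        (\<forall>i. continuous_on UNIV (ux i)) \<and> (\<forall>i z. \<bar>ux i z\<bar> \<le> K * \<epsilon>) \<and>
        (\<forall>i z. w i z + (\<mu> + sgn_of i * (p * u i z + q * partner L u i z)) * ux i z
          = \<beta> i z / 2 * (u i z + partner L u i z))"
    by (rule reflected_solution_small[OF L T \<mu> pq pos]) blast
  show ?thesis
  proof (rule exI[of _ \<epsilon>1], intro conjI \<epsilon>1, rule exI[of _ K], intro conjI K allI impI)
    fix \<epsilon> :: real and \<beta> :: "real \<times> real \<Rightarrow> real" and \<phi>1b \<phi>2b :: "real \<Rightarrow> real"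
    assume "0 < \<epsilon> \<and> \<epsilon> < \<epsilon>1"
    then have \<epsilon>: "0 < \<epsilon>" "\<epsilon> < \<epsilon>1" by auto
    assume H: "C2_on2 (dom_D L) \<beta> \<and>
       (\<forall>p\<in>dom_D L. \<beta>min \<le> \<beta> p \<and> \<beta> p \<le> 0 \<and>
          \<bar>partial_t (dom_D L) \<beta> p\<bar> \<le> \<epsilon> \<and> \<bar>partial_x (dom_D L) \<beta> p\<bar> \<le> \<epsilon>) \<and>
       (\<forall>(t, x)\<in>dom_D L. \<beta> (t + T, x) = \<beta> (t, x)) \<and>
       C1_on {0..} \<phi>1b \<and> (\<forall>t>0. \<phi>1b (t + T) = \<phi>1b t) \<and> C1_norm {0..} \<phi>1b \<le> ereal \<epsilon> \<and>
       C1_on {0..} \<phi>2b \<and> (\<forall>t>0. \<phi>2b (t + T) = \<phi>2b t) \<and> C1_norm {0..} \<phi>2b \<le> ereal \<epsilon>"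
    have C1: "C1_on2 (dom_D L) \<beta>" using H by (simp add: C2_on2_def)
    have \<beta>b: "\<beta>min \<le> \<beta> z" "\<beta> z \<le> 0" "\<bar>partial_t (dom_D L) \<beta> z\<bar> \<le> \<epsilon>" "\<bar>partial_x (dom_D L) \<beta> z\<bar> \<le> \<epsilon>"
      if "z \<in> dom_D L" for z
      using H that by blast+
    have \<beta>p: "\<beta> (t + T, x) = \<beta> (t, x)" if "0 \<le> t" "0 \<le> x" "x \<le> L" for t x
      using H that by (auto simp: dom_D_def)
    have O: "(0, 0) \<in> dom_D L" using L by (simp add: dom_D_def)
    define r where "r i x = (if i then x else L - x)" for i :: bool and x :: real
    have rc: "continuous_on UNIV (r i)" for i by (cases i) (auto simp: r_def intro!: continuous_intros)
    define \<beta>e :: profile where "\<beta>e = (\<lambda>i (t, x). periodic_extension T (\<lambda>s. \<beta> (s, clip L (r i x))) t)"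
    define \<beta>e' :: profile where
      "\<beta>e' = (\<lambda>i (t, x). periodic_extension T (\<lambda>s. partial_t (dom_D L) \<beta> (s, clip L (r i x))) t)"
    \<comment> \<open>The second invariant enters at x = 0 and the first at x = L, which is the
      section 0 of its reflected variable.\<close>
    define fb where "fb i = (if i then \<phi>2b else \<phi>1b)" for i :: bool
    define \<phi>b where "\<phi>b i = periodic_extension T (fb i)" for i
    define \<phi>b' where "\<phi>b' i = periodic_extension T (\<lambda>t. vector_derivative (fb i) (at t within {0..}))" for i
    define \<kappa>b where "\<kappa>b i = (if i then \<kappa>2 else \<kappa>1)" for i :: bool
    define k where "k = - \<beta> (0, 0) / (2 * \<mu>)"
    have fb: "C1_on {0..} (fb i)" "\<And>t. t > 0 \<Longrightarrow> fb i (t + T) = fb i t" "C1_norm {0..} (fb i) \<le> ereal \<epsilon>" for i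
      using H by (auto simp: fb_def)
    note bde = boundary_data_extension[OF fb T, folded \<phi>b_def \<phi>b'_def]
    have cl: "0 \<le> clip L y" "clip L y \<le> L" for y using clip_mem[OF L] by auto
    have sys: "reflected_system T (R0 * \<epsilon>) \<mu> p q k b \<epsilon> (E * \<epsilon>) \<kappa> \<beta>e \<beta>e' \<phi>b \<phi>b' \<kappa>b"
    proof
      show "k \<ge> 0" using \<beta>b(2)[OF O] \<mu> by (simp add: k_def divide_nonpos_pos)
      show "bounded_profile T b \<beta>e"
        unfolding \<beta>e_def by (intro periodic_extension_profile T L rc \<beta>p)
         (use C1 \<beta>b in \<open>force simp: C1_on2_def b_def\<close>)+
      show "bounded_profile T \<epsilon> \<beta>e'"
        unfolding \<beta>e'_def by (intro periodic_extension_profile T L rc \<beta>b partial_t_periodic[OF C1 \<beta>p T])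
         (use C1 in \<open>auto simp: C1_on2_def\<close>)
      show "t_derivative \<beta>e \<beta>e'"
        unfolding t_derivative_def \<beta>e_def \<beta>e'_def prod.case
      proof (intro allI)
        fix i t x
        show "((\<lambda>t. periodic_extension T (\<lambda>s. \<beta> (s, clip L (r i x))) t) has_real_derivative
          periodic_extension T (\<lambda>s. partial_t (dom_D L) \<beta> (s, clip L (r i x))) t) (at t)"
          by (rule periodic_extension_has_derivative)
            (use cl T \<beta>p partial_t_periodic[OF C1 \<beta>p T] C1_on2_dom_D_derivatives(1)[OF C1] in \<open>auto intro!: half_line_derivative\<close>)
      qed
      show "\<bar>\<beta>e i z / (2 * \<mu>) + k\<bar> \<le> E * \<epsilon>" for i z
      proof -
        obtain t x where z: "z = (t, x)" by fastforce
        obtain s where s: "s > 0" "periodic_extension T (\<lambda>s. \<beta> (s, clip L (r i x))) t = \<beta> (s, clip L (r i x))"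
          using periodic_extension_obtain[of "\<lambda>s. \<beta> (s, clip L (r i x))" T t] \<beta>p cl T by blast
        have "\<bar>\<beta> (s, clip L (r i x)) - \<beta> (0, 0)\<bar> \<le> \<epsilon> * (T + L)"
          by (rule slow_variation[OF C1 \<beta>p T L _ \<beta>b(3,4)]) (use s cl \<epsilon> in auto)
        then have "\<bar>(\<beta> (s, clip L (r i x)) - \<beta> (0, 0)) / (2 * \<mu>)\<bar> \<le> \<epsilon> * (T + L) / (2 * \<mu>)"
          using \<mu> by (simp add: divide_right_mono)
        moreover have "\<beta>e i z / (2 * \<mu>) + k = (\<beta> (s, clip L (r i x)) - \<beta> (0, 0)) / (2 * \<mu>)"
          by (simp add: \<beta>e_def z s k_def diff_divide_distrib)
        ultimately show ?thesis by (simp add: E_def mult.commute)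
      qed
    qed (use R0 \<epsilon> \<mu> pos RS bde in \<open>auto simp: \<kappa>b_def \<kappa>_def\<close>)
    have "k \<le> kmax"
      using \<beta>b(1)[OF O] \<mu> by (simp add: k_def kmax_def b_def divide_right_mono)
    from sol[OF \<epsilon> this sys] obtain u w ux :: profile where bu: "bounded_profile T (K * \<epsilon>) u"
      and bw: "bounded_profile T (K * \<epsilon>) w" and uw: "t_derivative u w"
      and u0: "\<And>i t. u i (t, 0) = \<phi>b i t + \<kappa>b i * u (\<not> i) (t, L)"
      and uxd: "\<And>i t x. 0 \<le> x \<Longrightarrow> x \<le> L \<Longrightarrow> ((\<lambda>x. u i (t, x)) has_real_derivative ux i (t, x)) (at x within {0..L})"
      and uxc: "\<And>i. continuous_on UNIV (ux i)" and uxb: "\<And>i z. \<bar>ux i z\<bar> \<le> K * \<epsilon>"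
      and eq: "\<And>i z. w i z + (\<mu> + sgn_of i * (p * u i z + q * partner L u i z)) * ux i z
          = \<beta>e i z / 2 * (u i z + partner L u i z)"
      by blast
    have uc: "continuous_on UNIV (u i)" "continuous_on UNIV (w i)" for i
      using bu bw by (auto simp: bounded_profile_def)
    have ub: "\<bar>u i z\<bar> \<le> K * \<epsilon>" "\<bar>w i z\<bar> \<le> K * \<epsilon>" for i z
      using bu bw by (cases z; simp add: bounded_profile_def)+
    \<comment> \<open>The reflection of the first component is undone; correspondingly its
      derivative in x changes sign in the definition of \<open>\<phi>x\<close>.\<close>
    define \<phi> :: "real \<times> real \<Rightarrow> real^2" where "\<phi> = (\<lambda>z. vector [u False (fst z, L - snd z), u True z])"
    define \<phi>t :: "real \<times> real \<Rightarrow> real^2" where "\<phi>t = (\<lambda>z. vector [w False (fst z, L - snd z), w True z])"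
    define \<phi>x :: "real \<times> real \<Rightarrow> real^2" where "\<phi>x = (\<lambda>z. vector [- ux False (fst z, L - snd z), ux True z])"
    have dt: "((\<lambda>s. \<phi> (s, x)) has_vector_derivative \<phi>t (t, x)) (at t within {0..})" for t x
      unfolding \<phi>_def \<phi>t_def fst_conv snd_conv
      by (rule has_vector_derivative_vec2) (use uw in \<open>auto simp: t_derivative_def intro: DERIV_subset\<close>)
    have dx: "((\<lambda>x. \<phi> (t, x)) has_vector_derivative \<phi>x (t, x)) (at x within {0..L})" if "0 \<le> x" "x \<le> L" for t x
      unfolding \<phi>_def \<phi>x_def fst_conv snd_conv
    proof (rule has_vector_derivative_vec2)
      have "((\<lambda>x. u False (t, L - x)) has_real_derivative ux False (t, L - x) * (- 1)) (at x within {0..L})"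
      proof (rule DERIV_image_chain[of "\<lambda>x. u False (t, x)", unfolded o_def])
        have "(\<lambda>x. L - x) ` {0..L} = {0..L}" by force
        then show "((\<lambda>x. u False (t, x)) has_real_derivative ux False (t, L - x)) (at (L - x) within (\<lambda>x. L - x) ` {0..L})"
          using uxd[of "L - x" False t] that by simp
      qed (auto intro!: derivative_eq_intros)
      then show "((\<lambda>x. u False (t, L - x)) has_real_derivative - ux False (t, L - x)) (at x within {0..L})" by simp
    qed (rule uxd[OF that])
    have cont: "continuous_on S \<phi>" "continuous_on S \<phi>t" "continuous_on S \<phi>x" for S
      unfolding \<phi>_def \<phi>t_def \<phi>x_def
      by (intro continuous_on_vec2 continuous_intros continuous_on_profile_compose[OF uc(1)]
        continuous_on_profile_compose[OF uc(2)] continuous_on_profile_compose[OF uxc]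
        continuous_on_subset[OF uc(1)] continuous_on_subset[OF uc(2)] continuous_on_subset[OF uxc] subset_UNIV)+
    have part: "C1_on2 (dom_D L) \<phi>" "\<And>z. z \<in> dom_D L \<Longrightarrow> partial_t (dom_D L) \<phi> z = \<phi>t z"
      "\<And>z. z \<in> dom_D L \<Longrightarrow> partial_x (dom_D L) \<phi> z = \<phi>x z"
      using C1_on2_dom_DI[OF L dt dx cont] by blast+
    have comp: "\<bar>\<phi> z $ 1\<bar> \<le> K * \<epsilon> \<and> \<bar>\<phi> z $ 2\<bar> \<le> K * \<epsilon>" "\<bar>\<phi>t z $ 1\<bar> \<le> K * \<epsilon> \<and> \<bar>\<phi>t z $ 2\<bar> \<le> K * \<epsilon>"
      "\<bar>\<phi>x z $ 1\<bar> \<le> K * \<epsilon> \<and> \<bar>\<phi>x z $ 2\<bar> \<le> K * \<epsilon>" for z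
      using ub uxb by (auto simp: \<phi>_def \<phi>t_def \<phi>x_def)
    have norm2: "C1_norm2 (dom_D L) \<phi> \<le> ereal (K * \<epsilon>)"
      unfolding C1_norm2_def by (intro max.boundedI sup_norm_vec2_le) (use comp part(2,3) in auto)
    have v0: "vector_derivative (\<lambda>x. \<phi> (0, x)) (at x within {0..L}) = \<phi>x (0, x)" if "x \<in> {0..L}" for x
      by (rule vector_derivative_at_convex[OF dx]) (use that Icc_not_singleton[OF L] in auto)
    have "continuous_on {0..L} (\<lambda>x. \<phi>x (0, x))"
      by (rule continuous_on_compose2[OF cont(3)[of UNIV]]) (auto intro!: continuous_intros)
    then have "continuous_on {0..L} (\<lambda>x. vector_derivative (\<lambda>x. \<phi> (0, x)) (at x within {0..L}))"
      by (rule continuous_on_eq) (simp add: v0)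
    then have C10: "C1_on {0..L} (\<lambda>x. \<phi> (0, x))"
      unfolding C1_on_def by (auto intro!: differentiableI_vector dx)
    have norm0: "C1_norm {0..L} (\<lambda>x. \<phi> (0, x)) \<le> ereal (K * \<epsilon>)"
      unfolding C1_norm_def by (intro max.boundedI sup_norm_vec2_le) (use comp v0 in auto)
    have per: "\<phi> (t + T, x) = \<phi> (t, x)" for t x
      using bu by (simp add: \<phi>_def bounded_profile_def)
    have bg: "char_speed \<gamma> (y + background \<gamma> \<rho>) $ 1 = - (\<mu> - (p * y $ 1 + q * y $ 2))"
      "char_speed \<gamma> (y + background \<gamma> \<rho>) $ 2 = \<mu> + (p * y $ 2 + q * y $ 1)" for y
    proof -
      \<comment> \<open>The background invariants are -a and a, and p - q = \<gamma> - 1, so the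
        background speeds are -\<mu> and \<mu>.\<close>
      define a where "a = sqrt \<gamma> / (\<gamma> - 1) * \<rho> powr ((\<gamma> - 1) / 2)"
      have "\<mu> = (\<gamma> - 1) * a" using assms by (simp add: \<mu>_def a_def)
      then show "char_speed \<gamma> (y + background \<gamma> \<rho>) $ 1 = - (\<mu> - (p * y $ 1 + q * y $ 2))"
        "char_speed \<gamma> (y + background \<gamma> \<rho>) $ 2 = \<mu> + (p * y $ 2 + q * y $ 1)"
        unfolding char_speed_def background_def a_def[symmetric] p_def q_def
        by (simp_all add: field_simps)
    qed
    have \<beta>e: "\<beta>e True (t, x) = \<beta> (t, x)" "\<beta>e False (t, L - x) = \<beta> (t, x)" if "0 \<le> t" "0 \<le> x" "x \<le> L" for t x
      using periodic_extension_nonneg[of "\<lambda>s. \<beta> (s, x)" T t] that \<beta>p T by (auto simp: \<beta>e_def r_def clip_id)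
    have "IBVP_solution \<gamma> \<rho> L \<kappa>1 \<kappa>2 \<beta> \<phi>1b \<phi>2b (\<lambda>x. \<phi> (0, x)) \<phi>"
      unfolding IBVP_solution_def
    proof (intro conjI ballI allI impI)
      show "C1_on2 (dom_D L) \<phi>" by (rule part(1))
      fix z i assume z: "z \<in> dom_D L"
      obtain t x where tx: "z = (t, x)" "0 \<le> t" "0 \<le> x" "x \<le> L" using z by (auto simp: dom_D_def)
      \<comment> \<open>For the first component the reflected equation is read at L - x: the sign of
        \<lambda>1 = -(\<mu> - ...) and the sign of the reflected x-derivative cancel.\<close>
      have "\<forall>i. \<phi>t z $ i + char_speed \<gamma> (\<phi> z + background \<gamma> \<rho>) $ i * \<phi>x z $ i = \<beta> z / 2 * (\<phi> z $ 1 + \<phi> z $ 2)"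
        unfolding forall_2 bg
        using eq[of False "(t, L - x)"] eq[of True "(t, x)"] \<beta>e[OF tx(2-4)]
        by (simp add: tx(1) \<phi>_def \<phi>t_def \<phi>x_def partner_def sgn_of_def algebra_simps)
      then show "partial_t (dom_D L) \<phi> z $ i + char_speed \<gamma> (\<phi> z + background \<gamma> \<rho>) $ i * partial_x (dom_D L) \<phi> z $ i
        = \<beta> z / 2 * (\<phi> z $ 1 + \<phi> z $ 2)"
        using part(2,3)[OF z] by simp
    next
      fix t :: real assume t: "t \<ge> 0"
      have "\<phi>b i t = fb i t" for i by (rule bde(7)) (use t in auto)
      then show "\<phi> (t, 0) $ 2 = \<phi>2b t + \<kappa>2 * \<phi> (t, 0) $ 1" "\<phi> (t, L) $ 1 = \<phi>1b t + \<kappa>1 * \<phi> (t, L) $ 2"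
        using u0[of True t] u0[of False t] by (auto simp: \<phi>_def fb_def \<kappa>b_def)
    qed auto
    then show "\<exists>\<phi>0 :: real \<Rightarrow> real^2.
          C1_on {0..L} \<phi>0 \<and> C1_norm {0..L} \<phi>0 \<le> ereal (K * \<epsilon>) \<and>
          (\<exists>\<phi> :: real \<times> real \<Rightarrow> real^2.
             IBVP_solution \<gamma> \<rho> L \<kappa>1 \<kappa>2 \<beta> \<phi>1b \<phi>2b \<phi>0 \<phi> \<and>
             (\<forall>(t, x)\<in>dom_D L. \<phi> (t + T, x) = \<phi> (t, x)) \<and>
             C1_norm2 (dom_D L) \<phi> \<le> ereal (K * \<epsilon>))"
      using C10 norm0 norm2 per by (intro exI[of _ "\<lambda>x. \<phi> (0, x)"] conjI exI[of _ \<phi>]) auto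
  qed
qed

end
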